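(* Let $n\ge2$ and let $P$ be a simple $K_{1,n}$-module. For $i\in\{1,\dots,n\}$, the filtration of $F(P,N_{n,1}(e_i))$ by $\mathcal{S}'(1,n)$-submodules $$0\subseteq\mathrm{diff}(F(P,N_{n,1}(\mathbf{0})))\subseteq\tilde F(P,e_i)\subseteq F(P,N_{n,1}(e_i))$$ satisfies the following properties. (1) If $P\cong A_{1,n}$, then $\mathrm{diff}(F(P,N_{n,1}(\mathbf{0})))\cong A_{1,n}/\mathbb{C}$, which has a unique nontrivial simple subquotient $\Delta A_{1,n}/\mathbb{C}$. (2) If $P\ncong A_{1,n}$, then $\mathrm{diff}(F(P,N_{n,1}(\mathbf{0})))\cong F(P,N_{n,1}(\mathbf{0}))=P$, which has a unique simple submodule $\Delta P$, with the corresponding quotient $P/\Delta P$ being either zero or a trivial module. (3) $\tilde F(P,e_i)/\mathrm{diff}(F(P,N_{n,1}(\mathbf{0})))$ is either zero or a trivial module. (4) $F(P,N_{n,1}(e_i))/\tilde F(P,e_i)\cong\mathrm{diff}(F(P,N_{n,1}(e_i)))$ is simple. In particular, $F(P,N_{n,1}(e_i))$ is not simple.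
   Context: All vector spaces are over $\mathbb{C}$; $n\ge 2$; modules over superalgebras are $\mathbb{Z}_2$-graded. A module $M$ over an algebra $A$ is trivial if $M\neq0$ and $AM=0$. $[1,n]=\{1,\dots,n\}$; $e_i$ is the $i$-th standard basis vector of $\mathbb{C}^n$, $\mathbf{0}=(0,\dots,0)$; $|\lambda|=\lambda_1+\dots+\lambda_n$. The algebra $\mathcal{S}'(1,n)$. $\Lambda(n)$ is the exterior algebra in odd variables $\xi_1,\dots,\xi_n$; for $I=\{i_1<\dots<i_r\}\subseteq[1,n]$, $\xi_I=\xi_{i_1}\cdots\xi_{i_r}$, $\xi_\varnothing=1$. $\mathcal{W}(1,n)=\mathrm{Der}(\mathbb{C}[t^{\pm1}]\otimes\Lambda(n))$ is the Lie superalgebra of superderivations $f_0\frac{d}{dt}+\sum_i f_i\frac{\partial}{\partial\xi_i}$. $\mathcal{S}(1,n)\subset\mathcal{W}(1,n)$ is the subalgebra of superderivations with zero superdivergence, i.e. $\frac{d(f_0)}{dt}+\sum_i(-1)^{|f_i|}\frac{\partial(f_i)}{\partial\xi_i}=0$, and $\mathcal{S}'(1,n)=[\mathcal{S}(1,n),\mathcal{S}(1,n)]$. It is spanned by $t^k\frac{\partial(\xi_I)}{\partial\xi_i}\frac{d}{dt}+(-1)^{1+|I|}kt^{k-1}\xi_I\frac{\partial}{\partial\xi_i}$ and $t^k\frac{\partial(\xi_I)}{\partial\xi_i}\frac{\partial}{\partial\xi_j}+t^k\frac{\partial(\xi_I)}{\partial\xi_j}\frac{\partial}{\partial\xi_i}$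 ($k\in\mathbb{Z}$, $I\subseteq[1,n]$, $i,j\in[1,n]$). $\mathfrak{gl}(1,n)$ has basis $E_{i,j}$, $0\le i,j\le n$ (odd: $E_{0,i},E_{i,0}$ with $i\ge1$; the others even), with the supercommutator bracket; $\mathfrak{sl}(1,n)=\{A:\ a_{0,0}-\sum_{i\ge1}a_{i,i}=0\}$. Shen-Larsson modules. $K_{1,n}=\mathbb{C}[t^{\pm1},\xi_1,\dots,\xi_n,\frac{d}{dt},\frac{\partial}{\partial\xi_1},\dots,\frac{\partial}{\partial\xi_n}]$ is the Weyl superalgebra. There is a Lie superalgebra homomorphism $\pi:\mathcal{W}(1,n)\to K_{1,n}\otimes U(\mathfrak{gl}(1,n))$ (super tensor product) given by $$\pi(t^k\xi_I\tfrac{d}{dt})=t^k\xi_I\tfrac{d}{dt}\otimes1+kt^{k-1}\xi_I\otimes E_{0,0}+(-1)^{|I|-1}\sum_{s=1}^n\tfrac{\partial(t^k\xi_I)}{\partial\xi_s}\otimes E_{s,0},$$ $$\pi(t^k\xi_I\tfrac{\partial}{\partial\xi_i})=t^k\xi_I\tfrac{\partial}{\partial\xi_i}\otimes1+kt^{k-1}\xi_I\otimes E_{0,i}+(-1)^{|I|-1}\sum_{s=1}^n\tfrac{\partial(t^k\xi_I)}{\partial\xi_s}\otimes E_{s,i},$$ and $\pi(\mathcal{S}'(1,n))\subseteq K_{1,n}\otimes U(\mathfrak{sl}(1,n))$. For a $K_{1,n}$-module $P$ and an $\mathfrak{sl}(1,n)$-module $M$, $F(P,M)$ is the $\mathcal{S}'(1,n)$-module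 $P\otimes M$ with $x\cdot(p\otimes v)=\pi(x)(p\otimes v)$, where $(a\otimes b)(p\otimes v)=(-1)^{|b||p|}ap\otimes bv$. The modules $N_{n,1}(\lambda)$. $K^+_{n,1}=\mathbb{C}[t_1,\dots,t_n,\xi,\frac{\partial}{\partial t_1},\dots,\frac{\partial}{\partial t_n},\frac{\partial}{\partial\xi}]$ with one odd variable $\xi$. Here only $\lambda\in\mathbb{Z}_+^n$ (nonnegative integers) is needed: then $A^+_{n,1}(\lambda)=\mathbb{C}[t_1,\dots,t_n]\otimes\Lambda(1)$ with $\Lambda(1)=\mathbb{C}\oplus\mathbb{C}\xi$, a $K^+_{n,1}$-module, which is a $\mathfrak{gl}(1,n)$-module via $E_{0,0}\mapsto\xi\frac{\partial}{\partial\xi}$, $E_{i,j}\mapsto t_i\frac{\partial}{\partial t_j}$, $E_{0,l}\mapsto\xi\frac{\partial}{\partial t_l}$, $E_{l,0}\mapsto t_l\frac{\partial}{\partial\xi}$ ($i,j,l\in[1,n]$), and $$N_{n,1}(\lambda)=\Big\{v\in A^+_{n,1}(\lambda):\Big(\xi\tfrac{\partial}{\partial\xi}+\sum_{s=1}^nt_s\tfrac{\partial}{\partial t_s}\Big)v=|\lambda|v\Big\},$$ a simple $\mathfrak{sl}(1,n)$-module. $N_{n,1}(\mathbf{0})=\mathbb{C}$ is trivial, and $F(P,N_{n,1}(\mathbf{0}))$ is identified with $P$. The map diff. The element $\mathrm{diff}=\frac{d}{dt}\otimes\xi-\sum_{s=1}^n\frac{\partial}{\partial\xi_s}\otimes t_s\in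 K_{1,n}\otimes K^+_{n,1}$ acts on $P\otimes A^+_{n,1}(\lambda)$; it satisfies $\mathrm{diff}^2=0$ and $[\mathrm{diff},\pi(x)]=0$ for all $x\in\mathcal{W}(1,n)$. Put $\tilde F(P,\lambda)=\{v\in F(P,N_{n,1}(\lambda)):\mathrm{diff}(v)=0\}$. $A_{1,n}=\mathbb{C}[t^{\pm1}]\otimes\Lambda(n)$ is the natural simple weight $K_{1,n}$-module, with constants $\mathbb{C}\subset A_{1,n}$. For a $K_{1,n}$-module $P$, $\Delta P=\frac{d}{dt}P+\sum_{i=1}^n\frac{\partial}{\partial\xi_i}P$, an $\mathcal{S}'(1,n)$-submodule of $P$. *)

theory Defs
  imports Complex_Main "HOL-Library.Poly_Mapping" "HOL-Library.Z2"
    "HOL-Library.Function_Algebras" "HOL-Library.Cardinality"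
begin

text \<open>
  The index set \<open>[1,n]\<close> is a finite linearly ordered type \<open>'n\<close> with \<open>CARD('n) = n\<close>; the index set
  \<open>[0,n]\<close> is \<open>'n option\<close>, where \<open>None\<close> plays the role of \<open>0\<close>.  Parities are elements of the
  two-element field \<^typ>\<open>bit\<close>.  A vector space with a distinguished basis indexed by \<open>'b\<close> is
  the type \<^typ>\<open>'b \<Rightarrow>\<^sub>0 complex\<close> of finitely supported functions.
\<close>

definition ksign :: "bit \<Rightarrow> complex" where
  "ksign p = (if p = 0 then 1 else - 1)"

abbreviation cscale :: "complex \<Rightarrow> ('b \<Rightarrow>\<^sub>0 complex) \<Rightarrow> ('b \<Rightarrow>\<^sub>0 complex)" where
  "cscale c \<equiv> Poly_Mapping.map ((*) c)"

definition lin_ext :: "('b \<Rightarrow> ('c \<Rightarrow>\<^sub>0 complex)) \<Rightarrow> ('b \<Rightarrow>\<^sub>0 complex) \<Rightarrow> ('c \<Rightarrow>\<^sub>0 complex)" where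
  "lin_ext g f = (\<Sum>b\<in>Poly_Mapping.keys f. cscale (Poly_Mapping.lookup f b) (g b))"


section \<open>Supermodules\<close>

text \<open>
  A supermodule has its own carrier and operations, so that quotients can be formed by cosets.
  Its action is used only on the elements of an (associative or Lie) superalgebra \<open>G\<close>, which is
  passed separately, together with its homogeneous components where they are needed.
\<close>

record ('x, 'm) smod =
  carrier :: "'m set"
  add :: "'m \<Rightarrow> 'm \<Rightarrow> 'm"
  zero :: 'm
  smult :: "complex \<Rightarrow> 'm \<Rightarrow> 'm"
  part :: "bit \<Rightarrow> 'm set"
  act :: "'x \<Rightarrow> 'm \<Rightarrow> 'm"

definition submod :: "'x set \<Rightarrow> ('x, 'm) smod \<Rightarrow> 'm set \<Rightarrow> bool" where
  "submod G M N \<longleftrightarrow>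
     N \<subseteq> carrier M \<and> zero M \<in> N \<and>
     (\<forall>u\<in>N. \<forall>v\<in>N. add M u v \<in> N) \<and>
     (\<forall>c. \<forall>v\<in>N. smult M c v \<in> N) \<and>
     (\<forall>x\<in>G. \<forall>v\<in>N. act M x v \<in> N) \<and>
     (\<forall>v\<in>N. \<exists>v0 \<in> N \<inter> part M 0. \<exists>v1 \<in> N \<inter> part M 1. v = add M v0 v1)"

definition restr :: "('x, 'm) smod \<Rightarrow> 'm set \<Rightarrow> ('x, 'm) smod" where
  "restr M N = M\<lparr>carrier := N, part := (\<lambda>p. part M p \<inter> N)\<rparr>"

definition coset :: "('x, 'm) smod \<Rightarrow> 'm set \<Rightarrow> 'm \<Rightarrow> 'm set" where
  "coset M N v = add M v ` N"

definition quot :: "('x, 'm) smod \<Rightarrow> 'm set \<Rightarrow> ('x, 'm set) smod" where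
  "quot M N = \<lparr>carrier = coset M N ` carrier M,
     add = (\<lambda>A B. {add M a b | a b. a \<in> A \<and> b \<in> B}),
     zero = N,
     smult = (\<lambda>c A. \<Union>a\<in>A. coset M N (smult M c a)),
     part = (\<lambda>p. coset M N ` part M p),
     act = (\<lambda>x A. \<Union>a\<in>A. coset M N (act M x a))\<rparr>"

definition zero_mod :: "('x, 'm) smod \<Rightarrow> bool" where
  "zero_mod M \<longleftrightarrow> carrier M = {zero M}"

definition trivial_mod :: "'x set \<Rightarrow> ('x, 'm) smod \<Rightarrow> bool" where
  "trivial_mod G M \<longleftrightarrow>
     (\<exists>v\<in>carrier M. v \<noteq> zero M) \<and> (\<forall>x\<in>G. \<forall>v\<in>carrier M. act M x v = zero M)"

definition simple_mod :: "'x set \<Rightarrow> ('x, 'm) smod \<Rightarrow> bool" where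
  "simple_mod G M \<longleftrightarrow>
     (\<exists>v\<in>carrier M. v \<noteq> zero M) \<and>
     (\<forall>N. submod G M N \<longrightarrow> N = {zero M} \<or> N = carrier M)"

text \<open>
  Isomorphisms are homogeneous of some parity \<open>e\<close>, i.e. parity-reversing ones are allowed; an odd
  isomorphism commutes with the action up to the usual sign.  The homogeneous elements of parity
  \<open>p\<close> of the superalgebra are \<open>G p\<close>.
\<close>

definition iso_mod :: "(bit \<Rightarrow> 'x set) \<Rightarrow> ('x, 'm) smod \<Rightarrow> ('x, 'k) smod \<Rightarrow> bool" where
  "iso_mod G M M' \<longleftrightarrow> (\<exists>e h.
     bij_betw h (carrier M) (carrier M') \<and>
     (\<forall>u\<in>carrier M. \<forall>v\<in>carrier M. h (add M u v) = add M' (h u) (h v)) \<and>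
     (\<forall>c. \<forall>v\<in>carrier M. h (smult M c v) = smult M' c (h v)) \<and>
     (\<forall>p. h ` part M p \<subseteq> part M' (p + e)) \<and>
     (\<forall>p. \<forall>x\<in>G p. \<forall>v\<in>carrier M. h (act M x v) = smult M' (ksign (p * e)) (act M' x (h v))))"


section \<open>The superalgebra \<open>A = \<complex>[t, t\<^sup>-\<^sup>1] \<otimes> \<Lambda>(n)\<close>\<close>

text \<open>The basis vector \<open>(k, I)\<close> is \<open>t\<^sup>k \<xi>\<^sub>I\<close>.\<close>

type_synonym 'n lau = "(int \<times> 'n set) \<Rightarrow>\<^sub>0 complex"
type_synonym 'n oper = "'n lau \<Rightarrow> 'n lau"

definition mon :: "int \<Rightarrow> 'n set \<Rightarrow> 'n lau" where
  "mon k I = Poly_Mapping.single (k, I) 1"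

text \<open>The sign counts the transpositions needed to sort \<open>\<xi>\<^sub>I \<xi>\<^sub>J\<close>.\<close>

definition amult :: "'n::{finite,linorder} lau \<Rightarrow> 'n lau \<Rightarrow> 'n lau" where
  "amult f g =
     lin_ext (\<lambda>(k, I). lin_ext (\<lambda>(l, J).
       if I \<inter> J = {}
       then cscale ((- 1) ^ card {(i, j). i \<in> I \<and> j \<in> J \<and> j < i}) (mon (k + l) (I \<union> J))
       else 0) g) f"

definition d_t :: "'n oper" where
  "d_t = lin_ext (\<lambda>(k, I). cscale (of_int k) (mon (k - 1) I))"

definition d_xi :: "'n::{finite,linorder} \<Rightarrow> 'n oper" where
  "d_xi i = lin_ext (\<lambda>(k, I).
     if i \<in> I then cscale ((- 1) ^ card {j \<in> I. j < i}) (mon k (I - {i})) else 0)"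

text \<open>\<open>d/dt\<close> for index \<open>0\<close>, and \<open>\<partial>/\<partial>\<xi>\<^sub>i\<close> for \<open>i \<in> [1,n]\<close>.\<close>

definition d_var :: "'n::{finite,linorder} option \<Rightarrow> 'n oper" where
  "d_var j = (case j of None \<Rightarrow> d_t | Some i \<Rightarrow> d_xi i)"

definition lau_part :: "bit \<Rightarrow> 'n lau set" where
  "lau_part p = {f. \<forall>(k, I) \<in> Poly_Mapping.keys f. of_nat (card I) = p}"

text \<open>\<open>f \<mapsto> (-1)\<^bsup>|f|\<^esup> f\<close>, extended linearly.\<close>

definition lau_sigma :: "'n oper" where
  "lau_sigma = lin_ext (\<lambda>(k, I). cscale ((- 1) ^ card I) (mon k I))"

definition oper_part :: "bit \<Rightarrow> 'n oper set" where
  "oper_part p = {x. \<forall>q. x ` lau_part q \<subseteq> lau_part (p + q)}"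

abbreviation homog :: "'n oper set \<Rightarrow> bit \<Rightarrow> 'n oper set" where
  "homog G p \<equiv> G \<inter> oper_part p"


section \<open>The Weyl superalgebra and the Lie superalgebras of superderivations\<close>

text \<open>
  The Weyl superalgebra acts faithfully on \<open>A\<close> and is taken as an algebra of operators there; thus
  it contains the superderivations, and its modules are modules over the latter by restriction.
\<close>

inductive_set weyl :: "'n::{finite,linorder} oper set" where
  "amult (mon 1 {}) \<in> weyl"
| "amult (mon (- 1) {}) \<in> weyl"
| "amult (mon 0 {i}) \<in> weyl"
| "d_t \<in> weyl"
| "d_xi i \<in> weyl"
| "id \<in> weyl"
| "x \<in> weyl \<Longrightarrow> (\<lambda>f. cscale c (x f)) \<in> weyl"
| "x \<in> weyl \<Longrightarrow> y \<in> weyl \<Longrightarrow> x + y \<in> weyl"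
| "x \<in> weyl \<Longrightarrow> y \<in> weyl \<Longrightarrow> x \<circ> y \<in> weyl"

definition superder :: "bit \<Rightarrow> 'n::{finite,linorder} oper set" where
  "superder p = {x \<in> oper_part p. Vector_Spaces.linear cscale cscale x \<and>
     (\<forall>q. \<forall>f \<in> lau_part q. \<forall>g.
        x (amult f g) = amult (x f) g + cscale (ksign (p * q)) (amult f (x g)))}"

definition W_alg :: "'n::{finite,linorder} oper set" where
  "W_alg = {x + y | x y. x \<in> superder 0 \<and> y \<in> superder 1}"

text \<open>
  The coefficients \<open>f\<^sub>0 = x(t)\<close> and \<open>f\<^sub>i = x(\<xi>\<^sub>i)\<close> of
  \<open>x = f\<^sub>0 d/dt + \<Sum>\<^sub>i f\<^sub>i \<partial>/\<partial>\<xi>\<^sub>i\<close>.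
\<close>

definition coef :: "'n oper \<Rightarrow> 'n option \<Rightarrow> 'n lau" where
  "coef x j = (case j of None \<Rightarrow> x (mon 1 {}) | Some i \<Rightarrow> x (mon 0 {i}))"

definition superdiv :: "'n::{finite,linorder} oper \<Rightarrow> 'n lau" where
  "superdiv x = d_t (coef x None) + (\<Sum>i\<in>UNIV. d_xi i (lau_sigma (coef x (Some i))))"

definition S_alg :: "'n::{finite,linorder} oper set" where
  "S_alg = {x \<in> W_alg. superdiv x = 0}"

definition sbracket :: "bit \<Rightarrow> bit \<Rightarrow> 'n oper \<Rightarrow> 'n oper \<Rightarrow> 'n oper" where
  "sbracket p q x y = (\<lambda>f. x (y f) - cscale (ksign (p * q)) (y (x f)))"

definition S'_alg :: "'n::{finite,linorder} oper set" where
  "S'_alg = module.span (\<lambda>c x f. cscale c (x f))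
     {sbracket p q x y | p q x y. x \<in> homog S_alg p \<and> y \<in> homog S_alg q}"


section \<open>Modules over the Weyl superalgebra\<close>

text \<open>The underlying vector space of such a module is a whole type.\<close>

definition weyl_module :: "('n::{finite,linorder} oper, 'p::ab_group_add) smod \<Rightarrow> bool" where
  "weyl_module P \<longleftrightarrow>
     carrier P = UNIV \<and> add P = (+) \<and> zero P = 0 \<and>
     vector_space (smult P) \<and>
     (\<forall>p. module.subspace (smult P) (part P p)) \<and>
     (\<forall>v. \<exists>!w. w \<in> part P 0 \<and> v - w \<in> part P 1) \<and>
     (\<forall>x\<in>weyl. Vector_Spaces.linear (smult P) (smult P) (act P x)) \<and>
     (\<forall>v. act P id v = v) \<and>
     (\<forall>c. \<forall>x\<in>weyl. \<forall>v. act P (\<lambda>f. cscale c (x f)) v = smult P c (act P x v)) \<and>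
     (\<forall>x\<in>weyl. \<forall>y\<in>weyl. \<forall>v. act P (x + y) v = act P x v + act P y v) \<and>
     (\<forall>x\<in>weyl. \<forall>y\<in>weyl. \<forall>v. act P (x \<circ> y) v = act P x (act P y v)) \<and>
     (\<forall>p q. \<forall>x \<in> homog weyl p. \<forall>v \<in> part P q. act P x v \<in> part P (p + q))"

definition A_mod :: "('n oper, 'n lau) smod" where
  "A_mod = \<lparr>carrier = UNIV, add = (+), zero = 0, smult = cscale, part = lau_part,
     act = (\<lambda>x. x)\<rparr>"

definition constants :: "'n lau set" where
  "constants = range (\<lambda>c. cscale c (mon 0 {}))"

definition Delta :: "('n::{finite,linorder} oper, 'p::ab_group_add) smod \<Rightarrow> 'p set" where
  "Delta P = {act P d_t v + (\<Sum>i\<in>UNIV. act P (d_xi i) (w i)) | v w. True}"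

definition hcomp :: "('x, 'p::ab_group_add) smod \<Rightarrow> bit \<Rightarrow> 'p \<Rightarrow> 'p" where
  "hcomp P r v = (THE w. w \<in> part P r \<and> v - w \<in> part P (r + 1))"

text \<open>\<open>v \<mapsto> (-1)\<^bsup>q|v|\<^esup> v\<close>, extended linearly.\<close>

definition twist :: "('x, 'p::ab_group_add) smod \<Rightarrow> bit \<Rightarrow> 'p \<Rightarrow> 'p" where
  "twist P q v = hcomp P 0 v + smult P (ksign q) (hcomp P 1 v)"


section \<open>The \<open>gl(1,n)\<close>-module \<open>\<complex>[t\<^sub>1, \<dots>, t\<^sub>n] \<otimes> \<Lambda>(1)\<close>\<close>

text \<open>The basis vector \<open>(a, e)\<close> is \<open>t\<^sub>1\<^bsup>a 1\<^esup> \<cdots> t\<^sub>n\<^bsup>a n\<^esup> \<xi>\<^bsup>e\<^esup>\<close>.\<close>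

type_synonym 'n pmon = "('n \<Rightarrow> nat) \<times> bit"
type_synonym 'n pol = "'n pmon \<Rightarrow>\<^sub>0 complex"

text \<open>
  Multiplication by, and derivative with respect to, the variable with index \<open>j \<in> [0,n]\<close>, the
  variable with index \<open>0\<close> being \<open>\<xi>\<close>.
\<close>

definition vmul :: "'n option \<Rightarrow> 'n pol \<Rightarrow> 'n pol" where
  "vmul j = lin_ext (\<lambda>(a, e). case j of
       None \<Rightarrow> (if e = 0 then Poly_Mapping.single (a, 1) 1 else 0)
     | Some s \<Rightarrow> Poly_Mapping.single (a(s := a s + 1), e) 1)"

definition vder :: "'n option \<Rightarrow> 'n pol \<Rightarrow> 'n pol" where
  "vder j = lin_ext (\<lambda>(a, e). case j of
       None \<Rightarrow> (if e = 1 then Poly_Mapping.single (a, 0) 1 else 0)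
     | Some s \<Rightarrow> Poly_Mapping.single (a(s := a s - 1), e) (of_nat (a s)))"

definition vpar :: "'n option \<Rightarrow> bit" where
  "vpar j = (if j = None then 1 else 0)"

definition E_op :: "'n option \<Rightarrow> 'n option \<Rightarrow> 'n pol \<Rightarrow> 'n pol" where
  "E_op i j = vmul i \<circ> vder j"

definition N_mod :: "('n::finite \<Rightarrow> nat) \<Rightarrow> 'n pol set" where
  "N_mod lam = {v. (\<Sum>j\<in>UNIV. vmul j (vder j v)) = cscale (of_nat (\<Sum>s\<in>UNIV. lam s)) v}"

definition unit_vec :: "'n \<Rightarrow> 'n \<Rightarrow> nat" where
  "unit_vec i = (\<lambda>s. if s = i then 1 else 0)"


section \<open>Shen--Larsson modules\<close>

text \<open>
  The tensor product of \<open>P\<close> with \<^typ>\<open>'b \<Rightarrow>\<^sub>0 complex\<close> is realised as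
  \<^typ>\<open>'b \<Rightarrow>\<^sub>0 'p\<close>, the direct sum of copies of \<open>P\<close> indexed by \<open>'b\<close>.
\<close>

definition tens :: "('x, 'p::ab_group_add) smod \<Rightarrow> 'p \<Rightarrow> ('b \<Rightarrow>\<^sub>0 complex) \<Rightarrow> ('b \<Rightarrow>\<^sub>0 'p)" where
  "tens P v f = Poly_Mapping.map (\<lambda>c. smult P c v) f"

definition tscale :: "('x, 'p::ab_group_add) smod \<Rightarrow> complex \<Rightarrow> ('b \<Rightarrow>\<^sub>0 'p) \<Rightarrow> ('b \<Rightarrow>\<^sub>0 'p)" where
  "tscale P c u = Poly_Mapping.map (smult P c) u"

text \<open>
  The operator \<open>a \<otimes> b\<close> for \<open>b\<close> of parity \<open>q\<close>, i.e.
  \<open>v \<otimes> f \<mapsto> (-1)\<^bsup>q|v|\<^esup> a v \<otimes> b f\<close>.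
\<close>

definition otens :: "('n oper, 'p::ab_group_add) smod \<Rightarrow> 'n oper \<Rightarrow> bit \<Rightarrow> ('n pol \<Rightarrow> 'n pol) \<Rightarrow>
    ('n pmon \<Rightarrow>\<^sub>0 'p) \<Rightarrow> ('n pmon \<Rightarrow>\<^sub>0 'p)" where
  "otens P a q b u =
     (\<Sum>m\<in>Poly_Mapping.keys u. tens P (act P a (twist P q (Poly_Mapping.lookup u m))) (b (Poly_Mapping.single m 1)))"

text \<open>
  The image under \<open>\<pi>\<close> of \<open>t\<^sup>k \<xi>\<^sub>I d/dt\<close> (for \<open>j = None\<close>) and of
  \<open>t\<^sup>k \<xi>\<^sub>I \<partial>/\<partial>\<xi>\<^sub>i\<close> (for \<open>j = Some i\<close>), acting on the tensor product.
\<close>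

definition pi_basis :: "('n::{finite,linorder} oper, 'p::ab_group_add) smod \<Rightarrow>
    int \<Rightarrow> 'n set \<Rightarrow> 'n option \<Rightarrow> ('n pmon \<Rightarrow>\<^sub>0 'p) \<Rightarrow> ('n pmon \<Rightarrow>\<^sub>0 'p)" where
  "pi_basis P k I j u =
     otens P (amult (mon k I) \<circ> d_var j) 0 id u
     + tscale P (of_int k)
         (otens P (amult (mon (k - 1) I)) (vpar (None :: 'n option) + vpar j) (E_op None j) u)
     + tscale P ((- 1) ^ (card I + 1))
         (\<Sum>s\<in>UNIV. otens P (amult (d_xi s (mon k I))) (vpar (Some s) + vpar j)
            (E_op (Some s) j) u)"

definition pi_act :: "('n::{finite,linorder} oper, 'p::ab_group_add) smod \<Rightarrow>
    'n oper \<Rightarrow> ('n pmon \<Rightarrow>\<^sub>0 'p) \<Rightarrow> ('n pmon \<Rightarrow>\<^sub>0 'p)" where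
  "pi_act P x u =
     (\<Sum>j\<in>UNIV. \<Sum>(k, I)\<in>Poly_Mapping.keys (coef x j). tscale P (Poly_Mapping.lookup (coef x j) (k, I)) (pi_basis P k I j u))"

definition tensor_mod :: "('n::{finite,linorder} oper, 'p::ab_group_add) smod \<Rightarrow>
    ('n oper, 'n pmon \<Rightarrow>\<^sub>0 'p) smod" where
  "tensor_mod P = \<lparr>carrier = UNIV, add = (+), zero = 0, smult = tscale P,
     part = (\<lambda>p. {u. \<forall>(a, e) \<in> Poly_Mapping.keys u. Poly_Mapping.lookup u (a, e) \<in> part P (p + e)}),
     act = pi_act P\<rparr>"

text \<open>\<open>F(P, N(\<lambda>))\<close> as a submodule of \<open>P \<otimes> (\<complex>[t\<^sub>1, \<dots>, t\<^sub>n] \<otimes> \<Lambda>(1))\<close>.\<close>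

definition F_mod :: "('n::{finite,linorder} oper, 'p::ab_group_add) smod \<Rightarrow> ('n \<Rightarrow> nat) \<Rightarrow>
    ('n oper, 'n pmon \<Rightarrow>\<^sub>0 'p) smod" where
  "F_mod P lam =
     restr (tensor_mod P) (module.span (tscale P) {tens P v f | v f. f \<in> N_mod lam})"

definition diff :: "('n::{finite,linorder} oper, 'p::ab_group_add) smod \<Rightarrow>
    ('n pmon \<Rightarrow>\<^sub>0 'p) \<Rightarrow> ('n pmon \<Rightarrow>\<^sub>0 'p)" where
  "diff P u = otens P d_t 1 (vmul None) u - (\<Sum>s\<in>UNIV. otens P (d_xi s) 0 (vmul (Some s)) u)"

definition diff_image :: "('n::{finite,linorder} oper, 'p::ab_group_add) smod \<Rightarrow> ('n \<Rightarrow> nat) \<Rightarrow>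
    ('n pmon \<Rightarrow>\<^sub>0 'p) set" where
  "diff_image P lam = diff P ` carrier (F_mod P lam)"

definition F_tilde :: "('n::{finite,linorder} oper, 'p::ab_group_add) smod \<Rightarrow> ('n \<Rightarrow> nat) \<Rightarrow>
    ('n pmon \<Rightarrow>\<^sub>0 'p) set" where
  "F_tilde P lam = {v \<in> carrier (F_mod P lam). diff P v = 0}"

end

theory Submission
  imports Defs
begin

text \<open>
  The algebra \<open>S'\<close> contains \<open>g \<partial>\<^sub>i\<close> whenever \<open>\<partial>\<^sub>i g = 0\<close> (bracket with \<open>\<xi>\<^sub>i \<partial>\<^sub>i - \<xi>\<^sub>j \<partial>\<^sub>j\<close>), and also
  \<open>d/dt\<close> and \<open>\<xi>\<^sub>j d/dt\<close>; these elements suffice for all simplicity statements.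

  For an \<open>S'\<close>-submodule \<open>X\<close> of \<open>P\<close>, the space \<open>Y\<^sub>j\<close> of all \<open>q\<close> with \<open>\<partial>\<^sub>j f q \<in> X\<close> for every \<open>f \<in> A\<close> is
  stable under the Weyl superalgebra, hence \<open>0\<close> or \<open>P\<close>.  The products \<open>(g \<partial>\<^sub>i) \<partial>\<^sub>l\<close> and
  \<open>(g \<partial>\<^sub>i) (\<xi>\<^sub>i \<partial>\<^sub>l)\<close> show that it is \<open>P\<close> unless all \<open>\<partial>\<^sub>l\<close> kill \<open>X\<close>; hence \<open>\<Delta>P \<subseteq> X\<close>.  A vector killed by all
  \<open>\<partial>\<^sub>l\<close> generates a copy of \<open>A\<close>.  Conversely \<open>S' P \<subseteq> \<Delta>P\<close>, because a divergence-free superderivation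
  can be written as \<open>\<Sum>\<^sub>j \<partial>\<^sub>j \<circ> g\<^sub>j\<close>.

  Elements of \<open>P \<otimes> A\<^sup>+\<close> are \<open>P\<close>-valued differential forms, \<open>diff\<close> is the exterior derivative, and
  \<open>\<pi>(x)\<close> is a Lie derivative: it satisfies Cartan's formula \<open>\<pi>(x) = diff \<circ> \<iota>\<^sub>1 + \<iota>\<^sub>2 \<circ> diff\<close> with contractions
  \<open>\<iota>\<^sub>1, \<iota>\<^sub>2\<close>.  So closed forms are mapped to exact ones.  If \<open>X\<close> is a submodule of the one-forms that
  contains the closed ones, then combinations such as \<open>\<pi>(t g \<partial>\<^sub>a) - \<pi>(g \<partial>\<^sub>a) t\<close> isolate single components
  of \<open>\<partial>\<^sub>a\<close>-contractions of \<open>du\<close>, \<open>u \<in> X\<close>, and the argument with \<open>Y\<^sub>j\<close>, applied to the space of all \<open>q\<close> with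
  \<open>f q \<otimes> \<xi> \<in> X\<close> for every \<open>f\<close>, shows that \<open>X\<close> consists of all one-forms as soon as it contains a form
  that is not closed.

  Gradings are expressed by the parity operator \<open>\<sigma>\<close>: a subspace is graded iff it is stable under
  \<open>\<sigma>\<close>, and all sign rules become commutation rules with \<open>\<sigma>\<close> that hold for inhomogeneous elements.
\<close>

text \<open>The shaping obstacle: \<open>S'\<close> offers only \<open>g d_xi i\<close> with
  \<open>d_xi i g = 0\<close>, whereas simplicity of \<open>P\<close> over the Weyl superalgebra can
  be exploited only for subspaces stable under multiplication by all functions. The identity
  \<open>mon_split\<close> bridges the gap: every f is g0 - g1 xi_i with g0 and g1 killed by
  \<open>d_xi i\<close>, so such coefficients suffice once they are handled with and without one
  extra factor xi_i. A second index enters twice: in the bracket producing \<open>g d_xi i\<close>,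
  and to have nonzero mixed derivatives D_i D_j. For one-forms, failure of closedness is detected on
  the diagonal terms D_a u_a, where u_a is the coefficient of d xi_a. Applying fields with
  coefficient xi_b spreads information from diagonal to off-diagonal terms and back. If some other
  odd derivative of a diagonal term is nonzero, the Weyl argument applies; if all of them vanish,
  multiplying by powers of t shows that the diagonal term itself is zero. Isomorphisms of odd parity
  are unavoidable: \<open>diff\<close> is odd, and f \<mapsto> f v from \<open>A\<close> to
  \<open>P\<close> is odd when v is odd.\<close>

section \<open>Finitely supported functions and linear maps between them\<close>

abbreviation cf :: "('b \<Rightarrow>\<^sub>0 'c::zero) \<Rightarrow> 'b \<Rightarrow> 'c" where "cf \<equiv> Poly_Mapping.lookup"
abbreviation supp :: "('b \<Rightarrow>\<^sub>0 'c::zero) \<Rightarrow> 'b set" where "supp \<equiv> Poly_Mapping.keys"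

lemma lookup_map0: "f 0 = 0 \<Longrightarrow> cf (Poly_Mapping.map f g) k = f (cf g k)"
  by (simp add: map.rep_eq when_def)

lemma lookup_cscale [simp]: "cf (cscale c f) b = c * cf f b"
  by (simp add: lookup_map0)

lemma cscale_add_right: "cscale c (f + g) = cscale c f + cscale c g"
  by (rule poly_mapping_eqI) (simp add: lookup_add ring_distribs)

lemma cscale_diff_right: "cscale c (f - g) = cscale c f - cscale c g"
  by (rule poly_mapping_eqI) (simp add: lookup_minus ring_distribs)

lemma cscale_cscale [simp]: "cscale c (cscale d f) = cscale (c * d) f"
  by (rule poly_mapping_eqI) simp

lemma cscale_one [simp]: "cscale 1 f = f"
  by (rule poly_mapping_eqI) simp

lemma cscale_zero_left [simp]: "cscale 0 f = 0"
  by (rule poly_mapping_eqI) simp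

lemma cscale_zero [simp]: "cscale c 0 = 0"
  by (rule poly_mapping_eqI) simp

lemma cscale_minus_left [simp]: "cscale (- c) f = - cscale c f"
  by (rule poly_mapping_eqI) simp

lemma cscale_minus_right [simp]: "cscale c (- f) = - cscale c f"
  by (rule poly_mapping_eqI) simp

lemma cscale_add_left: "cscale (c + d) f = cscale c f + cscale d f"
  by (rule poly_mapping_eqI) (simp add: lookup_add ring_distribs)

lemma cscale_single [simp]: "cscale c (Poly_Mapping.single b d) = Poly_Mapping.single b (c * d)"
  by (simp add: map_single)

lemma cscale_sum: "cscale c (sum f S) = (\<Sum>x\<in>S. cscale c (f x))"
  by (rule poly_mapping_eqI) (simp add: lookup_sum sum_distrib_left)

interpretation cs: vector_space cscale
  by unfold_locales (simp_all add: cscale_add_right cscale_add_left)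

lemma poly_mapping_sum_singles:
  fixes u :: "'b \<Rightarrow>\<^sub>0 'c::ab_group_add"
  shows "u = (\<Sum>b\<in>supp u. Poly_Mapping.single b (cf u b))"
proof (rule poly_mapping_eqI)
  fix k
  have "cf (\<Sum>b\<in>supp u. Poly_Mapping.single b (cf u b)) k
      = (\<Sum>b\<in>supp u. if b = k then cf u k else 0)"
    by (auto simp: lookup_sum lookup_single when_def intro: sum.cong)
  then show "cf u k = cf (\<Sum>b\<in>supp u. Poly_Mapping.single b (cf u b)) k"
    by (simp add: in_keys_iff)
qed

lemma pm_induct [case_names zero single add]:
  fixes u :: "'b \<Rightarrow>\<^sub>0 'c::ab_group_add"
  assumes "P 0" "\<And>b c. P (Poly_Mapping.single b c)" "\<And>f g. P f \<Longrightarrow> P g \<Longrightarrow> P (f + g)"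
  shows "P u"
proof -
  have "finite S \<Longrightarrow> P (\<Sum>b\<in>S. Poly_Mapping.single b (cf u b))" for S
    by (induction S rule: finite_induct) (auto intro: assms)
  then show ?thesis
    by (subst poly_mapping_sum_singles) simp
qed

lemma additive_eqI:
  fixes \<phi> \<psi> :: "('b \<Rightarrow>\<^sub>0 'c::ab_group_add) \<Rightarrow> 'd::ab_group_add"
  assumes "\<And>f g. \<phi> (f + g) = \<phi> f + \<phi> g" "\<And>f g. \<psi> (f + g) = \<psi> f + \<psi> g"
    and "\<And>b c. \<phi> (Poly_Mapping.single b c) = \<psi> (Poly_Mapping.single b c)"
  shows "\<phi> u = \<psi> u"
proof (induction u rule: pm_induct)
  case zero
  have "\<phi> 0 = 0" "\<psi> 0 = 0" using assms(1,2)[of 0 0] by simp_all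
  then show ?case by simp
qed (use assms in auto)

abbreviation clin :: "(('b \<Rightarrow>\<^sub>0 complex) \<Rightarrow> ('c \<Rightarrow>\<^sub>0 complex)) \<Rightarrow> bool" where
  "clin \<equiv> Vector_Spaces.linear cscale cscale"

lemma clinI:
  assumes "\<And>f g. \<phi> (f + g) = \<phi> f + \<phi> g" "\<And>c f. \<phi> (cscale c f) = cscale c (\<phi> f)"
  shows "clin \<phi>"
  by unfold_locales (use assms in \<open>auto simp: cscale_add_right cscale_add_left\<close>)

lemma clin_add: "clin \<phi> \<Longrightarrow> \<phi> (f + g) = \<phi> f + \<phi> g"
  and clin_scale: "clin \<phi> \<Longrightarrow> \<phi> (cscale c f) = cscale c (\<phi> f)"
  by (simp_all add: Vector_Spaces.linear_iff)

lemma clin_zero: "clin \<phi> \<Longrightarrow> \<phi> 0 = 0"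
  using clin_scale[of \<phi> 0 0] by simp

lemma clin_minus: "clin \<phi> \<Longrightarrow> \<phi> (- f) = - \<phi> f"
  using clin_scale[of \<phi> "-1" f] by simp

lemma clin_diff: "clin \<phi> \<Longrightarrow> \<phi> (f - g) = \<phi> f - \<phi> g"
  using clin_add[of \<phi> f "- g"] by (simp add: clin_minus)

lemma clin_sum: "clin \<phi> \<Longrightarrow> \<phi> (sum f S) = (\<Sum>x\<in>S. \<phi> (f x))"
  by (induction S rule: infinite_finite_induct) (auto simp: clin_zero clin_add)

lemma clin_comp: "clin \<phi> \<Longrightarrow> clin \<psi> \<Longrightarrow> clin (\<lambda>f. \<phi> (\<psi> f))"
  by (rule clinI) (auto simp: clin_add clin_scale)

lemma clin_id: "clin (\<lambda>f. f)"
  by (rule clinI) auto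

lemma clin_plus: "clin \<phi> \<Longrightarrow> clin \<psi> \<Longrightarrow> clin (\<lambda>f. \<phi> f + \<psi> f)"
  by (rule clinI) (auto simp: clin_add clin_scale cscale_add_right)

lemma clin_cscale: "clin \<phi> \<Longrightarrow> clin (\<lambda>f. cscale c (\<phi> f))"
  by (rule clinI) (auto simp: clin_add clin_scale cscale_add_right mult.commute)

lemma clin_uminus: "clin \<phi> \<Longrightarrow> clin (\<lambda>f. - \<phi> f)"
  by (rule clinI) (auto simp: clin_add clin_scale)

lemma clin_minusf: "clin \<phi> \<Longrightarrow> clin \<psi> \<Longrightarrow> clin (\<lambda>f. \<phi> f - \<psi> f)"
  by (rule clinI) (auto simp: clin_add clin_scale cscale_diff_right)

lemma clin_0: "clin (\<lambda>f. 0)"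
  by (rule clinI) auto

lemma clin_eqI:
  fixes \<phi> \<psi> :: "('b \<Rightarrow>\<^sub>0 complex) \<Rightarrow> ('c \<Rightarrow>\<^sub>0 complex)"
  assumes "clin \<phi>" "clin \<psi>" and "\<And>b. \<phi> (Poly_Mapping.single b 1) = \<psi> (Poly_Mapping.single b 1)"
  shows "\<phi> u = \<psi> u"
proof (rule additive_eqI[of \<phi> \<psi>])
  fix b :: 'b and c :: complex
  have "Poly_Mapping.single b c = cscale c (Poly_Mapping.single b 1)" by simp
  then show "\<phi> (Poly_Mapping.single b c) = \<psi> (Poly_Mapping.single b c)"
    by (metis assms clin_scale)
qed (use assms in \<open>auto simp: clin_add\<close>)

text \<open>Allows sums over the supports of different functions to be taken over one common index
  set, which is what additivity of \<open>lin_ext\<close> needs.\<close>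

lemma lin_ext_superset:
  assumes "finite S" "supp f \<subseteq> S"
  shows "lin_ext g f = (\<Sum>b\<in>S. cscale (cf f b) (g b))"
  unfolding lin_ext_def using assms
  by (intro sum.mono_neutral_left) (auto simp: in_keys_iff)

lemma clin_lin_ext [simp, intro]: "clin (lin_ext g)"
proof (rule clinI)
  fix f h :: "'a \<Rightarrow>\<^sub>0 complex" and c
  let ?S = "supp f \<union> supp h"
  have "lin_ext g (f + h) = (\<Sum>b\<in>?S. cscale (cf (f + h) b) (g b))"
    by (rule lin_ext_superset) (auto simp: in_keys_iff lookup_add)
  also have "\<dots> = lin_ext g f + lin_ext g h"
    by (simp add: lookup_add cscale_add_left sum.distrib lin_ext_superset[of ?S])
  finally show "lin_ext g (f + h) = lin_ext g f + lin_ext g h" .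
  have "lin_ext g (cscale c f) = (\<Sum>b\<in>supp f. cscale (cf (cscale c f) b) (g b))"
    by (rule lin_ext_superset) (auto simp: in_keys_iff)
  then show "lin_ext g (cscale c f) = cscale c (lin_ext g f)"
    by (simp add: lin_ext_def cscale_sum)
qed

lemma lin_ext_single [simp]: "lin_ext g (Poly_Mapping.single b c) = cscale c (g b)"
  by (subst lin_ext_superset[of "{b}"]) auto

lemma lin_ext_add: "lin_ext g (f + h) = lin_ext g f + lin_ext g h"
  and lin_ext_cscale: "lin_ext g (cscale c f) = cscale c (lin_ext g f)"
  using clin_lin_ext by (rule clin_add, rule clin_scale)

lemma lin_ext_fun_add: "lin_ext (\<lambda>b. g b + h b) f = lin_ext g f + lin_ext h f"
  by (simp add: lin_ext_def cscale_add_right sum.distrib)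

lemma lin_ext_fun_cscale: "lin_ext (\<lambda>b. cscale c (g b)) f = cscale c (lin_ext g f)"
  by (simp add: lin_ext_def cscale_sum mult.commute)


section \<open>Multiplication and derivatives in \<open>A\<close>\<close>

text \<open>The sorting sign written as a double product over pairs instead of a count of
  inversions; disjoint unions in either argument then simply multiply signs.\<close>

definition sg :: "'n::linorder set \<Rightarrow> 'n set \<Rightarrow> complex" where
  "sg I J = (\<Prod>i\<in>I. \<Prod>j\<in>J. if j < i then - 1 else 1)"

lemma sg_card:
  fixes I J :: "'n::{finite,linorder} set"
  shows "(- 1) ^ card {(i, j). i \<in> I \<and> j \<in> J \<and> j < i} = sg I J"
proof -
  have "sg I J = (\<Prod>(i, j)\<in>I \<times> J. if j < i then - 1 else 1)"
    by (simp add: sg_def prod.cartesian_product)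
  also have "\<dots> = (\<Prod>x\<in>I \<times> J. if snd x < fst x then - 1 else 1)"
    by (simp add: case_prod_unfold)
  also have "\<dots> = (\<Prod>x\<in>(I \<times> J) \<inter> {x. snd x < fst x}. - 1)"
    by (subst prod.inter_restrict) auto
  also have "\<dots> = (- 1) ^ card {(i, j). i \<in> I \<and> j \<in> J \<and> j < i}"
    by (auto intro!: arg_cong[of _ _ card] arg_cong[of _ _ "\<lambda>k. (- 1) ^ k"])
  finally show ?thesis by simp
qed

lemma sg_union_left:
  fixes I J K :: "'n::{finite,linorder} set"
  shows "I \<inter> J = {} \<Longrightarrow> sg (I \<union> J) K = sg I K * sg J K"
  unfolding sg_def by (rule prod.union_disjoint) auto

lemma sg_union_right:
  fixes I J K :: "'n::{finite,linorder} set"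
  shows "J \<inter> K = {} \<Longrightarrow> sg I (J \<union> K) = sg I J * sg I K"
  unfolding sg_def by (simp add: prod.union_disjoint prod.distrib)

lemma sg_empty [simp]: "sg {} J = 1" "sg I {} = 1"
  by (simp_all add: sg_def)

lemma sg_single_card:
  fixes J :: "'n::{finite,linorder} set"
  shows "(- 1) ^ card {j \<in> J. j < i} = sg {i} J"
proof -
  have "(\<Prod>j\<in>J. if j < i then - 1 else 1::complex) = (\<Prod>j\<in>J \<inter> {j. j < i}. - 1)"
    by (subst prod.inter_restrict) auto
  then show ?thesis
    by (auto simp: sg_def intro!: arg_cong[of _ _ card] arg_cong[of _ _ "\<lambda>k. (- 1) ^ k"])
qed

lemma sg_square [simp]:
  fixes I J :: "'n::{finite,linorder} set"
  shows "sg I J * sg I J = 1"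
  unfolding sg_def prod.distrib [symmetric] by (intro prod.neutral ballI) auto

lemma sg_square' [simp]:
  fixes I J :: "'n::{finite,linorder} set"
  shows "sg I J * (sg I J * c) = c"
  by (simp flip: mult.assoc)

text \<open>For disjoint sets each pair (i, j) is inverted in exactly one of the two orders, so it
  contributes one factor -1 in total.\<close>

lemma sg_swap:
  fixes I J :: "'n::{finite,linorder} set"
  assumes "I \<inter> J = {}"
  shows "sg I J * sg J I = (- 1) ^ (card I * card J)"
proof -
  have "sg J I = (\<Prod>i\<in>I. \<Prod>j\<in>J. if i < j then - 1 else 1)"
    unfolding sg_def by (rule prod.swap)
  then have "sg I J * sg J I = (\<Prod>i\<in>I. \<Prod>j\<in>J. - 1)"
    unfolding sg_def[of I J] using assms
    by (simp only: prod.distrib [symmetric], intro prod.cong refl)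
      (auto simp: not_less dest: le_neq_trans)
  also have "\<dots> = (- 1) ^ (card I * card J)"
    by (simp add: power_mult [symmetric] mult.commute)
  finally show ?thesis .
qed

lemma sg_insert_left:
  fixes I J :: "'n::{finite,linorder} set"
  shows "i \<notin> I \<Longrightarrow> sg (insert i I) J = sg {i} J * sg I J"
  using sg_union_left[of "{i}" I J] by simp

lemma sg_insert_right:
  fixes I J :: "'n::{finite,linorder} set"
  shows "j \<notin> J \<Longrightarrow> sg I (insert j J) = sg I {j} * sg I J"
  using sg_union_right[of "{j}" J I] by simp

lemma amult_mon:
  "amult (mon k I) (mon l J) = (if I \<inter> J = {} then cscale (sg I J) (mon (k + l) (I \<union> J)) else 0)"
  by (simp add: amult_def mon_def sg_card)

lemma d_t_mon: "d_t (mon k I) = cscale (of_int k) (mon (k - 1) I)"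
  by (simp add: d_t_def mon_def)

lemma d_xi_mon: "d_xi i (mon k I) = (if i \<in> I then cscale (sg {i} I) (mon k (I - {i})) else 0)"
  by (simp add: d_xi_def mon_def sg_single_card)

lemma lau_sigma_mon: "lau_sigma (mon k I) = cscale ((- 1) ^ card I) (mon k I)"
  by (simp add: lau_sigma_def mon_def)

lemma clin_d_t [simp]: "clin d_t" and clin_d_xi [simp]: "clin (d_xi i)"
  and clin_sigma [simp]: "clin lau_sigma"
  by (simp_all add: d_t_def d_xi_def lau_sigma_def)

lemma clin_d_var [simp]: "clin (d_var j)"
  by (cases j) (simp_all add: d_var_def)

lemma clin_amult [simp]: "clin (amult f)"
proof (rule clinI)
  fix g h c
  show "amult f (g + h) = amult f g + amult f h"
    by (simp add: amult_def case_prod_unfold lin_ext_add lin_ext_fun_add)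
  show "amult f (cscale c g) = cscale c (amult f g)"
    by (simp only: amult_def case_prod_unfold lin_ext_cscale lin_ext_fun_cscale)
qed

lemma clin_amult_left [simp]: "clin (\<lambda>f. amult f g)"
  unfolding amult_def by (rule clin_lin_ext)

lemmas amult_add_left = clin_add[OF clin_amult_left]
  and amult_add_right = clin_add[OF clin_amult]
  and amult_scale_left = clin_scale[OF clin_amult_left]
  and amult_scale_right = clin_scale[OF clin_amult]
  and amult_zero_left [simp] = clin_zero[OF clin_amult_left]
  and amult_zero_right [simp] = clin_zero[OF clin_amult]
  and amult_minus_left = clin_minus[OF clin_amult_left]
  and amult_minus_right = clin_minus[OF clin_amult]

lemma clin_mon_eqI:
  fixes \<phi> \<psi> :: "'n lau \<Rightarrow> ('c \<Rightarrow>\<^sub>0 complex)"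
  assumes "clin \<phi>" "clin \<psi>" "\<And>k I. \<phi> (mon k I) = \<psi> (mon k I)"
  shows "\<phi> u = \<psi> u"
  using assms(1,2)
proof (rule clin_eqI)
  fix b :: "int \<times> 'n set"
  show "\<phi> (Poly_Mapping.single b 1) = \<psi> (Poly_Mapping.single b 1)"
    using assms(3)[of "fst b" "snd b"] by (simp add: mon_def)
qed

lemma amult_one_left [simp]: "amult (mon 0 {}) f = f"
  by (rule clin_mon_eqI) (simp_all add: amult_mon clin_id)

lemma amult_one_right [simp]: "amult f (mon 0 {}) = f"
  by (rule clin_mon_eqI[of "\<lambda>f. amult f (mon 0 {})"]) (simp_all add: amult_mon clin_id)

text \<open>On monomials both sides vanish unless the three index sets are pairwise disjoint, and
  then the signs agree because \<open>sg\<close> is multiplicative in each argument. Trilinearity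
  does the rest, one variable at a time.\<close>

lemma amult_assoc: "amult (amult f g) h = amult f (amult g h)"
proof -
  have m: "amult (amult (mon k I) (mon l J)) (mon m K) = amult (mon k I) (amult (mon l J) (mon m K))" for k l m and I J K :: "'a set"
    by (auto simp: amult_mon amult_scale_left amult_scale_right sg_union_left sg_union_right
        Un_assoc add.assoc Int_Un_distrib Int_Un_distrib2 mult_ac)
  have "amult (amult (mon k I) (mon l J)) h = amult (mon k I) (amult (mon l J) h)" for k l and I J :: "'a set"
    by (rule clin_mon_eqI[of _ "\<lambda>h. amult (mon k I) (amult (mon l J) h)"]) (auto intro: clin_comp simp: m)
  then have "amult (amult (mon k I) g) h = amult (mon k I) (amult g h)" for k and I :: "'a set"
    by (rule clin_mon_eqI[of "\<lambda>g. amult (amult (mon k I) g) h" "\<lambda>g. amult (mon k I) (amult g h)", rotated 2])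
      (auto intro: clin_comp clin_comp[OF clin_amult_left])
  then show ?thesis
    by (rule clin_mon_eqI[of "\<lambda>f. amult (amult f g) h" "\<lambda>f. amult f (amult g h)", rotated 2])
      (auto intro: clin_comp[OF clin_amult_left])
qed


text \<open>Parities are to remain ring expressions, so that \<open>ksign_add\<close> and
  distributivity can be applied to them.\<close>

declare add_bit_eq_xor [simp del] mult_bit_eq_and [simp del]

lemma clin2_mon_eqI:
  fixes \<phi> \<psi> :: "'n lau \<Rightarrow> 'n lau \<Rightarrow> ('c \<Rightarrow>\<^sub>0 complex)"
  assumes "\<And>f. clin (\<phi> f)" "\<And>f. clin (\<psi> f)" "\<And>g. clin (\<lambda>f. \<phi> f g)" "\<And>g. clin (\<lambda>f. \<psi> f g)"
    and "\<And>k I l J. \<phi> (mon k I) (mon l J) = \<psi> (mon k I) (mon l J)"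
  shows "\<phi> f g = \<psi> f g"
proof -
  have "\<phi> (mon k I) g = \<psi> (mon k I) g" for k I
    by (rule clin_mon_eqI[OF assms(1,2)]) (rule assms(5))
  then show ?thesis
    by (rule clin_mon_eqI[of "\<lambda>f. \<phi> f g" "\<lambda>f. \<psi> f g", OF assms(3,4)])
qed

lemma ksign_simps [simp]: "ksign 0 = 1" "ksign 1 = - 1"
  by (simp_all add: ksign_def)

lemma ksign_square [simp]: "ksign p * ksign p = 1" "ksign p * (ksign p * c) = c"
  by (cases p; simp)+

lemma ksign_add: "ksign (p + q) = ksign p * ksign q"
  by (cases p; cases q) simp_all

lemma ksign_of_nat: "ksign (of_nat n) = (- 1) ^ n"
  by (induction n) (simp_all add: ksign_add)

lemma ksign_inject [simp]: "ksign p = ksign q \<longleftrightarrow> p = q"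
  by (cases p; cases q) simp_all

lemma bit_add_self [simp]: "p + p = (0::bit)" "p + (p + q) = (q::bit)"
  by (cases p; cases q; simp)+

subsection \<open>Derivations and the parity operator\<close>

lemma d_t_amult: "d_t (amult f g) = amult (d_t f) g + amult f (d_t g)"
proof (rule clin2_mon_eqI[of "\<lambda>f g. d_t (amult f g)" "\<lambda>f g. amult (d_t f) g + amult f (d_t g)"])
  show "d_t (amult (mon k I) (mon l J)) = amult (d_t (mon k I)) (mon l J) + amult (mon k I) (d_t (mon l J))"
    for k l and I J :: "'a set"
    by (auto simp: amult_mon d_t_mon amult_scale_left amult_scale_right clin_scale[OF clin_d_t] clin_zero[OF clin_d_t]
        algebra_simps simp flip: cs.scale_left_distrib)
qed (auto intro!: clin_id clin_comp[OF clin_d_t] clin_plus clin_comp[OF clin_amult] clin_comp[OF clin_amult_left])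

lemma sigma_amult: "lau_sigma (amult f g) = amult (lau_sigma f) (lau_sigma g)"
proof (rule clin2_mon_eqI[of "\<lambda>f g. lau_sigma (amult f g)" "\<lambda>f g. amult (lau_sigma f) (lau_sigma g)"])
  show "lau_sigma (amult (mon k I) (mon l J)) = amult (lau_sigma (mon k I)) (lau_sigma (mon l J))"
    for k l and I J :: "'a set"
    by (auto simp: amult_mon lau_sigma_mon amult_scale_left amult_scale_right clin_scale[OF clin_sigma] clin_zero[OF clin_sigma]
        card_Un_disjoint power_add mult_ac)
qed (auto intro!: clin_id clin_comp[OF clin_sigma] clin_plus clin_comp[OF clin_amult] clin_comp[OF clin_amult_left])

lemma sigma_sigma [simp]: "lau_sigma (lau_sigma f) = f"
  by (rule clin_mon_eqI[of "\<lambda>f. lau_sigma (lau_sigma f)" "\<lambda>f. f"])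
    (auto intro!: clin_id clin_comp[OF clin_sigma] clin_id simp: lau_sigma_mon clin_scale[OF clin_sigma] simp flip: power_add)

lemma sigma_d_t: "lau_sigma (d_t f) = d_t (lau_sigma f)"
  by (rule clin_mon_eqI[of "\<lambda>f. lau_sigma (d_t f)" "\<lambda>f. d_t (lau_sigma f)"])
    (auto intro!: clin_id clin_comp[OF clin_sigma] clin_comp[OF clin_d_t]
      simp: lau_sigma_mon clin_scale[OF clin_sigma] clin_scale[OF clin_d_t] d_t_mon)

lemma sigma_d_xi: "lau_sigma (d_xi i f) = - d_xi i (lau_sigma f)"
proof (rule clin_mon_eqI[of "\<lambda>f. lau_sigma (d_xi i f)" "\<lambda>f. - d_xi i (lau_sigma f)"])
  fix k and I :: "'a set"
  have "i \<in> I \<Longrightarrow> (- 1) ^ card I = - ((- 1) ^ card (I - {i}) :: complex)"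
    by (subst card.remove[of I i]) auto
  then show "lau_sigma (d_xi i (mon k I)) = - d_xi i (lau_sigma (mon k I))"
    by (auto simp: lau_sigma_mon clin_scale[OF clin_sigma] clin_scale[OF clin_d_xi] clin_zero[OF clin_sigma] d_xi_mon mult.commute)
qed (auto intro!: clin_id clin_comp[OF clin_sigma] clin_comp[OF clin_d_xi] clin_uminus)

lemma d_t_d_xi: "d_t (d_xi i f) = d_xi i (d_t f)"
  by (rule clin_mon_eqI[of "\<lambda>f. d_t (d_xi i f)" "\<lambda>f. d_xi i (d_t f)"])
    (auto intro!: clin_id clin_comp[OF clin_d_xi] clin_comp[OF clin_d_t]
      simp: d_xi_mon clin_scale[OF clin_d_xi] clin_scale[OF clin_d_t] d_t_mon clin_zero[OF clin_d_t])

text \<open>Only monomials containing both xi_i and xi_j with i \<noteq> j matter; there the two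
  orders of removal differ by \<open>sg {i} {j}\<close> versus \<open>sg {j} {i}\<close>, which are
  opposite.\<close>

lemma d_xi_d_xi: "d_xi i (d_xi j f) = - d_xi j (d_xi i f)"
proof (rule clin_mon_eqI[of "\<lambda>f. d_xi i (d_xi j f)" "\<lambda>f. - d_xi j (d_xi i f)"])
  fix k and I :: "'a set"
  have "d_xi i (d_xi j (mon k I)) = - d_xi j (d_xi i (mon k I))" if "i \<in> I" "j \<in> I" "i \<noteq> j"
  proof -
    define J where "J = I - {i, j}"
    have J: "I = insert i (insert j J)" "i \<notin> J" "j \<notin> J" using that by (auto simp: J_def)
    have "sg {i} {j} * sg {j} {i} = - 1"
      using sg_swap[of "{i}" "{j}"] that by simp
    then have "sg {i} {j} * (sg {i} {j} * sg {j} {i}) = - sg {i} {j}" by simp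
    then have e: "sg {j} {i} = - sg {i} {j}" by simp
    have "insert i (insert j J) - {i} = insert j J" "insert i (insert j J) - {j} = insert i J"
      using J that by auto
    moreover have "sg {x} (insert i (insert j J)) = sg {x} {i} * (sg {x} {j} * sg {x} J)" for x
      using that J sg_insert_right[of i "insert j J" "{x}"] sg_insert_right[of j J "{x}"] by simp
    moreover have "sg {i} {i} = 1" "sg {j} {j} = 1" by (simp_all add: sg_def)
    ultimately show ?thesis
      using J that by (simp add: d_xi_mon clin_scale[OF clin_d_xi] clin_minus[OF clin_d_xi] sg_insert_right[OF J(2)] sg_insert_right[OF J(3)] mult_ac e)
  qed
  then show "d_xi i (d_xi j (mon k I)) = - d_xi j (d_xi i (mon k I))"
    by (cases "i \<in> I \<and> j \<in> I \<and> i \<noteq> j")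
      (auto simp: d_xi_mon clin_scale[OF clin_d_xi] clin_zero[OF clin_d_xi])
qed (auto intro!: clin_id clin_comp[OF clin_d_xi] clin_uminus)

lemma d_xi_sq [simp]: "d_xi i (d_xi i f) = 0"
proof -
  have "cscale 2 (d_xi i (d_xi i f)) = 0"
    using d_xi_d_xi[of i i f] cscale_add_left[of 1 1 "d_xi i (d_xi i f)"] by (simp add: eq_neg_iff_add_eq_0)
  then have "cscale (1/2) (cscale 2 (d_xi i (d_xi i f))) = 0" by (simp del: cscale_cscale)
  then show ?thesis by simp
qed

lemma sg_self_single [simp]: "sg {i} {i} = 1"
  by (simp add: sg_def)

lemma sg_insert_self [simp]:
  fixes I :: "'n::{finite,linorder} set"
  shows "sg {i} (insert i I) = sg {i} I"
  by (cases "i \<in> I") (simp_all add: insert_absorb sg_insert_right[of i I "{i}"])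

lemma sg_remove_self [simp]:
  fixes I :: "'n::{finite,linorder} set"
  shows "sg {i} (I - {i}) = sg {i} I"
  using sg_insert_self[of i "I - {i}"] by (cases "i \<in> I") (simp_all add: insert_absorb)

lemma d_xi_amult: "d_xi i (amult f g) = amult (d_xi i f) g + amult (lau_sigma f) (d_xi i g)"
proof (rule clin2_mon_eqI[of "\<lambda>f g. d_xi i (amult f g)" "\<lambda>f g. amult (d_xi i f) g + amult (lau_sigma f) (d_xi i g)"])
  fix k l and I J :: "'a set"
  note simps = amult_mon lau_sigma_mon d_xi_mon amult_scale_left amult_scale_right clin_scale[OF clin_d_xi] clin_zero[OF clin_d_xi] amult_minus_left
  show "d_xi i (amult (mon k I) (mon l J)) = amult (d_xi i (mon k I)) (mon l J) + amult (lau_sigma (mon k I)) (d_xi i (mon l J))"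
  proof (cases "i \<in> I")
    case iI: True
    define I' where "I' = I - {i}"
    have I: "I = insert i I'" "i \<notin> I'" using iI by (auto simp: I'_def)
    show ?thesis
    proof (cases "i \<in> J")
      case iJ: True
      define J' where "J' = J - {i}"
      have J: "J = insert i J'" "i \<notin> J'" using iJ by (auto simp: J'_def)
      have sw: "sg I' {i} * sg {i} I' = (- 1) ^ card I'"
        using sg_swap[of I' "{i}"] I by simp
      have "sg {i} I' * sg I' {i} = (- 1) ^ card I'" by (simp add: sw [symmetric] mult.commute)
      then have e: "sg {i} I' * (sg I' {i} * sg I' J') = (- 1) ^ card I' * sg I' J'"
        by (simp flip: mult.assoc)
      have ne: "insert i I' \<inter> insert i J' \<noteq> {}" and d: "insert i I' - {i} = I'" "insert i J' - {i} = J'"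
        "I' \<inter> insert i J' = I' \<inter> J'" "insert i I' \<inter> J' = I' \<inter> J'"
        using I J by auto
      show ?thesis
      proof (cases "I' \<inter> J' = {}")
        case True
        \<comment> \<open>The product is zero because xi_i occurs in both factors, but neither
          Leibniz term vanishes. They are multiples of the same monomial, and the extra element i in
          \<open>card (insert i I')\<close> gives the relative sign that cancels them.\<close>
        have "cscale (sg {i} I' * sg I' (insert i J')) (mon (k + l) (insert i (I' \<union> J')))
          + cscale ((- 1) ^ card (insert i I') * (sg {i} J' * sg (insert i I') J')) (mon (k + l) (insert i (I' \<union> J'))) = 0"
          unfolding cscale_add_left [symmetric]
          using I J by (simp add: sg_insert_left[OF I(2)] sg_insert_right[OF J(2)] e sw mult_ac)
        moreover have "sg {i} (insert i I') = sg {i} I'" "sg {i} (insert i J') = sg {i} J'"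
          using sg_insert_right[OF I(2), of "{i}"] sg_insert_right[OF J(2), of "{i}"] by simp_all
        then have "amult (d_xi i (mon k (insert i I'))) (mon l (insert i J'))
            = cscale (sg {i} I' * sg I' (insert i J')) (mon (k + l) (insert i (I' \<union> J')))"
          "amult (lau_sigma (mon k (insert i I'))) (d_xi i (mon l (insert i J')))
            = cscale ((- 1) ^ card (insert i I') * (sg {i} J' * sg (insert i I') J')) (mon (k + l) (insert i (I' \<union> J')))"
          using True d by (simp_all add: simps amult_minus_left mult_ac del: card_insert_disjoint)
        ultimately show ?thesis
          unfolding I(1) J(1) using ne by (simp add: amult_mon clin_zero[OF clin_d_xi] del: card_insert_disjoint)
      next
        case False
        then show ?thesis
          using I J ne d unfolding I(1) J(1) by (simp add: simps)
      qed
    next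
      case iJ: False
      then show ?thesis
        using I sg_union_right[of I' J "{i}"] unfolding I(1)
        by (simp add: simps sg_insert_left[OF I(2)]  insert_Diff_if mult_ac)
    qed
  next
    case iI: False
    show ?thesis
    proof (cases "i \<in> J")
      case iJ: True
      define J' where "J' = J - {i}"
      have J: "J = insert i J'" "i \<notin> J'" using iJ by (auto simp: J'_def)
      have sw0: "sg I {i} * sg {i} I = (- 1) ^ card I"
        using sg_swap[of I "{i}"] iI by simp
      then have sw: "sg {i} I * (sg I {i} * c) = (- 1) ^ card I * c" for c
        by (metis mult.assoc mult.commute)
      have "sg {i} (I \<union> J') = sg {i} I * sg {i} J'" if "I \<inter> J' = {}"
        using that by (rule sg_union_right)
      then show ?thesis
        using J iI unfolding J(1)
        by (auto simp: simps  sg_insert_right[OF J(2)] insert_Diff_if sw sw0 mult_ac)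
    next
      case iJ: False
      then show ?thesis using iI by (auto simp: simps)
    qed
  qed
qed (auto intro!: clin_id clin_comp[OF clin_d_xi] clin_plus clin_comp[OF clin_amult] clin_comp[OF clin_amult_left])


text \<open>The sign rule for moving \<open>\<partial>\<^sub>j\<close> past a function.\<close>

definition lsig :: "'n option \<Rightarrow> 'n oper" where
  "lsig j = (case j of None \<Rightarrow> id | Some i \<Rightarrow> lau_sigma)"

lemma lsig_simps [simp]: "lsig None f = f" "lsig (Some i) f = lau_sigma f"
  by (simp_all add: lsig_def)

lemma d_var_simps [simp]: "d_var None = d_t" "d_var (Some i) = d_xi i"
  by (simp_all add: d_var_def)

lemma d_var_amult: "d_var j (amult f g) = amult (d_var j f) g + amult (lsig j f) (d_var j g)"
  by (cases j) (simp_all add: d_t_amult d_xi_amult)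

lemma d_var_mon_var [simp]:
  "d_t (mon 1 {}) = mon 0 {}" "d_t (mon 0 I) = 0" "d_xi i (mon k {}) = 0"
  "d_xi i (mon k {i}) = mon k {}" "i \<noteq> j \<Longrightarrow> d_xi i (mon k {j}) = 0"
  by (simp_all add: d_t_mon d_xi_mon)


subsection \<open>Homogeneous elements\<close>

lemma cf_mon: "cf (mon k I) b = (if b = (k, I) then 1 else 0)"
  by (auto simp: mon_def lookup_single when_def)

lemma lau_expand: "f = (\<Sum>b\<in>supp f. cscale (cf f b) (mon (fst b) (snd b)))"
  by (subst poly_mapping_sum_singles) (simp add: mon_def)

lemma cf_sigma: "cf (lau_sigma f) (k, I) = (- 1) ^ card I * cf f (k, I)"
proof (induction f rule: pm_induct)
  case (single b c)
  then show ?case by (cases b) (auto simp: lau_sigma_def cf_mon lookup_single when_def)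
qed (auto simp: clin_zero[OF clin_sigma] clin_add[OF clin_sigma] lookup_add ring_distribs)

text \<open>Homogeneity becomes an eigenvector equation for \<open>lau_sigma\<close>, because
  \<open>ksign\<close> is injective. All later parity checks are equations of this kind.\<close>

lemma lau_part_iff: "f \<in> lau_part p \<longleftrightarrow> lau_sigma f = cscale (ksign p) f"
proof -
  have "f \<in> lau_part p \<longleftrightarrow> (\<forall>k I. cf f (k, I) \<noteq> 0 \<longrightarrow> ksign (of_nat (card I)) = ksign p)"
    unfolding lau_part_def by (auto simp: in_keys_iff)
  also have "\<dots> \<longleftrightarrow> (\<forall>k I. (- 1) ^ card I * cf f (k, I) = ksign p * cf f (k, I))"
    by (auto simp: ksign_of_nat)
  also have "\<dots> \<longleftrightarrow> lau_sigma f = cscale (ksign p) f"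
    by (auto simp: poly_mapping_eq_iff fun_eq_iff cf_sigma)
  finally show ?thesis .
qed

lemma mon_lau_part: "mon k I \<in> lau_part (of_nat (card I))"
  by (simp add: lau_part_iff lau_sigma_mon ksign_of_nat)

lemma mon_lau_part' [simp]: "mon k {} \<in> lau_part 0" "mon k {i} \<in> lau_part 1"
  using mon_lau_part[of k "{}"] mon_lau_part[of k "{i}"] by simp_all

lemma amult_lau_part: "f \<in> lau_part p \<Longrightarrow> g \<in> lau_part q \<Longrightarrow> amult f g \<in> lau_part (p + q)"
  by (simp add: lau_part_iff sigma_amult amult_scale_left amult_scale_right ksign_add mult_ac)

lemma amult_supercomm:
  assumes "f \<in> lau_part p" "g \<in> lau_part q"
  shows "amult f g = cscale (ksign (p * q)) (amult g f)"
proof -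
  have m: "amult (mon k I) (mon l J) = cscale ((- 1) ^ (card I * card J)) (amult (mon l J) (mon k I))"
    for k l and I J :: "'a set"
    using sg_swap[of I J]
    by (auto simp: amult_mon Un_commute add.commute Int_commute simp flip: sg_swap)
  have "amult f g = amult (\<Sum>b\<in>supp f. cscale (cf f b) (mon (fst b) (snd b))) (\<Sum>b\<in>supp g. cscale (cf g b) (mon (fst b) (snd b)))"
    by (rule arg_cong2[OF lau_expand lau_expand])
  also have "\<dots> = (\<Sum>b\<in>supp f. \<Sum>c\<in>supp g. cscale (cf f b * cf g c) (amult (mon (fst b) (snd b)) (mon (fst c) (snd c))))"
    by (simp add: clin_sum[OF clin_amult] clin_sum[OF clin_amult_left] amult_scale_left amult_scale_right cscale_sum mult.commute)
      (rule sum.swap)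
  also have "\<dots> = (\<Sum>b\<in>supp f. \<Sum>c\<in>supp g. cscale (ksign (p * q)) (cscale (cf f b * cf g c) (amult (mon (fst c) (snd c)) (mon (fst b) (snd b)))))"
  proof (intro sum.cong refl)
    fix b c assume "b \<in> supp f" "c \<in> supp g"
    then have "of_nat (card (snd b)) = p" "of_nat (card (snd c)) = q"
      using assms by (auto simp: lau_part_def)
    \<comment> \<open>The exchange sign is constant over the supports, since every index set
      occurring in f has cardinality of parity p, and every one in g of parity q.\<close>
    then have "ksign (p * q) = (- 1) ^ (card (snd b) * card (snd c))"
      by (metis ksign_of_nat of_nat_mult)
    then show "cscale (cf f b * cf g c) (amult (mon (fst b) (snd b)) (mon (fst c) (snd c)))
      = cscale (ksign (p * q)) (cscale (cf f b * cf g c) (amult (mon (fst c) (snd c)) (mon (fst b) (snd b))))"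
      by (subst m) (simp add: mult_ac)
  qed
  also have "\<dots> = cscale (ksign (p * q)) (amult g f)"
    by (subst arg_cong2[OF lau_expand lau_expand, of amult g f])
      (simp add: clin_sum[OF clin_amult] clin_sum[OF clin_amult_left] amult_scale_left amult_scale_right cscale_sum mult_ac)
  finally show ?thesis .
qed

lemma xi_right: "amult g (mon 0 {j}) = amult (mon 0 {j}) (lau_sigma g)"
proof (rule clin_mon_eqI[of "\<lambda>g. amult g (mon 0 {j})" "\<lambda>g. amult (mon 0 {j}) (lau_sigma g)"])
  fix k and I :: "'a set"
  show "amult (mon k I) (mon 0 {j}) = amult (mon 0 {j}) (lau_sigma (mon k I))"
    using amult_supercomm[OF mon_lau_part[of k I] mon_lau_part'(2)[of 0 j]]
    by (simp add: lau_sigma_mon amult_scale_right ksign_of_nat)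
qed (auto intro!: clin_id clin_comp[OF clin_amult])


subsection \<open>Operators on \<open>A\<close>\<close>

text \<open>A linear operator has parity p iff conjugation by \<open>lau_sigma\<close> multiplies it
  by \<open>ksign p\<close>. Monomials are homogeneous, so they suffice to pass from the definition
  to an identity on all of \<open>A\<close>.\<close>

lemma oper_part_iff: "clin x \<Longrightarrow> x \<in> oper_part p \<longleftrightarrow> (\<forall>f. lau_sigma (x f) = cscale (ksign p) (x (lau_sigma f)))"
proof
  assume x: "clin x" "x \<in> oper_part p"
  have h: "lau_sigma (x f) = cscale (ksign p) (x (lau_sigma f))" if "f \<in> lau_part q" for f q
  proof -
    have "x f \<in> lau_part (p + q)" using x that by (auto simp: oper_part_def)
    then show ?thesis
      using that x(1) by (simp add: lau_part_iff clin_scale ksign_add)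
  qed
  show "\<forall>f. lau_sigma (x f) = cscale (ksign p) (x (lau_sigma f))"
  proof
    fix f
    show "lau_sigma (x f) = cscale (ksign p) (x (lau_sigma f))"
    proof (rule clin_mon_eqI[of "\<lambda>f. lau_sigma (x f)" "\<lambda>f. cscale (ksign p) (x (lau_sigma f))"])
      show "lau_sigma (x (mon k I)) = cscale (ksign p) (x (lau_sigma (mon k I)))" for k I
        by (rule h[OF mon_lau_part])
    qed (auto intro!: clin_id clin_comp[OF clin_sigma] clin_comp[OF x(1)] clin_cscale x(1))
  qed
next
  assume "clin x" "\<forall>f. lau_sigma (x f) = cscale (ksign p) (x (lau_sigma f))"
  then show "x \<in> oper_part p"
    by (auto simp: oper_part_def lau_part_iff clin_scale ksign_add)
qed

definition pd :: "'n option \<Rightarrow> bit" where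
  "pd j = (case j of None \<Rightarrow> 0 | Some i \<Rightarrow> 1)"

lemma pd_simps [simp]: "pd None = 0" "pd (Some i) = 1"
  by (simp_all add: pd_def)

lemma sigma_d_var: "lau_sigma (d_var j f) = cscale (ksign (pd j)) (d_var j (lau_sigma f))"
  by (cases j) (simp_all add: sigma_d_t sigma_d_xi)

lemma lsig_part: "f \<in> lau_part q \<Longrightarrow> lsig j f = cscale (ksign (pd j * q)) f"
  by (cases j) (simp_all add: lau_part_iff)

definition vf :: "'n::{finite,linorder} lau \<Rightarrow> 'n option \<Rightarrow> 'n oper" where
  "vf g j = (\<lambda>h. amult g (d_var j h))"

lemma clin_vf [simp]: "clin (vf g j)"
  unfolding vf_def by (rule clin_comp) simp_all

lemma vf_oper_part: "g \<in> lau_part p \<Longrightarrow> vf g j \<in> oper_part (p + pd j)"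
  by (simp add: oper_part_iff)
    (simp add: vf_def lau_part_iff sigma_amult sigma_d_var amult_scale_left amult_scale_right ksign_add mult_ac)

lemma vf_superder:
  fixes g :: "'n::{finite,linorder} lau"
  assumes "g \<in> lau_part p"
  shows "vf g j \<in> superder (p + pd j)"
  unfolding superder_def
proof (intro CollectI conjI allI ballI vf_oper_part assms clin_vf)
  fix q and f h :: "'n lau" assume f: "f \<in> lau_part q"
  have "amult g (lsig j f) = cscale (ksign ((p + pd j) * q)) (amult f g)"
    using amult_supercomm[OF assms f] lsig_part[OF f]
    by (simp add: amult_scale_right ring_distribs ksign_add mult_ac)
  then have "amult g (amult (lsig j f) (d_var j h)) = cscale (ksign ((p + pd j) * q)) (amult f (amult g (d_var j h)))"
    by (simp flip: amult_assoc amult_scale_left)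
  then show "vf g j (amult f h) = amult (vf g j f) h + cscale (ksign ((p + pd j) * q)) (amult f (vf g j h))"
    by (simp add: vf_def d_var_amult amult_add_right amult_assoc)
qed

lemma superderD:
  assumes "x \<in> superder p"
  shows "clin x" "x \<in> oper_part p"
    "f \<in> lau_part q \<Longrightarrow> x (amult f g) = amult (x f) g + cscale (ksign (p * q)) (amult f (x g))"
  using assms by (auto simp: superder_def)

lemma oper_part_add: "clin x \<Longrightarrow> clin y \<Longrightarrow> x \<in> oper_part p \<Longrightarrow> y \<in> oper_part p \<Longrightarrow> x + y \<in> oper_part p"
  by (subst oper_part_iff; (auto simp: oper_part_iff clin_add[OF clin_sigma] cscale_add_right plus_fun_def intro: clin_plus)?)

lemma oper_part_cscale: "clin x \<Longrightarrow> x \<in> oper_part p \<Longrightarrow> (\<lambda>f. cscale c (x f)) \<in> oper_part p"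
  by (subst oper_part_iff; (auto simp: oper_part_iff clin_scale[OF clin_sigma] mult.commute intro: clin_cscale)?)

lemma superder_add: "x \<in> superder p \<Longrightarrow> y \<in> superder p \<Longrightarrow> x + y \<in> superder p"
  unfolding superder_def
  by (auto simp: oper_part_add amult_add_left amult_add_right cscale_add_right clin_plus[unfolded plus_fun_def] plus_fun_def
      intro: oper_part_add[unfolded plus_fun_def] clin_plus)

lemma superder_cscale: "x \<in> superder p \<Longrightarrow> (\<lambda>f. cscale c (x f)) \<in> superder p"
  unfolding superder_def
  by (auto simp: amult_scale_left amult_scale_right cscale_add_right mult.commute
      intro: oper_part_cscale clin_cscale)

lemma superder_zero: "0 \<in> superder p"
  by (auto simp: superder_def oper_part_def lau_part_def zero_fun_def clin_0)

lemma superder_sum: "(\<And>a. a \<in> S \<Longrightarrow> x a \<in> superder p) \<Longrightarrow> sum x S \<in> superder p"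
  by (induction S rule: infinite_finite_induct) (auto simp: superder_zero superder_add)

lemma superder_diff: "x \<in> superder p \<Longrightarrow> y \<in> superder p \<Longrightarrow> x - y \<in> superder p"
  using superder_add[of x p "\<lambda>f. cscale (-1) (y f)"] superder_cscale[of y p "-1"]
  by (simp add: fun_diff_def plus_fun_def)

text \<open>The kernel of a superderivation is closed under products of homogeneous elements, and t,
  its inverse and the xi_i generate \<open>A\<close>.\<close>

lemma superder_eq_0:
  fixes y :: "'n::{finite,linorder} oper"
  assumes y: "y \<in> superder p" and t: "y (mon 1 {}) = 0" and xi: "\<And>i. y (mon 0 {i}) = 0"
  shows "y h = 0"
proof -
  note yc = superderD(1)[OF y]
  have mul: "y (amult f g) = 0" if "y f = 0" "y g = 0" "f \<in> lau_part q" for f g q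
    using superderD(3)[OF y that(3)] that by simp
  have one: "y (mon 0 {}) = 0"
    using superderD(3)[OF y mon_lau_part'(1)[of 0], of "mon 0 {}"] by simp
  \<comment> \<open>Differentiating t times its inverse gives t y(1/t) = 0, and t is
    invertible.\<close>
  have inv: "y (mon (- 1) {}) = 0"
  proof -
    have "amult (mon 1 {}) (y (mon (- 1) {})) = 0"
      using superderD(3)[OF y mon_lau_part'(1)[of 1], of "mon (-1) {}"] t one by (simp add: amult_mon)
    then have "amult (mon (-1) {}) (amult (mon 1 {}) (y (mon (- 1) {}))) = 0" by simp
    then show ?thesis by (simp add: amult_assoc [symmetric] amult_mon)
  qed
  have pw: "y (mon k {}) = 0" for k :: int
  proof (induction k rule: int_induct[of _ 0])
    case base then show ?case by (rule one)
  next
    case (step1 i)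
    then show ?case using mul[OF t step1(2) mon_lau_part'(1)] by (simp add: amult_mon add.commute)
  next
    case (step2 i)
    then show ?case using mul[OF inv step2(2) mon_lau_part'(1)] by (simp add: amult_mon)
  qed
  have I: "y (mon 0 I) = 0" for I :: "'n set"
  proof (induction I rule: finite_induct[OF finite])
    case 1 then show ?case by (rule one)
  next
    case (2 i I)
    have "y (amult (mon 0 {i}) (mon 0 I)) = 0"
      by (rule mul[OF xi 2(3) mon_lau_part'(2)])
    then have "cscale (sg {i} I) (y (mon 0 (insert i I))) = 0"
      using 2(2) by (simp add: amult_mon clin_scale[OF yc])
    then have "cscale (sg {i} I) (cscale (sg {i} I) (y (mon 0 (insert i I)))) = 0" by (simp del: cscale_cscale cs.scale_eq_0_iff)
    then show ?case by (simp only: cscale_cscale sg_square cscale_one)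
  qed
  have "y (mon k I) = 0" for k I
    using mul[OF pw[of k] I[of I] mon_lau_part'(1)] by (simp add: amult_mon)
  then show ?thesis
    by (rule clin_mon_eqI[OF yc clin_0])
qed


subsection \<open>Superderivations inside the Weyl superalgebra\<close>

lemma weyl_zero: "0 \<in> weyl"
  using weyl.intros(7)[OF weyl.intros(6), of 0] by (simp add: zero_fun_def)

lemma weyl_sum: "(\<And>a. a \<in> S \<Longrightarrow> x a \<in> weyl) \<Longrightarrow> sum x S \<in> weyl"
  by (induction S rule: infinite_finite_induct) (auto simp: weyl_zero intro: weyl.intros)

lemma weyl_amult: "amult f \<in> weyl"
proof -
  have comp: "amult (amult f g) \<in> weyl" if "amult f \<in> weyl" "amult g \<in> weyl" for f g :: "'a lau"
  proof -
    have "amult (amult f g) = amult f \<circ> amult g" by (auto simp: amult_assoc)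
    then show ?thesis using that by (simp add: weyl.intros)
  qed
  have one: "amult (mon 0 {} :: 'a lau) \<in> weyl"
  proof -
    have "amult (mon 0 {}) = (id :: 'a oper)" by auto
    then show ?thesis using weyl.intros(6) by simp
  qed
  have pw: "amult (mon k {} :: 'a lau) \<in> weyl" for k :: int
  proof (induction k rule: int_induct[of _ 0])
    case base then show ?case by (rule one)
  next
    case (step1 i)
    then show ?case using comp[OF weyl.intros(1) step1(2)] by (simp add: amult_mon add.commute)
  next
    case (step2 i)
    then show ?case using comp[OF weyl.intros(2) step2(2)] by (simp add: amult_mon)
  qed
  have I: "amult (mon 0 I) \<in> weyl" for I :: "'a set"
  proof (induction I rule: finite_induct[OF finite])
    case 1 then show ?case by (rule one)
  next
    case (2 i I)
    have "mon 0 (insert i I) = cscale (sg {i} I) (amult (mon 0 {i}) (mon 0 I))"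
      using 2(2) by (simp add: amult_mon)
    then have "amult (mon 0 (insert i I)) = (\<lambda>f. cscale (sg {i} I) (amult (amult (mon 0 {i}) (mon 0 I)) f))"
      by (auto simp: amult_scale_left)
    then show ?case
      using weyl.intros(7)[OF comp[OF weyl.intros(3) 2(3)]] by simp
  qed
  have m: "amult (mon k I) \<in> weyl" for k and I :: "'a set"
    using comp[OF pw[of k] I[of I]] by (simp add: amult_mon)
  show ?thesis
  proof (induction f rule: pm_induct)
    case zero
    have "amult 0 = (0 :: 'a oper)" by auto
    then show ?case using weyl_zero by metis
  next
    case (single b c)
    have "Poly_Mapping.single b c = cscale c (mon (fst b) (snd b))" by (simp add: mon_def)
    then have "amult (Poly_Mapping.single b c) = (\<lambda>f. cscale c (amult (mon (fst b) (snd b)) f))"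
      by (auto simp: amult_scale_left)
    then show ?case using weyl.intros(7)[OF m] by simp
  next
    case (add f g)
    have "amult (f + g) = amult f + amult g" by (auto simp: amult_add_left)
    then show ?case using add weyl.intros(8) by metis
  qed
qed

lemma weyl_d_var: "d_var j \<in> weyl"
  by (cases j) (simp_all add: weyl.intros)

lemma weyl_vf: "vf g j \<in> weyl"
proof -
  have "vf g j = amult g \<circ> d_var j" by (auto simp: vf_def)
  then show ?thesis using weyl.intros(9)[OF weyl_amult weyl_d_var] by simp
qed

lemma weyl_clin: "x \<in> weyl \<Longrightarrow> clin x"
  by (induction x rule: weyl.induct)
    (auto intro: clin_comp clin_plus clin_cscale clin_id simp: plus_fun_def id_def comp_def)

lemma coef_add: "coef (x + y) j = coef x j + coef y j"
  by (cases j) (simp_all add: coef_def)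

lemma coef_diff: "coef (x - y) j = coef x j - coef y j"
  by (cases j) (simp_all add: coef_def)

lemma coef_scale: "coef (\<lambda>f. cscale c (x f)) j = cscale c (coef x j)"
  by (cases j) (simp_all add: coef_def)

lemma coef_vf: "coef (vf g j) l = (if l = j then g else 0)"
  by (cases j; cases l) (auto simp: coef_def vf_def)

lemma coef_part:
  assumes "x \<in> oper_part p"
  shows "coef x j \<in> lau_part (p + pd j)"
proof (cases j)
  case None
  have "x ` lau_part 0 \<subseteq> lau_part (p + 0)" using assms by (auto simp only: oper_part_def)
  moreover have "mon 1 {} \<in> lau_part 0" by simp
  ultimately show ?thesis using None by (auto simp: coef_def simp del: mon_lau_part')
next
  case (Some i)
  have "x ` lau_part 1 \<subseteq> lau_part (p + 1)" using assms by (auto simp: oper_part_def)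
  moreover have "mon 0 {i} \<in> lau_part 1" by simp
  ultimately show ?thesis using Some by (auto simp: coef_def simp del: mon_lau_part')
qed

lemma sum_fun_apply: "(sum x S) h = (\<Sum>a\<in>S. x a h)"
  by (induction S rule: infinite_finite_induct) auto

lemma coef_sum: "coef (sum x S) j = (\<Sum>a\<in>S. coef (x a) j)"
  by (cases j) (simp_all add: coef_def sum_fun_apply)

text \<open>Subtracting the candidate expansion leaves a superderivation of the same parity that
  vanishes on t and on all xi_i.\<close>

lemma superder_expand:
  assumes x: "x \<in> superder p"
  shows "x = (\<Sum>j\<in>UNIV. vf (coef x j) j)"
proof -
  have v: "vf (coef x j) j \<in> superder p" for j
    using vf_superder[OF coef_part[OF superderD(2)[OF x]], of j j] by (simp add: add.assoc)
  define y where "y = x - (\<Sum>j\<in>UNIV. vf (coef x j) j)"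
  have "y \<in> superder p" unfolding y_def by (intro superder_diff superder_sum x v)
  moreover have c: "coef y l = 0" for l
    by (simp add: y_def coef_diff coef_sum coef_vf)
  have "y (mon 1 {}) = 0" "\<And>i. y (mon 0 {i}) = 0"
    using c[of None] c[of "Some i" for i] by (simp_all add: coef_def)
  ultimately have "y h = 0" for h by (rule superder_eq_0)
  then have "y = 0" by auto
  then show ?thesis by (simp add: y_def)
qed

lemma W_alg_expand:
  assumes x: "x \<in> W_alg"
  shows "x = (\<Sum>j\<in>UNIV. vf (coef x j) j)"
proof -
  obtain y z where yz: "x = y + z" "y \<in> superder 0" "z \<in> superder 1"
    using x by (auto simp: W_alg_def)
  have va: "vf (f + g) j = vf f j + vf g j" for f g :: "'a lau" and j
    by (auto simp: vf_def amult_add_left)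
  show ?thesis
    using superder_expand[OF yz(2)] superder_expand[OF yz(3)]
    by (simp add: yz(1) coef_add va sum.distrib)
qed

lemma W_alg_weyl: "x \<in> W_alg \<Longrightarrow> x \<in> weyl"
  by (subst W_alg_expand) (auto intro: weyl_sum weyl_vf)

lemma superder_W: "x \<in> superder p \<Longrightarrow> x \<in> W_alg"
proof -
  assume x: "x \<in> superder p"
  have "x = x + 0" "x = 0 + x" by simp_all
  then show ?thesis using x superder_zero[of 0] superder_zero[of 1] unfolding W_alg_def by (cases p) blast+
qed

lemma W_alg_add: "x \<in> W_alg \<Longrightarrow> y \<in> W_alg \<Longrightarrow> x + y \<in> W_alg"
proof -
  assume "x \<in> W_alg" "y \<in> W_alg"
  then obtain a b c d where "x = a + b" "y = c + d" "a \<in> superder 0" "b \<in> superder 1" "c \<in> superder 0" "d \<in> superder 1"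
    by (auto simp: W_alg_def)
  then have "x + y = (a + c) + (b + d)" "a + c \<in> superder 0" "b + d \<in> superder 1"
    by (simp_all add: algebra_simps superder_add)
  then show ?thesis unfolding W_alg_def by blast
qed

lemma W_alg_scale: "x \<in> W_alg \<Longrightarrow> (\<lambda>f. cscale c (x f)) \<in> W_alg"
proof -
  assume "x \<in> W_alg"
  then obtain a b where "x = a + b" "a \<in> superder 0" "b \<in> superder 1"
    by (auto simp: W_alg_def)
  then have "(\<lambda>f. cscale c (x f)) = (\<lambda>f. cscale c (a f)) + (\<lambda>f. cscale c (b f))"
    "(\<lambda>f. cscale c (a f)) \<in> superder 0" "(\<lambda>f. cscale c (b f)) \<in> superder 1"
    by (auto simp: cscale_add_right superder_cscale)
  then show ?thesis unfolding W_alg_def by blast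
qed

text \<open>Elements of \<open>W_alg\<close> are sums of an even and an odd superderivation. If the
  sum has parity p, the component of parity p + 1 equals its own negative and therefore
  vanishes.\<close>

lemma S_alg_superder:
  assumes "x \<in> homog S_alg p"
  shows "x \<in> superder p"
proof -
  from assms have xp: "x \<in> oper_part p" and "x \<in> W_alg" by (auto simp: S_alg_def)
  then obtain y z where yz: "x = y + z" "y \<in> superder 0" "z \<in> superder 1"
    by (auto simp: W_alg_def)
  define u where "u = (if p = 0 then y else z)"
  define v where "v = (if p = 0 then z else y)"
  have u: "u \<in> superder p" and v: "v \<in> superder (p + 1)" and xuv: "x = u + v"
    using yz by (cases p; simp add: u_def v_def add.commute)+
  have "v h = 0" for h
  proof -
    have "x (lau_sigma h) = u (lau_sigma h) + v (lau_sigma h)" by (simp add: xuv)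
    moreover have "clin x" using superderD(1)[OF u] superderD(1)[OF v] by (auto simp: xuv plus_fun_def intro: clin_plus)
    then have "lau_sigma (x h) = cscale (ksign p) (x (lau_sigma h))" using xp by (simp add: oper_part_iff)
    moreover have "lau_sigma (u h) = cscale (ksign p) (u (lau_sigma h))"
      "lau_sigma (v h) = cscale (ksign (p + 1)) (v (lau_sigma h))"
      using superderD[OF u] superderD[OF v] by (simp_all add: oper_part_iff)
    moreover have "x h = u h + v h" by (simp add: xuv)
    ultimately have "cscale (ksign (p + 1)) (v (lau_sigma h)) = cscale (ksign p) (v (lau_sigma h))"
      by (simp add: clin_add[OF clin_sigma] cscale_add_right)
    then have "cscale (ksign p) (v (lau_sigma h)) = 0"
      by (auto simp: ksign_add poly_mapping_eq_iff fun_eq_iff neg_eq_iff_add_eq_0[symmetric] simp flip: mult_2)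
    then have "v (lau_sigma h) = 0" by (cases p) simp_all
    then have "lau_sigma (v h) = 0" using superderD[OF v] by (simp add: oper_part_iff)
    then have "lau_sigma (lau_sigma (v h)) = 0" by (simp only: clin_zero[OF clin_sigma])
    then show ?thesis by simp
  qed
  then have "v = 0" by auto
  with u xuv show ?thesis by simp
qed

text \<open>In the supercommutator the cross terms (x f)(y g) and (y f)(x g) cancel; the signs are
  checked separately for the eight combinations of parities.\<close>

lemma sbracket_superder:
  assumes x: "x \<in> superder p" and y: "y \<in> superder q"
  shows "sbracket p q x y \<in> superder (p + q)"
proof -
  have cx: "clin x" and cy: "clin y" using assms by (auto simp: superder_def)
  have c: "clin (sbracket p q x y)"
    unfolding sbracket_def by (rule clin_minusf[OF clin_comp[OF cx cy] clin_cscale[OF clin_comp[OF cy cx]]])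
  have "lau_sigma (x h) = cscale (ksign p) (x (lau_sigma h))"
    "lau_sigma (y h) = cscale (ksign q) (y (lau_sigma h))" for h
    using superderD[OF x] superderD[OF y] by (simp_all add: oper_part_iff)
  then have "sbracket p q x y \<in> oper_part (p + q)"
    unfolding oper_part_iff[OF c]
    by (simp add: sbracket_def clin_diff[OF clin_sigma] clin_scale[OF clin_sigma] clin_scale[OF cx] clin_scale[OF cy]
        cscale_diff_right ksign_add mult_ac)
  moreover have "sbracket p q x y (amult f g) = amult (sbracket p q x y f) g + cscale (ksign ((p + q) * r)) (amult f (sbracket p q x y g))"
    if f: "f \<in> lau_part r" for f g r
  proof -
    have xf: "x f \<in> lau_part (p + r)" and yf: "y f \<in> lau_part (q + r)"
      using f superderD(2)[OF x] superderD(2)[OF y] by (simp_all add: oper_part_def image_subset_iff)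
    show ?thesis
      unfolding sbracket_def superderD(3)[OF x f] superderD(3)[OF y f] clin_add[OF cx] clin_add[OF cy] clin_scale[OF cx] clin_scale[OF cy]
        superderD(3)[OF x yf] superderD(3)[OF y xf] superderD(3)[OF x f] superderD(3)[OF y f]
      by (cases p; cases q; cases r)
        (simp_all add: clin_diff[OF clin_amult] clin_diff[OF clin_amult_left] amult_scale_right amult_scale_left
          cscale_add_right cscale_diff_right amult_add_left amult_add_right amult_minus_left amult_minus_right algebra_simps)
  qed
  ultimately show ?thesis using c by (auto simp: superder_def)
qed

section \<open>The derived algebra \<open>S'\<close> as a span of brackets\<close>

interpretation ops: vector_space "\<lambda>c (x :: 'a \<Rightarrow> ('b \<Rightarrow>\<^sub>0 complex)) f. cscale c (x f)"
  by unfold_locales (auto simp: cscale_add_right cscale_add_left)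

lemma S'_alg_add: "x \<in> S'_alg \<Longrightarrow> y \<in> S'_alg \<Longrightarrow> x + y \<in> S'_alg"
  unfolding S'_alg_def by (rule ops.span_add)

lemma S'_alg_scale: "x \<in> S'_alg \<Longrightarrow> (\<lambda>f. cscale c (x f)) \<in> S'_alg"
  unfolding S'_alg_def by (rule ops.span_scale)

lemma S'_alg_zero: "0 \<in> S'_alg"
  unfolding S'_alg_def by (rule ops.span_zero)

lemma S'_alg_bracket: "x \<in> homog S_alg p \<Longrightarrow> y \<in> homog S_alg q \<Longrightarrow> sbracket p q x y \<in> S'_alg"
  unfolding S'_alg_def by (rule ops.span_base) blast

text \<open>The scalar is part of the bracket case, so no separate case for scaling remains.\<close>

lemma S'_alg_induct [consumes 1, case_names bracket zero add]:
  assumes "x \<in> S'_alg"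
    and "\<And>c p q x y. x \<in> homog S_alg p \<Longrightarrow> y \<in> homog S_alg q \<Longrightarrow> Q (\<lambda>f. cscale c (sbracket p q x y f))"
    and "Q 0" "\<And>x y. x \<in> S'_alg \<Longrightarrow> y \<in> S'_alg \<Longrightarrow> Q x \<Longrightarrow> Q y \<Longrightarrow> Q (x + y)"
  shows "Q x"
proof -
  have "x \<in> S'_alg \<and> Q x"
    using assms(1) unfolding S'_alg_def
  proof (induction rule: ops.span_induct_alt)
    case base
    show ?case using assms(3) by (intro conjI ops.span_zero)
  next
    case (step c x y)
    then obtain p q u v where x: "x = sbracket p q u v" "u \<in> homog S_alg p" "v \<in> homog S_alg q" by auto
    have "(\<lambda>f. cscale c (x f)) \<in> S'_alg" "Q (\<lambda>f. cscale c (x f))"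
      using assms(2)[OF x(2,3), of c] S'_alg_scale[OF S'_alg_bracket[OF x(2,3)], of c] by (simp_all add: x(1))
    then show ?case
      using step assms(4) S'_alg_add unfolding S'_alg_def by blast
  qed
  then show ?thesis ..
qed

lemma S'_alg_W: "x \<in> S'_alg \<Longrightarrow> x \<in> W_alg"
proof (induction rule: S'_alg_induct)
  case (bracket c p q x y)
  then show ?case
    by (intro W_alg_scale superder_W[OF sbracket_superder] S_alg_superder)
next
  case zero
  show ?case by (rule superder_W[OF superder_zero])
next
  case (add x y)
  show ?case by (rule W_alg_add[OF add(3,4)])
qed

lemma S'_alg_weyl: "x \<in> S'_alg \<Longrightarrow> x \<in> weyl"
  by (rule W_alg_weyl[OF S'_alg_W])

text \<open>Moving the coefficients to the right of the derivatives produces, by the Leibniz rule,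
  exactly one extra term: multiplication by the superdivergence, which is zero.\<close>

lemma S_alg_right:
  assumes x: "x \<in> S_alg"
  shows "x h = d_t (amult (coef x None) h) + (\<Sum>i\<in>UNIV. d_xi i (amult (lau_sigma (coef x (Some i))) h))"
proof -
  have W: "x \<in> W_alg" and div: "superdiv x = 0" using x by (auto simp: S_alg_def)
  have "d_t (amult (coef x None) h) + (\<Sum>i\<in>UNIV. d_xi i (amult (lau_sigma (coef x (Some i))) h))
    = amult (superdiv x) h + (vf (coef x None) None h + (\<Sum>i\<in>UNIV. vf (coef x (Some i)) (Some i) h))"
    by (simp add: superdiv_def d_t_amult d_xi_amult amult_add_left clin_sum[OF clin_amult_left] sum.distrib vf_def)
  also have "\<dots> = (\<Sum>j\<in>UNIV. vf (coef x j) j h)"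
    by (simp add: div UNIV_option_conv sum.reindex)
  also have "\<dots> = x h"
    using arg_cong[OF W_alg_expand[OF W], of "\<lambda>y. y h"] by (simp only: sum_fun_apply)
  finally show ?thesis by simp
qed


subsection \<open>Elements of \<open>S'\<close>\<close>

lemma superdiv_add: "superdiv (x + y) = superdiv x + superdiv y"
  by (simp add: superdiv_def coef_add clin_add[OF clin_sigma] clin_add[OF clin_d_t] clin_add[OF clin_d_xi] sum.distrib)

lemma superdiv_scale: "superdiv (\<lambda>f. cscale c (x f)) = cscale c (superdiv x)"
  by (simp add: superdiv_def coef_scale clin_scale[OF clin_sigma] clin_scale[OF clin_d_t] clin_scale[OF clin_d_xi]
      cscale_add_right cscale_sum)

lemma superdiv_vf: "superdiv (vf g j) = d_var j (lsig j g)"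
proof (cases j)
  case None
  then show ?thesis by (simp add: superdiv_def coef_vf clin_zero[OF clin_sigma] clin_zero[OF clin_d_xi])
next
  case (Some i)
  have "d_xi s (lau_sigma (if s = i then g else 0)) = (if s = i then d_xi i (lau_sigma g) else 0)" for s
    by (simp add: clin_zero[OF clin_sigma] clin_zero[OF clin_d_xi])
  then show ?thesis
    using Some by (simp add: superdiv_def coef_vf clin_zero[OF clin_d_t])
qed

lemma vf_homog_S:
  assumes "g \<in> lau_part p" "d_var j g = 0"
  shows "vf g j \<in> homog S_alg (p + pd j)"
proof -
  have "d_var j (lsig j g) = 0"
    using assms sigma_d_xi by (cases j) (auto simp: lau_part_iff clin_scale[OF clin_d_xi])
  then show ?thesis
    using vf_superder[OF assms(1), of j] by (simp add: S_alg_def superder_W superdiv_vf superderD(2))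
qed

lemma rotation_homog_S:
  assumes "i \<noteq> j"
  shows "vf (mon 0 {i}) (Some i) - vf (mon 0 {j}) (Some j) \<in> homog S_alg 0"
proof -
  have 1: "vf (mon 0 {k}) (Some k) \<in> superder 0" for k :: 'a
    using vf_superder[OF mon_lau_part'(2), of 0 k "Some k"] by simp
  have "superdiv (vf (mon 0 {i}) (Some i) + (\<lambda>f. cscale (-1) (vf (mon 0 {j}) (Some j) f))) = 0"
    unfolding superdiv_add superdiv_scale superdiv_vf by (simp add: lau_sigma_mon clin_minus[OF clin_d_xi])
  moreover have "vf (mon 0 {i}) (Some i) + (\<lambda>f. cscale (-1) (vf (mon 0 {j}) (Some j) f)) = vf (mon 0 {i}) (Some i) - vf (mon 0 {j}) (Some j)"
    by auto
  ultimately show ?thesis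
    using superder_diff[OF 1[of i] 1[of j]] superder_W by (auto simp: S_alg_def dest: superderD(2))
qed

lemma ex_other:
  fixes i :: "'n::finite"
  assumes "CARD('n) \<ge> 2"
  shows "\<exists>j. j \<noteq> i"
proof (rule ccontr)
  assume "\<not> ?thesis"
  then have "(UNIV :: 'n set) = {i}" by auto
  then have "CARD('n) = 1" by (metis is_singletonI is_singleton_altdef)
  with assms show False by simp
qed

lemma xi_xi [simp]: "amult (mon 0 {i}) (mon 0 {i}) = 0" "amult (mon 0 {i}) (amult (mon 0 {i}) f) = 0"
  by (simp_all add: amult_mon flip: amult_assoc)

lemma xi_swap: "amult (mon 0 {i}) (amult (mon 0 {j}) f) = - amult (mon 0 {j}) (amult (mon 0 {i}) f)"
  using xi_right[of "mon 0 {i}" j] by (simp add: lau_sigma_mon amult_minus_right amult_minus_left flip: amult_assoc)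

text \<open>The kernel of \<open>d_xi i\<close> equals its image, so the condition on the
  coefficient can be encoded as \<open>d_xi i G\<close>. With G arbitrary, induction over monomials
  needs no side condition.\<close>

lemma S'_vf_xi:
  fixes i :: "'n::{finite,linorder}"
  assumes n: "CARD('n) \<ge> 2"
  shows "vf (d_xi i G) (Some i) \<in> S'_alg"
proof -
  obtain j where ij: "j \<noteq> i" using ex_other[OF n] by blast
  have mon: "vf (mon k J) (Some i) \<in> S'_alg" if "i \<notin> J" for k J
  proof -
    let ?g = "mon k J" and ?H = "vf (mon 0 {i}) (Some i) - vf (mon 0 {j}) (Some j)"
    \<comment> \<open>The eigenvalue of xi_j d/dxi_j on the monomial g. Bracketing with
      \<open>?H\<close> multiplies g d/dxi_i by -(1 + c), which is -1 or -2 and can be divided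
      out.\<close>
    define c :: complex where "c = (if j \<in> J then 1 else 0)"
    have xd: "amult (mon 0 {j}) (d_xi j ?g) = cscale c ?g"
      by (auto simp: c_def d_xi_mon amult_scale_right amult_mon insert_absorb sg_insert_right[of j "J - {j}" "{j}", symmetric])
    have ig: "d_xi i ?g = 0" using that by (simp add: d_xi_mon)
    have gx: "amult ?g (amult (mon 0 {l}) f) = amult (mon 0 {l}) (amult (lau_sigma ?g) f)" for l f
      using xi_right[of ?g l] by (simp flip: amult_assoc)
    have "sbracket 0 (of_nat (card J) + 1) ?H (vf ?g (Some i)) h = cscale (- (1 + c)) (vf ?g (Some i) h)" for h
    proof -
      have 1: "?H (vf ?g (Some i) h) = - (amult (mon 0 {j}) (amult (d_xi j ?g) (d_xi i h))
          + amult (mon 0 {j}) (amult (lau_sigma ?g) (d_xi j (d_xi i h))))"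
        using ig by (simp add: vf_def d_xi_amult amult_add_right)
      have 2: "vf ?g (Some i) (?H h) = amult ?g (d_xi i h) + amult (mon 0 {j}) (amult (lau_sigma ?g) (d_xi i (d_xi j h)))"
        using ij by (simp add: vf_def d_xi_amult clin_diff[OF clin_d_xi] clin_diff[OF clin_amult] amult_add_right
            lau_sigma_mon amult_minus_left amult_minus_right gx)
      have 3: "amult (mon 0 {j}) (amult (d_xi j ?g) (d_xi i h)) = cscale c (amult ?g (d_xi i h))"
        by (simp add: xd amult_scale_left flip: amult_assoc)
      show ?thesis
        unfolding sbracket_def 1 2 3
        by (simp add: d_xi_d_xi[of i j] vf_def amult_minus_right cs.scale_left_diff_distrib)
    qed
    then have "sbracket 0 (of_nat (card J) + 1) ?H (vf ?g (Some i)) = (\<lambda>h. cscale (- (1 + c)) (vf ?g (Some i) h))"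
      by auto
    moreover have "vf ?g (Some i) \<in> homog S_alg (of_nat (card J) + 1)"
      using vf_homog_S[OF mon_lau_part[of k J], of "Some i"] ig by simp
    moreover have "?H \<in> homog S_alg 0" using ij by (intro rotation_homog_S) auto
    ultimately have "(\<lambda>h. cscale (- (1 + c)) (vf ?g (Some i) h)) \<in> S'_alg"
      using S'_alg_bracket by metis
    from S'_alg_scale[OF this, of "- 1 / (1 + c)"] show ?thesis
      by (cases "j \<in> J") (auto simp: c_def)
  qed
  show ?thesis
  proof (induction G rule: pm_induct)
    case zero
    have "vf (d_xi i 0) (Some i) = 0" by (auto simp: vf_def clin_zero[OF clin_d_xi])
    then show ?case using S'_alg_zero by metis
  next
    case (single b c)
    obtain k J where b: "b = (k, J)" by (cases b)
    have "Poly_Mapping.single b c = cscale c (mon k J)" by (simp add: b mon_def)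
    then have "vf (d_xi i (Poly_Mapping.single b c)) (Some i)
        = (if i \<in> J then (\<lambda>h. cscale (c * sg {i} J) (vf (mon k (J - {i})) (Some i) h)) else 0)"
      by (auto simp: vf_def d_xi_mon clin_scale[OF clin_d_xi] amult_scale_left)
    moreover have "(\<lambda>h. cscale (c * sg {i} J) (vf (mon k (J - {i})) (Some i) h)) \<in> S'_alg"
      by (rule S'_alg_scale[OF mon]) simp
    ultimately show ?case using S'_alg_zero by metis
  next
    case (add f g)
    have "vf (d_xi i (f + g)) (Some i) = vf (d_xi i f) (Some i) + vf (d_xi i g) (Some i)"
      by (auto simp: vf_def clin_add[OF clin_d_xi] amult_add_left)
    then show ?case using add S'_alg_add by metis
  qed
qed

text \<open>The field xi_j d/dt is an eigenvector, with eigenvalue 1, of the bracket with xi_j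
  d/dxi_j - xi_i d/dxi_i, hence itself a bracket in \<open>S_alg\<close>.\<close>

lemma S'_vf_t:
  fixes j :: "'n::{finite,linorder}"
  assumes n: "CARD('n) \<ge> 2"
  shows "vf (mon 0 {j}) None \<in> S'_alg"
proof -
  obtain i where ij: "i \<noteq> j" using ex_other[OF n] by blast
  let ?H = "vf (mon 0 {j}) (Some j) - vf (mon 0 {i}) (Some i)"
  have "sbracket 0 1 ?H (vf (mon 0 {j}) None) h = vf (mon 0 {j}) None h" for h
    using ij xi_swap[of i j] by (simp add: sbracket_def vf_def d_xi_amult clin_diff[OF clin_d_xi] clin_diff[OF clin_amult] clin_diff[OF clin_d_t]
        amult_add_right d_t_amult lau_sigma_mon amult_minus_left amult_minus_right d_t_d_xi)
  then have "sbracket 0 1 ?H (vf (mon 0 {j}) None) = vf (mon 0 {j}) None" by auto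
  moreover have "vf (mon 0 {j}) None \<in> homog S_alg 1"
    using vf_homog_S[OF mon_lau_part'(2), of None 0 j] by simp
  moreover have "?H \<in> homog S_alg 0" using ij by (intro rotation_homog_S) auto
  ultimately show ?thesis using S'_alg_bracket by metis
qed

text \<open>The superbracket of d/dxi_j and xi_j d/dt is d/dt.\<close>

lemma S'_d_t:
  assumes n: "CARD('n::{finite,linorder}) \<ge> 2"
  shows "(d_t :: 'n oper) \<in> S'_alg"
proof -
  obtain j :: 'n where True by simp
  have "sbracket 1 1 (vf (mon 0 {}) (Some j)) (vf (mon 0 {j}) None) h = d_t h" for h
    by (simp add: sbracket_def vf_def d_xi_amult d_t_amult d_t_d_xi lau_sigma_mon amult_minus_left)
  then have "sbracket 1 1 (vf (mon 0 {}) (Some j)) (vf (mon 0 {j}) None) = d_t" by auto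
  moreover have "vf (mon 0 {j}) None \<in> homog S_alg 1"
    using vf_homog_S[OF mon_lau_part'(2), of None 0 j] by simp
  moreover have "vf (mon 0 {}) (Some j) \<in> homog S_alg 1"
    using vf_homog_S[OF mon_lau_part'(1), of "Some j" 0] by simp
  ultimately show ?thesis using S'_alg_bracket by metis
qed

lemma S'_d_xi:
  fixes i :: "'n::{finite,linorder}"
  assumes n: "CARD('n) \<ge> 2"
  shows "d_xi i \<in> S'_alg"
proof -
  have "vf (d_xi i (mon 0 {i})) (Some i) = d_xi i" by (auto simp: vf_def)
  then show ?thesis using S'_vf_xi[OF n, of i "mon 0 {i}"] by simp
qed


section \<open>Graded vector spaces and Weyl modules\<close>

locale graded_space = vector_space scale
  for scale :: "complex \<Rightarrow> 'v::ab_group_add \<Rightarrow> 'v" +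
  fixes par :: "'v \<Rightarrow> 'v" and prt :: "bit \<Rightarrow> 'v set"
  assumes par_add: "par (u + v) = par u + par v"
    and par_scale: "par (scale c v) = scale c (par v)"
    and par_par [simp]: "par (par v) = v"
    and prt_iff: "v \<in> prt p \<longleftrightarrow> par v = scale (ksign p) v"
begin

text \<open>The two summands are the projections (1 + par)/2 and (1 - par)/2 onto the even and the
  odd part.\<close>

lemma half: "v = scale (1/2) (v + par v) + scale (1/2) (v - par v)"
proof -
  have "scale (1/2) (v + par v) + scale (1/2) (v - par v) = scale (1/2 + 1/2) v"
    by (simp add: scale_right_distrib scale_right_diff_distrib flip: scale_left_distrib)
  then show ?thesis by simp
qed

lemma par_0 [simp]: "par 0 = 0"
  using par_scale[of 0 0] by simp

lemma par_minus: "par (- v) = - par v"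
  using par_scale[of "-1" v] by simp

lemma par_diff: "par (u - v) = par u - par v"
  using par_add[of u "- v"] by (simp add: par_minus)

lemma half_prt: "scale (1/2) (v + par v) \<in> prt 0" "scale (1/2) (v - par v) \<in> prt 1"
  by (simp_all add: prt_iff par_scale par_add par_diff add.commute scale_right_diff_distrib)

lemma decomp: obtains v0 v1 where "v0 \<in> prt 0" "v1 \<in> prt 1" "v = v0 + v1"
  using half half_prt by blast

lemma graded_iff:
  assumes "subspace N"
  shows "(\<forall>v\<in>N. \<exists>v0 \<in> N \<inter> prt 0. \<exists>v1 \<in> N \<inter> prt 1. v = v0 + v1) \<longleftrightarrow> (\<forall>v\<in>N. par v \<in> N)"
proof
  assume L: "\<forall>v\<in>N. \<exists>v0 \<in> N \<inter> prt 0. \<exists>v1 \<in> N \<inter> prt 1. v = v0 + v1"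
  show "\<forall>v\<in>N. par v \<in> N"
  proof
    fix v assume "v \<in> N"
    with L obtain v0 v1 where "v0 \<in> N" "v0 \<in> prt 0" "v1 \<in> N" "v1 \<in> prt 1" "v = v0 + v1" by blast
    then have "par v = v0 - v1" by (simp add: par_add prt_iff)
    with \<open>v0 \<in> N\<close> \<open>v1 \<in> N\<close> assms show "par v \<in> N" by (simp add: subspace_diff)
  qed
next
  assume R: "\<forall>v\<in>N. par v \<in> N"
  show "\<forall>v\<in>N. \<exists>v0 \<in> N \<inter> prt 0. \<exists>v1 \<in> N \<inter> prt 1. v = v0 + v1"
  proof
    fix v assume "v \<in> N"
    then have "scale (1/2) (v + par v) \<in> N" "scale (1/2) (v - par v) \<in> N"
      using R assms by (simp_all add: subspace_add subspace_diff subspace_scale)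
    then show "\<exists>v0 \<in> N \<inter> prt 0. \<exists>v1 \<in> N \<inter> prt 1. v = v0 + v1"
      using half half_prt by blast
  qed
qed

end

locale weyl_mod =
  fixes P :: "('n::{finite,linorder} oper, 'p::ab_group_add) smod"
  assumes weyl_module: "weyl_module P"
begin

abbreviation sm :: "complex \<Rightarrow> 'p \<Rightarrow> 'p" where "sm \<equiv> smult P"
definition M :: "'n lau \<Rightarrow> 'p \<Rightarrow> 'p" where "M f = act P (amult f)"
definition D :: "'n option \<Rightarrow> 'p \<Rightarrow> 'p" where "D j = act P (d_var j)"
abbreviation \<sigma> :: "'p \<Rightarrow> 'p" where "\<sigma> \<equiv> twist P 1"
abbreviation plin :: "('p \<Rightarrow> 'p) \<Rightarrow> bool" where "plin \<equiv> Vector_Spaces.linear sm sm"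

sublocale vs: vector_space sm
  using weyl_module by (simp add: weyl_module_def)

lemma P_simps [simp]: "carrier P = UNIV" "add P = (+)" "zero P = 0"
  using weyl_module by (simp_all add: weyl_module_def)

lemma subspace_part: "vs.subspace (part P p)"
  and part_ex1: "\<exists>!w. w \<in> part P 0 \<and> v - w \<in> part P 1"
  and act_linear: "x \<in> weyl \<Longrightarrow> plin (act P x)"
  and act_id: "act P id v = v"
  and act_scale: "x \<in> weyl \<Longrightarrow> act P (\<lambda>f. cscale c (x f)) v = sm c (act P x v)"
  and act_plus: "x \<in> weyl \<Longrightarrow> y \<in> weyl \<Longrightarrow> act P (x + y) v = act P x v + act P y v"
  and act_comp: "x \<in> weyl \<Longrightarrow> y \<in> weyl \<Longrightarrow> act P (x \<circ> y) v = act P x (act P y v)"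
  and act_part: "x \<in> homog weyl p \<Longrightarrow> v \<in> part P q \<Longrightarrow> act P x v \<in> part P (p + q)"
proof -
  note * = weyl_module[unfolded weyl_module_def]
  from * show "vs.subspace (part P p)" by (elim conjE) (rule spec)
  from * show "\<exists>!w. w \<in> part P 0 \<and> v - w \<in> part P 1" by (elim conjE) (rule spec)
  from * show "x \<in> weyl \<Longrightarrow> plin (act P x)" by (elim conjE) simp
  from * show "act P id v = v" by (elim conjE) (rule spec)
  from * show "x \<in> weyl \<Longrightarrow> act P (\<lambda>f. cscale c (x f)) v = sm c (act P x v)" by (elim conjE) simp
  from * show "x \<in> weyl \<Longrightarrow> y \<in> weyl \<Longrightarrow> act P (x + y) v = act P x v + act P y v" by (elim conjE) simp
  from * show "x \<in> weyl \<Longrightarrow> y \<in> weyl \<Longrightarrow> act P (x \<circ> y) v = act P x (act P y v)" by (elim conjE) simp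
  from * show "x \<in> homog weyl p \<Longrightarrow> v \<in> part P q \<Longrightarrow> act P x v \<in> part P (p + q)" by (elim conjE) simp
qed

lemma twist_add_parts:
  assumes "v0 \<in> part P 0" "v1 \<in> part P 1"
  shows "twist P q (v0 + v1) = v0 + sm (ksign q) v1"
proof -
  have uniq: "w = v0" if "w \<in> part P 0" "v0 + v1 - w \<in> part P 1" for w
  proof -
    have "v0 \<in> part P 0 \<and> v0 + v1 - v0 \<in> part P 1" using assms by simp
    then show ?thesis using that part_ex1[of "v0 + v1"] by blast
  qed
  have "hcomp P 0 (v0 + v1) = v0"
    unfolding hcomp_def by (rule the_equality) (use assms uniq in auto)
  moreover have "hcomp P 1 (v0 + v1) = v1"
    unfolding hcomp_def
  proof (rule the_equality)
    fix w assume w: "w \<in> part P 1 \<and> v0 + v1 - w \<in> part P (1 + 1)"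
    then have "v0 + v1 - w = v0" by (intro uniq) simp_all
    then show "w = v1" by (simp add: algebra_simps)
  qed (use assms in simp)
  ultimately show ?thesis by (simp add: twist_def)
qed

lemma part_decomp: obtains v0 v1 where "v0 \<in> part P 0" "v1 \<in> part P 1" "v = v0 + v1"
  using part_ex1[of v] by (metis add_diff_cancel_left' diff_add_cancel add.commute)

lemma twist_0 [simp]: "twist P 0 v = v"
  by (rule part_decomp[of v]) (simp add: twist_add_parts)

lemma part_0: "0 \<in> part P p"
  using subspace_part by (rule vs.subspace_0)

sublocale gr: graded_space sm \<sigma> "part P"
proof unfold_locales
  fix u v c p
  obtain u0 u1 where u: "u0 \<in> part P 0" "u1 \<in> part P 1" "u = u0 + u1" by (rule part_decomp)
  obtain v0 v1 where v: "v0 \<in> part P 0" "v1 \<in> part P 1" "v = v0 + v1" by (rule part_decomp)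
  note sub = vs.subspace_add[OF subspace_part] vs.subspace_scale[OF subspace_part]
  have "u + v = (u0 + v0) + (u1 + v1)" by (simp add: u v)
  then have "\<sigma> (u + v) = (u0 + v0) - (u1 + v1)"
    using u v twist_add_parts[of "u0 + v0" "u1 + v1" 1] by (simp only: sub) simp
  then show "\<sigma> (u + v) = \<sigma> u + \<sigma> v"
    using u v by (simp add: twist_add_parts)
  show "\<sigma> (sm c v) = sm c (\<sigma> v)"
    using v twist_add_parts[of "sm c v0" "sm c v1" 1]
    by (simp add: sub twist_add_parts vs.scale_right_distrib vs.scale_right_diff_distrib)
  show "\<sigma> (\<sigma> v) = v"
    using v twist_add_parts[of v0 "- v1" 1] vs.subspace_neg[OF subspace_part] by (simp add: twist_add_parts)
  show "v \<in> part P p \<longleftrightarrow> \<sigma> v = sm (ksign p) v"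
  proof
    assume vp: "v \<in> part P p"
    then show "\<sigma> v = sm (ksign p) v"
      using twist_add_parts[of v 0 1] twist_add_parts[of 0 v 1] part_0 by (cases p) simp_all
  next
    assume e: "\<sigma> v = sm (ksign p) v"
    have s: "\<sigma> v = v0 - v1" using v by (simp add: twist_add_parts)
    \<comment> \<open>A complex vector space has no 2-torsion; the eigenvalue equation says that
      twice the component of the wrong parity is zero.\<close>
    have z: "w = 0" if "w + w = 0" for w :: 'p
    proof -
      have "sm (1 + 1) w = 0" using that by (simp only: vs.scale_left_distrib vs.scale_one)
      then show ?thesis by simp
    qed
    show "v \<in> part P p"
    proof (cases p)
      case zero
      then have "v0 - v1 = v0 + v1" unfolding s [symmetric] v(3) [symmetric] e by simp
      moreover have "v1 + v1 = (v0 + v1) - (v0 - v1)" by simp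
      ultimately have "v1 + v1 = 0" by simp
      from z[OF this] show ?thesis using v zero by simp
    next
      case one
      then have "v0 - v1 = - (v0 + v1)" unfolding s [symmetric] v(3) [symmetric] e by simp
      moreover have "v0 + v0 = (v0 - v1) + (v0 + v1)" by simp
      ultimately have "v0 + v0 = 0" by (metis add.left_inverse)
      from z[OF this] show ?thesis using v one by simp
    qed
  qed
qed

lemma plin_add: "plin \<phi> \<Longrightarrow> \<phi> (u + v) = \<phi> u + \<phi> v"
  and plin_scale: "plin \<phi> \<Longrightarrow> \<phi> (sm c v) = sm c (\<phi> v)"
  by (simp_all add: Vector_Spaces.linear_iff)

lemma plinI: "(\<And>u v. \<phi> (u + v) = \<phi> u + \<phi> v) \<Longrightarrow> (\<And>c v. \<phi> (sm c v) = sm c (\<phi> v)) \<Longrightarrow> plin \<phi>"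
  using vs.vector_space_axioms by (simp add: Vector_Spaces.linear_iff)

lemma plin_zero: "plin \<phi> \<Longrightarrow> \<phi> 0 = 0"
  using plin_scale[of \<phi> 0 0] by simp

lemma plin_minus: "plin \<phi> \<Longrightarrow> \<phi> (- v) = - \<phi> v"
  using plin_scale[of \<phi> "-1" v] by simp

lemma plin_diff: "plin \<phi> \<Longrightarrow> \<phi> (u - v) = \<phi> u - \<phi> v"
  using plin_add[of \<phi> u "- v"] by (simp add: plin_minus)

lemma plin_sum: "plin \<phi> \<Longrightarrow> \<phi> (sum f S) = (\<Sum>x\<in>S. \<phi> (f x))"
  by (induction S rule: infinite_finite_induct) (auto simp: plin_zero plin_add)

lemma plin_comp: "plin \<phi> \<Longrightarrow> plin \<psi> \<Longrightarrow> plin (\<lambda>v. \<phi> (\<psi> v))"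
  by (rule plinI) (auto simp: plin_add plin_scale)

lemma plin_M [simp]: "plin (M f)" and plin_D [simp]: "plin (D j)" and plin_sigma [simp]: "plin \<sigma>"
  unfolding M_def D_def
  by (rule act_linear[OF weyl_amult], rule act_linear[OF weyl_d_var], rule plinI[OF gr.par_add gr.par_scale])

lemmas M_lin = plin_add[OF plin_M] plin_scale[OF plin_M] plin_diff[OF plin_M] plin_minus[OF plin_M] plin_zero[OF plin_M] plin_sum[OF plin_M]
lemmas D_lin = plin_add[OF plin_D] plin_scale[OF plin_D] plin_diff[OF plin_D] plin_minus[OF plin_D] plin_zero[OF plin_D] plin_sum[OF plin_D]
lemmas \<sigma>_lin = plin_add[OF plin_sigma] plin_scale[OF plin_sigma] plin_diff[OF plin_sigma] plin_minus[OF plin_sigma] plin_zero[OF plin_sigma] plin_sum[OF plin_sigma]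

lemma M_add_left: "M (f + g) v = M f v + M g v"
proof -
  have "amult (f + g) = amult f + amult g" by (auto simp: amult_add_left)
  then show ?thesis unfolding M_def using act_plus weyl_amult by metis
qed

lemma M_scale_left: "M (cscale c f) v = sm c (M f v)"
proof -
  have "amult (cscale c f) = (\<lambda>g. cscale c (amult f g))" by (auto simp: amult_scale_left)
  then show ?thesis unfolding M_def using act_scale weyl_amult by metis
qed

lemma M_zero_left [simp]: "M 0 v = 0"
  using M_scale_left[of 0 0 v] by simp

lemma M_minus_left: "M (- f) v = - M f v"
  using M_scale_left[of "-1" f v] by simp

lemma M_diff_left: "M (f - g) v = M f v - M g v"
  using M_add_left[of f "- g" v] by (simp add: M_minus_left)

lemma M_M: "M f (M g v) = M (amult f g) v"
proof -
  have "amult (amult f g) = amult f \<circ> amult g" by (auto simp: amult_assoc)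
  then show ?thesis unfolding M_def using act_comp weyl_amult by metis
qed

lemma M_one [simp]: "M (mon 0 {}) v = v"
proof -
  have "amult (mon 0 {}) = (id :: 'n oper)" by auto
  then show ?thesis unfolding M_def using act_id by metis
qed

lemma act_vf: "act P (vf g j) v = M g (D j v)"
proof -
  have "vf g j = amult g \<circ> d_var j" by (auto simp: vf_def)
  then show ?thesis unfolding M_def D_def using act_comp weyl_amult weyl_d_var by metis
qed

lemma act_zero: "act P 0 v = 0"
proof -
  have "(0 :: 'n oper) = (\<lambda>f. cscale 0 (id f))" by auto
  then show ?thesis using act_scale[OF weyl.intros(6), of 0] by (metis vs.scale_zero_left)
qed

lemma act_sum: "(\<And>a. a \<in> S \<Longrightarrow> x a \<in> weyl) \<Longrightarrow> act P (sum x S) v = (\<Sum>a\<in>S. act P (x a) v)"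
proof (induction S rule: infinite_finite_induct)
  case (insert a S)
  have "act P (x a + sum x S) v = act P (x a) v + act P (sum x S) v"
    by (rule act_plus) (use insert in \<open>auto intro: weyl_sum\<close>)
  moreover have "sum x (insert a S) = x a + sum x S" by (rule sum.insert[OF insert(1,2)])
  moreover have "act P (sum x S) v = (\<Sum>a\<in>S. act P (x a) v)" using insert by simp
  ultimately show ?case using insert(1,2) by (metis (no_types) sum.insert)
qed (use act_zero in \<open>metis sum.infinite sum.empty\<close>)+

lemma D_M: "D j (M f v) = M (d_var j f) v + M (lsig j f) (D j v)"
proof -
  have "d_var j \<circ> amult f = amult (d_var j f) + vf (lsig j f) j"
    by (auto simp: vf_def d_var_amult)
  then have "act P (d_var j \<circ> amult f) v = act P (amult (d_var j f) + vf (lsig j f) j) v" by simp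
  then show ?thesis
    by (simp only: act_comp act_plus weyl_d_var weyl_amult weyl_vf act_vf flip: M_def D_def)
qed

lemma D_D: "D j (D l v) = sm (ksign (pd j * pd l)) (D l (D j v))"
proof -
  have "d_var j (d_var l h) = cscale (ksign (pd j * pd l)) (d_var l (d_var j h))" for h :: "'n lau"
    by (cases j; cases l) (simp_all add: d_t_d_xi, rule d_xi_d_xi)
  then have "d_var j \<circ> d_var l = (\<lambda>h. cscale (ksign (pd j * pd l)) ((d_var l \<circ> d_var j) h :: 'n lau))" by auto
  then have "act P (d_var j \<circ> d_var l) v = act P (\<lambda>h. cscale (ksign (pd j * pd l)) ((d_var l \<circ> d_var j) h)) v" by simp
  then show ?thesis
    by (simp only: act_comp act_scale weyl_d_var weyl.intros(9) flip: D_def)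
qed

lemma D_D_simps:
  "D None (D (Some i) v) = D (Some i) (D None v)"
  "D (Some i) (D (Some j) v) = - D (Some j) (D (Some i) v)"
  using D_D[of None "Some i"] D_D[of "Some i" "Some j"] by simp_all

lemma D_sq [simp]: "D (Some i) (D (Some i) v) = 0"
proof -
  have "sm 2 (D (Some i) (D (Some i) v)) = 0"
    using D_D_simps(2)[of i i v] vs.scale_left_distrib[of 1 1 "D (Some i) (D (Some i) v)"] by (simp add: eq_neg_iff_add_eq_0)
  then show ?thesis by simp
qed

lemma act_sigma: "x \<in> homog weyl p \<Longrightarrow> \<sigma> (act P x v) = sm (ksign p) (act P x (\<sigma> v))"
proof -
  assume x: "x \<in> homog weyl p"
  then have l: "plin (act P x)" by (intro act_linear) auto
  obtain v0 v1 where v: "v0 \<in> part P 0" "v1 \<in> part P 1" "v = v0 + v1" by (rule part_decomp)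
  have "\<sigma> (act P x v0) = sm (ksign p) (act P x v0)" "\<sigma> (act P x v1) = sm (- ksign p) (act P x v1)"
    using act_part[OF x v(1)] act_part[OF x v(2)] by (simp_all add: gr.prt_iff ksign_add)
  moreover have "\<sigma> v = v0 - v1" using v by (simp add: twist_add_parts)
  ultimately show ?thesis
    by (simp add: v(3) plin_add[OF l] plin_diff[OF l] \<sigma>_lin vs.scale_right_diff_distrib)
qed

lemma \<sigma>_M: "\<sigma> (M f v) = M (lau_sigma f) (\<sigma> v)"
proof (induction f rule: pm_induct)
  case zero
  then show ?case by (simp add: \<sigma>_lin clin_zero[OF clin_sigma])
next
  case (single b c)
  obtain k J where b: "b = (k, J)" by (cases b)
  have e: "Poly_Mapping.single b c = cscale c (mon k J)" by (simp add: b mon_def)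
  have "amult (mon k J) \<in> oper_part (of_nat (card J))"
    using mon_lau_part[of k J] by (auto simp: oper_part_def intro: amult_lau_part)
  then have "\<sigma> (M (mon k J) v) = sm ((- 1) ^ card J) (M (mon k J) (\<sigma> v))"
    unfolding M_def using act_sigma[of "amult (mon k J)" "of_nat (card J)"] weyl_amult[of "mon k J"] by (simp add: ksign_of_nat)
  then show ?case
    by (simp add: e M_scale_left \<sigma>_lin clin_scale[OF clin_sigma] lau_sigma_mon)
next
  case (add f g)
  then show ?case by (simp add: M_add_left \<sigma>_lin clin_add[OF clin_sigma])
qed

lemma \<sigma>_D: "\<sigma> (D j v) = sm (ksign (pd j)) (D j (\<sigma> v))"
proof -
  have "d_var j \<in> oper_part (pd j)"
    by (subst oper_part_iff) (simp_all add: sigma_d_var)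
  then show ?thesis unfolding D_def using weyl_d_var by (intro act_sigma) auto
qed

lemma \<sigma>_D_simps: "\<sigma> (D None v) = D None (\<sigma> v)" "\<sigma> (D (Some i) v) = - D (Some i) (\<sigma> v)"
  by (simp_all add: \<sigma>_D)

text \<open>Reduces stability under the Weyl superalgebra to multiplications and derivatives, by
  induction over its generation.\<close>

lemma weyl_closed:
  assumes N: "vs.subspace N" and M: "\<And>f v. v \<in> N \<Longrightarrow> M f v \<in> N" and D: "\<And>j v. v \<in> N \<Longrightarrow> D j v \<in> N"
    and x: "x \<in> weyl" and v: "v \<in> N"
  shows "act P x v \<in> N"
  using x v
proof (induction x arbitrary: v rule: weyl.induct)
  case (4)
  then show ?case using D[of v None] by (simp add: D_def)
next
  case (5 i)
  then show ?case using D[of v "Some i"] by (simp add: D_def)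
next
  case 6
  then show ?case by (simp only: act_id)
next
  case (7 x c)
  then show ?case using N by (simp only: act_scale vs.subspace_scale)
next
  case (8 x y)
  then have "act P x v + act P y v \<in> N" using N by (simp add: vs.subspace_add)
  then show ?case using 8 act_plus by metis
next
  case (9 x y)
  then have "act P x (act P y v) \<in> N" by simp
  then show ?case using 9 act_comp by metis
qed (use M in \<open>simp_all add: M_def\<close>)

lemma submodI:
  assumes "vs.subspace N" "\<And>v. v \<in> N \<Longrightarrow> \<sigma> v \<in> N" "\<And>x v. x \<in> G \<Longrightarrow> v \<in> N \<Longrightarrow> act P x v \<in> N"
  shows "submod G P N"
  using assms(1) assms(2,3) gr.graded_iff[OF assms(1)]
  unfolding submod_def by (auto simp: vs.subspace_def)

lemma submodD:
  assumes "submod G P N"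
  shows "vs.subspace N" "v \<in> N \<Longrightarrow> \<sigma> v \<in> N" "x \<in> G \<Longrightarrow> v \<in> N \<Longrightarrow> act P x v \<in> N"
proof -
  show N: "vs.subspace N" using assms by (auto simp: submod_def vs.subspace_def)
  show "v \<in> N \<Longrightarrow> \<sigma> v \<in> N"
    using assms gr.graded_iff[OF N] by (simp add: submod_def)
  show "x \<in> G \<Longrightarrow> v \<in> N \<Longrightarrow> act P x v \<in> N"
    using assms by (auto simp: submod_def)
qed

end

locale simple_weyl_mod = weyl_mod P for P :: "('n::{finite,linorder} oper, 'p::ab_group_add) smod" +
  assumes simple: "simple_mod weyl P"
begin

text \<open>The form in which simplicity of \<open>P\<close> is used: for auxiliary subspaces built
  from a given \<open>S'\<close>-submodule that turn out to be stable under everything.\<close>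

lemma dichotomy:
  assumes "vs.subspace N" "\<And>v. v \<in> N \<Longrightarrow> \<sigma> v \<in> N" "\<And>f v. v \<in> N \<Longrightarrow> M f v \<in> N" "\<And>j v. v \<in> N \<Longrightarrow> D j v \<in> N"
  shows "N = {0} \<or> N = UNIV"
proof -
  have "submod weyl P N"
    using assms by (intro submodI weyl_closed) auto
  then show ?thesis using simple by (simp add: simple_mod_def)
qed

lemma nonzero: "\<exists>v :: 'p. v \<noteq> 0"
  using simple by (simp add: simple_mod_def)

end


text \<open>The Leibniz rule for \<open>d_xi i\<close> applied to the product of
  \<open>lau_sigma f\<close> and xi_i. Both coefficients on the right lie in the image of
  \<open>d_xi i\<close>, hence are admissible in \<open>S'\<close>.\<close>

lemma mon_split: "f = d_xi i (amult (lau_sigma f) (mon 0 {i})) - amult (d_xi i (lau_sigma f)) (mon 0 {i})"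
  by (simp add: d_xi_amult)

text \<open>Multiplication by xi_i is a contracting homotopy for \<open>d_xi i\<close>.\<close>

lemma d_xi_lift: "d_xi i g = 0 \<Longrightarrow> g = d_xi i (amult (mon 0 {i}) g)"
  by (simp add: d_xi_amult)

lemma lsig_lsig [simp]: "lsig j (lsig j f) = f"
  by (cases j) simp_all

section \<open>\<open>\<Delta>P\<close> and the submodules of \<open>P\<close>\<close>

context weyl_mod
begin

lemma Delta_eq: "Delta P = {D None v + (\<Sum>i\<in>UNIV. D (Some i) (w i)) | v w. True}"
  by (simp add: Delta_def D_def)

lemma DeltaI: "D None v + (\<Sum>i\<in>UNIV. D (Some i) (w i)) \<in> Delta P"
  unfolding Delta_eq by blast

lemma DeltaE:
  assumes "x \<in> Delta P"
  obtains v w where "x = D None v + (\<Sum>i\<in>UNIV. D (Some i) (w i))"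
  using assms unfolding Delta_eq by blast

lemma D_in_Delta: "D j v \<in> Delta P"
proof (cases j)
  case None
  then show ?thesis using DeltaI[of v "\<lambda>_. 0"] by (simp add: D_lin)
next
  case (Some i)
  have "(\<Sum>s\<in>UNIV. D (Some s) (if s = i then v else 0)) = (\<Sum>s\<in>UNIV. if s = i then D j v else 0)"
    by (rule sum.cong) (simp_all add: Some D_lin)
  then show ?thesis using DeltaI[of 0 "\<lambda>s. if s = i then v else 0"] by (simp add: D_lin)
qed

lemma subspace_Delta: "vs.subspace (Delta P)"
proof (rule vs.subspaceI)
  show "0 \<in> Delta P" using D_in_Delta[of None 0] by (simp add: D_lin)
next
  fix x y assume "x \<in> Delta P" "y \<in> Delta P"
  then obtain v w v' w' where "x = D None v + (\<Sum>i\<in>UNIV. D (Some i) (w i))" "y = D None v' + (\<Sum>i\<in>UNIV. D (Some i) (w' i))"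
    by (elim DeltaE)
  then have "x + y = D None (v + v') + (\<Sum>i\<in>UNIV. D (Some i) (w i + w' i))"
    by (simp add: D_lin sum.distrib algebra_simps)
  then show "x + y \<in> Delta P" by (simp only: DeltaI)
next
  fix c x assume "x \<in> Delta P"
  then obtain v w where "x = D None v + (\<Sum>i\<in>UNIV. D (Some i) (w i))" by (elim DeltaE)
  then have "sm c x = D None (sm c v) + (\<Sum>i\<in>UNIV. D (Some i) (sm c (w i)))"
    by (simp add: D_lin vs.scale_right_distrib vs.scale_sum_right)
  then show "sm c x \<in> Delta P" by (simp only: DeltaI)
qed

lemma Delta_least:
  assumes "vs.subspace X" "\<And>j v. D j v \<in> X"
  shows "Delta P \<subseteq> X"
  using assms by (auto simp: Delta_eq intro!: vs.subspace_add vs.subspace_sum)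

lemma \<sigma>_Delta:
  assumes "v \<in> Delta P"
  shows "\<sigma> v \<in> Delta P"
proof -
  obtain u w where "v = D None u + (\<Sum>i\<in>UNIV. D (Some i) (w i))" using assms by (elim DeltaE)
  then have "\<sigma> v = D None (\<sigma> u) + (\<Sum>i\<in>UNIV. D (Some i) (- \<sigma> (w i)))"
    by (simp add: \<sigma>_lin \<sigma>_D_simps D_lin)
  then show ?thesis by (simp only: DeltaI)
qed

text \<open>\<open>S_alg_right\<close> writes x as a sum of operators that end, on the left, with a
  derivative, and this factorisation carries over from \<open>A\<close> to every Weyl
  module.\<close>

lemma S_alg_act:
  assumes "x \<in> S_alg"
  shows "act P x v \<in> Delta P"
proof -
  define g where "g j = lsig j (coef x j)" for j
  have "x h = (\<Sum>j\<in>UNIV. (d_var j \<circ> amult (g j)) h)" for h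
    using S_alg_right[OF assms, of h] by (simp add: UNIV_option_conv sum.reindex g_def)
  then have "x = (\<Sum>j\<in>UNIV. d_var j \<circ> amult (g j))"
    by (auto simp: sum_fun_apply)
  then have "act P x v = (\<Sum>j\<in>UNIV. act P (d_var j \<circ> amult (g j)) v)"
    using act_sum[of UNIV "\<lambda>j. d_var j \<circ> amult (g j)" v] weyl.intros(9)[OF weyl_d_var weyl_amult] by metis
  also have "\<dots> = (\<Sum>j\<in>UNIV. D j (M (g j) v))"
    by (simp only: act_comp weyl_d_var weyl_amult flip: M_def D_def)
  finally show ?thesis by (simp add: vs.subspace_sum subspace_Delta D_in_Delta)
qed

text \<open>A bracket acts as a combination of the products x y and y x, and the left factor of each
  already maps into \<open>Delta P\<close>. No stability of \<open>Delta P\<close> is presupposed,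
  and it follows as a special case.\<close>

lemma S'_alg_act:
  assumes "x \<in> S'_alg"
  shows "act P x v \<in> Delta P"
  using assms
proof (induction x rule: S'_alg_induct)
  case (bracket c p q x y)
  have S: "x \<in> S_alg" "y \<in> S_alg" using bracket by auto
  then have W: "x \<in> weyl" "y \<in> weyl" by (auto simp: S_alg_def intro: W_alg_weyl)
  have "sbracket p q x y = (x \<circ> y) + (\<lambda>f. cscale (- ksign (p * q)) ((y \<circ> x) f))"
    by (auto simp: sbracket_def)
  then have "act P (\<lambda>f. cscale c (sbracket p q x y f)) v
    = sm c (act P ((x \<circ> y) + (\<lambda>f. cscale (- ksign (p * q)) ((y \<circ> x) f))) v)"
    using W by (metis act_scale weyl.intros(7,8,9))
  also have "\<dots> = sm c (act P x (act P y v) + sm (- ksign (p * q)) (act P y (act P x v)))"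
    using W by (simp only: act_plus act_scale act_comp weyl.intros)
  finally show ?case
    using S S_alg_act subspace_Delta by (simp only: vs.subspace_add vs.subspace_scale)
next
  case zero
  show ?case using act_zero vs.subspace_0[OF subspace_Delta] by metis
next
  case (add x y)
  have "act P x v + act P y v \<in> Delta P" using add subspace_Delta by (simp add: vs.subspace_add)
  then show ?case using add S'_alg_weyl act_plus by metis
qed

lemma Delta_submod: "submod S'_alg P (Delta P)"
  by (rule submodI[OF subspace_Delta]) (simp_all add: \<sigma>_Delta S'_alg_act)

lemma S'_closed:
  assumes n: "CARD('n) \<ge> 2" and X: "submod S'_alg P X" and v: "v \<in> X"
  shows "D j v \<in> X" "M (d_xi i G) (D (Some i) v) \<in> X" "M (mon 0 {i}) (D None v) \<in> X"
    "d_xi i g = 0 \<Longrightarrow> M g (D (Some i) v) \<in> X"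
proof -
  note cl = submodD(3)[OF X _ v]
  show "D j v \<in> X"
    using cl[OF S'_d_t[OF n]] cl[OF S'_d_xi[OF n]] by (cases j) (simp_all add: D_def)
  show 2: "M (d_xi i G) (D (Some i) v) \<in> X" for G
    using cl[OF S'_vf_xi[OF n]] by (simp add: act_vf)
  show "M (mon 0 {i}) (D None v) \<in> X"
    using cl[OF S'_vf_t[OF n]] by (simp add: act_vf)
  show "d_xi i g = 0 \<Longrightarrow> M g (D (Some i) v) \<in> X"
    using 2[of "amult (mon 0 {i}) g"] d_xi_lift[of i g] by simp
qed

lemma D_xi_M_xi: "D (Some i) (M (mon 0 {i}) v) + M (mon 0 {i}) (D (Some i) v) = v"
  by (simp add: D_M lau_sigma_mon M_minus_left)

text \<open>The canonical (anti)commutation relation expresses the identity through D_j and its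
  variable; if D_j vanished identically, so would the identity of \<open>P\<close>.\<close>

lemma all_D_zero:
  fixes v :: 'p
  assumes "\<And>v. D j v = 0"
  shows "v = 0"
proof (cases j)
  case None
  have "D None (M (mon 1 {}) v) = v + M (mon 1 {}) (D None v)" by (simp add: D_M)
  then show ?thesis using assms by (simp add: None M_lin)
next
  case (Some i)
  then show ?thesis using D_xi_M_xi[of i v] assms by (simp add: M_lin)
qed

end

context simple_weyl_mod
begin

text \<open>One vector with one nonzero derivative suffices: it first gives D_i P \<subseteq> X for
  all odd directions, and these vectors then serve as input for the even direction.\<close>

lemma submodule_contains_Delta:
  assumes n: "CARD('n) \<ge> 2" and X: "submod S'_alg P X" and v: "v \<in> X" "D l v \<noteq> 0"
  shows "Delta P \<subseteq> X"
proof -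
  note sub = submodD(1)[OF X]
  note cl = S'_closed[OF n X]
  define Y where "Y j = {q. \<forall>f. D j (M f q) \<in> X}" for j
  have Y: "Y j = {0} \<or> Y j = UNIV" for j
  proof (rule dichotomy)
    show "vs.subspace (Y j)"
      using sub by (auto simp: vs.subspace_def Y_def M_lin D_lin)
  next
    fix q assume q: "q \<in> Y j"
    have "D j (M f (\<sigma> q)) = sm (ksign (pd j)) (\<sigma> (D j (M (lau_sigma f) q)))" for f
      by (simp add: \<sigma>_M \<sigma>_D)
    then show "\<sigma> q \<in> Y j"
      using q submodD(2)[OF X] sub by (simp add: Y_def vs.subspace_scale)
  next
    fix f q assume "q \<in> Y j"
    then show "M f q \<in> Y j" by (simp add: Y_def M_M)
  next
    fix k q assume q: "q \<in> Y j"
    have "M f (D k q) = D k (M (lsig k f) q) - M (d_var k (lsig k f)) q" for f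
      by (simp add: D_M)
    then have "D j (M f (D k q)) = sm (ksign (pd j * pd k)) (D k (D j (M (lsig k f) q))) - D j (M (d_var k (lsig k f)) q)" for f
      by (simp add: D_lin D_D[of j k])
    then show "D k q \<in> Y j"
      using q sub cl(1) by (simp add: Y_def vs.subspace_diff vs.subspace_scale)
  qed
  have nz: "Y j = UNIV" if "q \<in> Y j" "q \<noteq> 0" for j q
    using Y[of j] that by auto
  have split: "M f q = M (d_xi i (amult (lau_sigma f) (mon 0 {i}))) q - M (d_xi i (lau_sigma f)) (M (mon 0 {i}) q)" for f q i
    using mon_split[of f i] by (metis M_diff_left M_M)
  have Dg: "D (Some i) (M (d_xi i G) q) \<in> X" if "q \<in> X" for i G q
    using cl(2)[OF that, of i "lau_sigma G"] sub by (simp add: D_M sigma_d_xi M_minus_left vs.subspace_neg)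
  have 1: "D k u \<in> Y (Some i)" if u: "u \<in> X" for u k i
  proof (cases "k = Some i")
    case True
    \<comment> \<open>Since D_i squares to zero, only the term in which D_i hits f survives, and its
      coefficient \<open>d_xi i f\<close> is admissible.\<close>
    have "D (Some i) (M f (D (Some i) u)) \<in> X" for f
      using cl(2)[OF u, of i f] by (simp add: D_M M_lin)
    then show ?thesis by (simp add: Y_def True)
  next
    case False
    \<comment> \<open>For k different from i, the coefficient xi_i is admissible for D_k. This
      provides the factor xi_i needed in the second term of the splitting of f, while
      \<open>Dg\<close> absorbs the remaining coefficients.\<close>
    have "M (mon 0 {i}) (D k u) \<in> X"
    proof (cases k)
      case None
      then show ?thesis using cl(3)[OF u] by simp
    next
      case (Some j)
      then show ?thesis using False cl(4)[OF u] by simp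
    qed
    then have "D (Some i) (M f (D k u)) \<in> X" for f
      using cl(1)[OF u] sub by (subst split[of f _ i]) (simp add: D_lin(3) vs.subspace_diff Dg)
    then show ?thesis by (simp add: Y_def)
  qed
  have "Y (Some i) = UNIV" for i
    using nz[OF 1[OF v(1)] v(2)] .
  then have DX: "D (Some i) q \<in> X" for i q
    unfolding Y_def using M_one by (metis (mono_tags, lifting) UNIV_I mem_Collect_eq)
  have 2: "D (Some i) u \<in> Y None" if u: "u \<in> X" for u i
  proof -
    \<comment> \<open>Moving xi_i to the far left leaves the field xi_i d/dt, an element of
      \<open>S'\<close>, applied to a vector g D_i u that is already known to lie in X.\<close>
    have "D None (M (d_xi i G) (M (mon 0 {i}) (D (Some i) u))) \<in> X" for G
    proof -
      have "D None (M (d_xi i G) (M (mon 0 {i}) (D (Some i) u)))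
        = - M (mon 0 {i}) (D None (M (d_xi i (lau_sigma G)) (D (Some i) u)))"
        by (simp add: M_M xi_right sigma_d_xi amult_minus_right M_minus_left D_lin)
          (simp add: D_M flip: M_M)
      then show ?thesis
        using cl(3)[OF cl(2)[OF u]] sub by (simp add: vs.subspace_neg)
    qed
    then have "D None (M f (D (Some i) u)) \<in> X" for f
      using cl(1)[OF cl(2)[OF u]] sub by (subst split[of f _ i]) (simp add: D_lin(3) vs.subspace_diff)
    then show ?thesis by (simp add: Y_def)
  qed
  \<comment> \<open>Supplies a nonzero element of \<open>Y None\<close>, namely D_i u with u = D_j
    w, where u lies in X by \<open>DX\<close>. If D_i D_j were zero, evaluating it on xi_i q would
    give D_j q = 0 for all q.\<close>
  have "\<exists>w. D (Some i) (D (Some j) w) \<noteq> 0" if "i \<noteq> j" for i j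
  proof (rule ccontr)
    assume "\<not> ?thesis"
    then have z: "D (Some i) (D (Some j) w) = 0" for w by blast
    have "D (Some j) q = 0" for q
      using z[of "M (mon 0 {i}) q"] that z[of q]
      by (simp add: D_M lau_sigma_mon M_minus_left D_lin M_lin)
    then have "v = 0" by (rule all_D_zero)
    with v show False by (simp add: D_lin)
  qed
  moreover obtain i j :: 'n where "i \<noteq> j" using ex_other[OF n] by blast
  ultimately obtain w where "D (Some i) (D (Some j) w) \<noteq> 0" by blast
  with 2[OF DX] nz have "Y None = UNIV" by blast
  then have "D None q \<in> X" for q
    unfolding Y_def using M_one by (metis (mono_tags, lifting) UNIV_I mem_Collect_eq)
  then have "D j q \<in> X" for j q
    using DX by (cases j) auto
  then show ?thesis by (rule Delta_least[OF sub])
qed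

end


section \<open>The module \<open>A\<close>\<close>

lemma A_mod_simps [simp]: "carrier A_mod = UNIV" "add A_mod = (+)" "zero A_mod = 0" "smult A_mod = cscale"
  "part A_mod = lau_part" "act A_mod x = x"
  by (simp_all add: A_mod_def)

lemma mon_nonzero [simp]: "mon k I \<noteq> 0"
  by (metis cf_mon lookup_zero zero_neq_one)

lemma lau_sigma_graded: "graded_space cscale lau_sigma (lau_part :: bit \<Rightarrow> 'n::{finite,linorder} lau set)"
  by unfold_locales (simp_all add: clin_add[OF clin_sigma] clin_scale[OF clin_sigma] lau_part_iff)

lemma A_weyl_module: "weyl_module (A_mod :: ('n::{finite,linorder} oper, 'n lau) smod)"
proof -
  interpret g: graded_space cscale lau_sigma "lau_part :: bit \<Rightarrow> 'n::{finite,linorder} lau set"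
    by (rule lau_sigma_graded)
  have "\<exists>!w. w \<in> lau_part 0 \<and> v - w \<in> lau_part 1" for v :: "'n lau"
  proof -
    obtain v0 v1 where v: "v0 \<in> lau_part 0" "v1 \<in> lau_part 1" "v = v0 + v1" by (rule g.decomp)
    show ?thesis
    proof (rule ex1I)
      show "v0 \<in> lau_part 0 \<and> v - v0 \<in> lau_part 1" using v by simp
    next
      fix w assume w: "w \<in> lau_part 0 \<and> v - w \<in> lau_part 1"
      then have "lau_sigma v = w - (v - w)"
        by (auto simp: lau_part_iff clin_diff[OF clin_sigma] algebra_simps)
      moreover have "lau_sigma v = v0 - v1" using v by (simp add: lau_part_iff clin_add[OF clin_sigma])
      ultimately have "w + w = v0 + v0" using v by (simp add: algebra_simps)
      then have "cscale 2 w = cscale 2 v0" using cscale_add_left[of 1 1 w] cscale_add_left[of 1 1 v0] by simp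
      then show "w = v0" by simp
    qed
  qed
  moreover have "cs.subspace (lau_part p :: 'n lau set)" for p :: bit
    by (auto simp: cs.subspace_def lau_part_iff clin_add[OF clin_sigma] clin_scale[OF clin_sigma] clin_zero[OF clin_sigma]
        cscale_add_right mult.commute)
  moreover have "vector_space (cscale :: complex \<Rightarrow> 'n lau \<Rightarrow> 'n lau)" by (rule cs.vector_space_axioms)
  moreover have "x v \<in> lau_part (p + q)" if "x \<in> oper_part p" "v \<in> lau_part q" for p q and x :: "'n oper" and v
    using that by (auto simp: oper_part_def)
  ultimately show ?thesis
    unfolding weyl_module_def by (simp add: weyl_clin)
qed

interpretation A: weyl_mod A_mod
  by unfold_locales (rule A_weyl_module)

lemma A_D [simp]: "A.D j g = d_var j g"
  by (simp add: A.D_def)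

lemma A_sigma [simp]: "twist A_mod 1 f = lau_sigma (f :: 'n::{finite,linorder} lau)"
proof -
  interpret g: graded_space cscale lau_sigma "lau_part :: bit \<Rightarrow> 'n::{finite,linorder} lau set"
    by (rule lau_sigma_graded)
  obtain v0 v1 where v: "v0 \<in> lau_part 0" "v1 \<in> lau_part 1" "f = v0 + v1" by (rule g.decomp)
  then show ?thesis
    using A.twist_add_parts[of v0 v1 1] by (simp add: lau_part_iff clin_add[OF clin_sigma])
qed

text \<open>The operators t d/dt and xi_i d/dxi_i are diagonal on monomials, and their joint
  eigenvalues separate the monomials.\<close>

lemma cf_euler_t: "cf (amult (mon 1 {}) (d_t f)) (k, I) = of_int k * cf f (k, I)"
proof (induction f rule: pm_induct)
  case (single b c)
  have "Poly_Mapping.single b c = cscale c (mon (fst b) (snd b))" by (simp add: mon_def)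
  then show ?case by (auto simp: clin_scale[OF clin_d_t] amult_scale_right d_t_mon amult_mon cf_mon)
qed (auto simp: clin_zero[OF clin_d_t] clin_add[OF clin_d_t] amult_add_right lookup_add ring_distribs)

lemma cf_euler_xi: "cf (amult (mon 0 {i}) (d_xi i f)) (k, I) = (if i \<in> I then cf f (k, I) else 0)"
proof (induction f rule: pm_induct)
  case (single b c)
  have "Poly_Mapping.single b c = cscale c (mon (fst b) (snd b))" by (simp add: mon_def)
  then show ?case by (auto simp: clin_scale[OF clin_d_xi] amult_scale_right d_xi_mon amult_mon cf_mon insert_absorb)
qed (auto simp: clin_zero[OF clin_d_xi] clin_add[OF clin_d_xi] amult_add_right lookup_add ring_distribs)

text \<open>A nonzero element of N with the smallest support must be a multiple of one monomial,
  because the Euler operators could otherwise shorten it. Multiplying by a power of t and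
  differentiating away the xi factors then yields 1.\<close>

lemma A_ideal:
  fixes N :: "'n::{finite,linorder} lau set"
  assumes N: "cs.subspace N" and M: "\<And>f g. g \<in> N \<Longrightarrow> amult f g \<in> N" and D: "\<And>j g. g \<in> N \<Longrightarrow> d_var j g \<in> N"
    and nz: "g \<in> N" "g \<noteq> 0"
  shows "N = UNIV"
proof -
  obtain f where f: "f \<in> N" "f \<noteq> 0" and min: "\<And>h. h \<in> N \<Longrightarrow> h \<noteq> 0 \<Longrightarrow> card (supp f) \<le> card (supp h)"
    using ex_has_least_nat[of "\<lambda>h. h \<in> N \<and> h \<noteq> 0" g "\<lambda>h. card (supp h)"] nz by auto
  obtain k I where kI: "cf f (k, I) \<noteq> 0"
    using f(2) by (metis poly_mapping_eqI lookup_zero surj_pair)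
  \<comment> \<open>For an operator acting with diagonal weights w, subtracting the multiple w (k,
    I) of f removes (k, I) from the support; by minimality the difference is zero, so w is constant
    on the support.\<close>
  have diag: "w b = w (k, I)" if b: "b \<in> supp f" and h: "h \<in> N" "\<And>b. cf h b = w b * cf f b" for b h w
  proof (rule ccontr)
    assume ne: "w b \<noteq> w (k, I)"
    let ?h = "h - cscale (w (k, I)) f"
    have cf: "cf ?h b = (w b - w (k, I)) * cf f b" for b by (simp add: lookup_minus h(2) algebra_simps)
    have "?h \<in> N" using N h f by (simp add: cs.subspace_diff cs.subspace_scale)
    moreover have "cf ?h b \<noteq> 0" using ne b by (simp add: cf in_keys_iff)
    then have "?h \<noteq> 0" by auto
    moreover have "supp ?h \<subseteq> supp f - {(k, I)}"
    proof
      fix b assume "b \<in> supp ?h"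
      then have "cf ?h b \<noteq> 0" by (simp add: in_keys_iff)
      then show "b \<in> supp f - {(k, I)}" by (auto simp: cf in_keys_iff)
    qed
    then have "card (supp ?h) < card (supp f)"
      using kI by (intro psubset_card_mono) (auto simp: in_keys_iff)
    ultimately show False using min[of ?h] by simp
  qed
  have "b = (k, I)" if b: "b \<in> supp f" for b
  proof -
    obtain l J where lJ: "b = (l, J)" by (cases b)
    have "of_int l = (of_int k :: complex)"
      using diag[OF b M[OF D[OF f(1), of None], of "mon 1 {}"], of "\<lambda>(k, I). of_int k"]
      by (auto simp: cf_euler_t lJ)
    moreover have "(\<lambda>(k, I). of_bool (i \<in> I) :: complex) b = (\<lambda>(k, I). of_bool (i \<in> I)) (k, I)" for i
      by (rule diag[OF b M[OF D[OF f(1), of "Some i"], of "mon 0 {i}"]]) (auto simp: cf_euler_xi)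
    then have "i \<in> J \<longleftrightarrow> i \<in> I" for i
      by (simp add: lJ of_bool_eq_iff)
    ultimately show ?thesis by (auto simp: lJ)
  qed
  then have "f = cscale (cf f (k, I)) (mon k I)"
    by (intro poly_mapping_eqI) (metis cf_mon in_keys_iff lookup_cscale mult.right_neutral mult_zero_right)
  then have "mon k I = cscale (1 / cf f (k, I)) f"
    using kI by (metis cscale_cscale cscale_one nonzero_eq_divide_eq times_divide_eq_left mult_1)
  then have "mon k I \<in> N" using f(1) N by (simp add: cs.subspace_scale)
  from M[OF this, of "mon (- k) {}"] have "mon 0 I \<in> N" by (simp add: amult_mon)
  then have one: "mon 0 {} \<in> N"
  proof (induction I rule: finite_induct[OF finite])
    case (2 i I)
    have "d_xi i (mon 0 (insert i I)) \<in> N" using D[OF 2(4), of "Some i"] by simp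
    then have "cscale (sg {i} I) (d_xi i (mon 0 (insert i I))) \<in> N" using N by (simp only: cs.subspace_scale)
    then have "mon 0 I \<in> N" using 2(2) by (simp add: d_xi_mon)
    then show ?case by (rule 2(3))
  qed simp
  show ?thesis using M[OF one] by auto
qed

lemma A_simple: "simple_mod weyl (A_mod :: ('n::{finite,linorder} oper, 'n lau) smod)"
  unfolding simple_mod_def
proof (intro conjI allI impI)
  show "\<exists>v\<in>carrier A_mod. v \<noteq> zero (A_mod :: ('n oper, 'n lau) smod)"
    by (intro bexI[of _ "mon 0 {}"]) simp_all
next
  fix N :: "'n lau set" assume N: "submod weyl A_mod N"
  show "N = {zero A_mod} \<or> N = carrier A_mod"
  proof (cases "\<exists>g\<in>N. g \<noteq> 0")
    case True
    then obtain g where g: "g \<in> N" "g \<noteq> 0" by blast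
    have "N = UNIV"
      using A.submodD(1)[OF N] A.submodD(3)[OF N weyl_amult] A.submodD(3)[OF N weyl_d_var]
      by (intro A_ideal[OF _ _ _ g]) simp_all
    then show ?thesis by simp
  next
    case False
    moreover have "0 \<in> N" using A.submodD(1)[OF N] by (simp add: cs.subspace_0)
    ultimately have "N = {0}" by auto
    then show ?thesis by simp
  qed
qed

interpretation A: simple_weyl_mod A_mod
  by unfold_locales (rule A_simple)

text \<open>The Euler operators give k times the coefficient = 0, and coefficient = 0 as soon as I
  is nonempty, so only (0, {}) survives.\<close>

lemma constants_iff:
  fixes f :: "'n::{finite,linorder} lau"
  shows "f \<in> constants \<longleftrightarrow> (\<forall>j. d_var j f = 0)"
proof
  assume "f \<in> constants"
  then obtain c where "f = cscale c (mon 0 {})" by (auto simp: constants_def)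
  moreover have "d_var j (cscale c (mon 0 {})) = 0" for j :: "'n option" by (cases j) (simp_all only: clin_scale[OF clin_d_var], simp_all)
  ultimately show "\<forall>j. d_var j f = 0" by simp
next
  assume z: "\<forall>j. d_var j f = 0"
  have "cf f (k, I) = cf (cscale (cf f (0, {})) (mon 0 {})) (k, I)" for k I
  proof -
    have "of_int k * cf f (k, I) = 0"
      using z[rule_format, of None] cf_euler_t[of f k I] by simp
    moreover have "cf f (k, I) = 0" if "i \<in> I" for i
      using z[rule_format, of "Some i"] cf_euler_xi[of i f k I] that by simp
    ultimately show ?thesis by (cases "I = {}") (auto simp: cf_mon)
  qed
  then have "f = cscale (cf f (0, {})) (mon 0 {})"
    by (intro poly_mapping_eqI) (metis surj_pair)
  then show "f \<in> constants" unfolding constants_def by blast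
qed


section \<open>The tensor product as a space of \<open>P\<close>-valued forms\<close>

context weyl_mod
begin

text \<open>\<open>H \<phi>\<close> is \<phi> \<otimes> id and, below, \<open>B b\<close> is id
  \<otimes> b, both without Koszul sign. The two kinds of operators commute, and every sign is
  carried explicitly by \<open>H \<sigma>\<close>.\<close>

definition H :: "('p \<Rightarrow> 'p) \<Rightarrow> ('b \<Rightarrow>\<^sub>0 'p) \<Rightarrow> ('b \<Rightarrow>\<^sub>0 'p)" where
  "H \<phi> = Poly_Mapping.map \<phi>"

definition B :: "(('b \<Rightarrow>\<^sub>0 complex) \<Rightarrow> ('c \<Rightarrow>\<^sub>0 complex)) \<Rightarrow> ('b \<Rightarrow>\<^sub>0 'p) \<Rightarrow> ('c \<Rightarrow>\<^sub>0 'p)" where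
  "B b u = (\<Sum>m\<in>supp u. tens P (cf u m) (b (Poly_Mapping.single m 1)))"

lemma cf_tens [simp]: "cf (tens P v f) m = sm (cf f m) v"
  by (simp add: tens_def lookup_map0)

lemma cf_tscale [simp]: "cf (tscale P c u) m = sm c (cf u m)"
  by (simp add: tscale_def lookup_map0)

lemma cf_H: "plin \<phi> \<Longrightarrow> cf (H \<phi> u) m = \<phi> (cf u m)"
  by (simp add: H_def lookup_map0 plin_zero)

sublocale ts: vector_space "tscale P"
  by unfold_locales
    (simp_all add: poly_mapping_eq_iff fun_eq_iff lookup_add vs.scale_right_distrib vs.scale_left_distrib)

lemma tens_add: "tens P (u + v) f = tens P u f + tens P v f" "tens P v (f + g) = tens P v f + tens P v g"
  by (simp_all add: poly_mapping_eq_iff fun_eq_iff lookup_add vs.scale_right_distrib vs.scale_left_distrib)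

lemma tens_zero [simp]: "tens P 0 f = 0" "tens P v 0 = 0"
  by (simp_all add: poly_mapping_eq_iff fun_eq_iff)

lemma tens_scale: "tens P v (cscale c f) = tens P (sm c v) f"
  by (simp add: poly_mapping_eq_iff fun_eq_iff mult.commute)

lemma tens_single [simp]: "tens P v (Poly_Mapping.single m c) = Poly_Mapping.single m (sm c v)"
  by (rule poly_mapping_eqI) (simp add: lookup_single when_def)

lemma tscale_single [simp]: "tscale P c (Poly_Mapping.single m v) = Poly_Mapping.single m (sm c v)"
  by (rule poly_mapping_eqI) (simp add: lookup_single when_def)

lemma H_single [simp]: "plin \<phi> \<Longrightarrow> H \<phi> (Poly_Mapping.single m v) = Poly_Mapping.single m (\<phi> v)"
  by (rule poly_mapping_eqI) (simp add: cf_H lookup_single when_def plin_zero)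

lemma H_tens: "plin \<phi> \<Longrightarrow> H \<phi> (tens P v f) = tens P (\<phi> v) f"
  by (rule poly_mapping_eqI) (simp add: cf_H plin_scale)

lemma B_superset:
  assumes "finite S" "supp u \<subseteq> S"
  shows "B b u = (\<Sum>m\<in>S. tens P (cf u m) (b (Poly_Mapping.single m 1)))"
  unfolding B_def using assms by (intro sum.mono_neutral_left) (auto simp: in_keys_iff)

lemma B_add: "B b (u + v) = B b u + B b v"
proof -
  let ?S = "supp u \<union> supp v"
  have "B b (u + v) = (\<Sum>m\<in>?S. tens P (cf (u + v) m) (b (Poly_Mapping.single m 1)))"
    by (rule B_superset) (auto simp: in_keys_iff lookup_add)
  also have "\<dots> = B b u + B b v"
    by (simp add: lookup_add tens_add sum.distrib B_superset[of ?S])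
  finally show ?thesis .
qed

lemma B_single [simp]: "B b (Poly_Mapping.single m v) = tens P v (b (Poly_Mapping.single m 1))"
  by (subst B_superset[of "{m}"]) auto

lemma B_zero [simp]: "B b 0 = 0"
  by (simp add: B_def)

lemma B_minus: "B b (- u) = - B b u"
  using B_add[of b u "- u"] by (simp add: eq_neg_iff_add_eq_0 add.commute)

lemma B_diff: "B b (u - v) = B b u - B b v"
  using B_add[of b u "- v"] by (simp add: B_minus)

lemma B_sum: "B b (sum f S) = (\<Sum>x\<in>S. B b (f x))"
  by (induction S rule: infinite_finite_induct) (auto simp: B_add)

lemma B_scale: "B b (tscale P c u) = tscale P c (B b u)"
proof (induction u rule: pm_induct)
  case (single m v)
  show ?case by (rule poly_mapping_eqI) (simp add: mult.commute)
qed (simp_all add: B_add ts.scale_right_distrib)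

lemmas B_lin = B_add B_scale B_diff B_minus B_zero B_sum

lemma B_tens: "clin b \<Longrightarrow> B b (tens P v f) = tens P v (b f)"
proof (induction f rule: pm_induct)
  case (single m c)
  have "b (Poly_Mapping.single m c) = cscale c (b (Poly_Mapping.single m 1))"
    using clin_scale[OF single, of c "Poly_Mapping.single m 1"] by simp
  then show ?case by (simp add: tens_scale)
qed (simp_all add: clin_zero clin_add tens_add B_add)

lemma B_B: "clin b \<Longrightarrow> B b (B b' u) = B (\<lambda>f. b (b' f)) u"
  by (induction u rule: pm_induct) (simp_all add: B_add B_tens)

lemma B_fun_add: "B (\<lambda>f. b f + b' f) u = B b u + B b' u"
  by (induction u rule: pm_induct) (simp_all add: B_add tens_add)

lemma B_fun_zero: "B (\<lambda>f. 0) u = 0"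
  by (induction u rule: pm_induct) (simp_all add: B_add)

lemma B_fun_scale: "B (\<lambda>f. cscale c (b f)) u = tscale P c (B b u)"
  by (rule trans[OF _ B_scale], induction u rule: pm_induct) (simp_all add: B_add ts.scale_right_distrib tens_scale)

lemma B_fun_minus: "B (\<lambda>f. - b f) u = - B b u"
  using B_fun_scale[of "-1" b u] by simp

lemma B_id: "B (\<lambda>f. f) u = u"
  by (induction u rule: pm_induct) (simp_all add: B_add)

lemma H_add: "plin \<phi> \<Longrightarrow> H \<phi> (u + v) = H \<phi> u + H \<phi> v"
  and H_scale: "plin \<phi> \<Longrightarrow> H \<phi> (tscale P c u) = tscale P c (H \<phi> u)"
  and H_zero: "plin \<phi> \<Longrightarrow> H \<phi> 0 = 0"
  by (simp_all add: poly_mapping_eq_iff fun_eq_iff cf_H lookup_add plin_add plin_scale plin_zero)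

lemma H_minus: "plin \<phi> \<Longrightarrow> H \<phi> (- u) = - H \<phi> u"
  using H_scale[of \<phi> "-1" u] by simp

lemma H_diff: "plin \<phi> \<Longrightarrow> H \<phi> (u - v) = H \<phi> u - H \<phi> v"
  using H_add[of \<phi> u "- v"] by (simp add: H_minus)

lemma H_sum: "plin \<phi> \<Longrightarrow> H \<phi> (sum f S) = (\<Sum>x\<in>S. H \<phi> (f x))"
  by (induction S rule: infinite_finite_induct) (auto simp: H_add H_zero)

lemma H_B: "plin \<phi> \<Longrightarrow> H \<phi> (B b u) = B b (H \<phi> u)"
  by (induction u rule: pm_induct) (simp_all add: B_add H_add H_zero H_tens)

lemma H_H: "plin \<phi> \<Longrightarrow> plin \<psi> \<Longrightarrow> H \<phi> (H \<psi> u) = H (\<lambda>v. \<phi> (\<psi> v)) u"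
  by (rule poly_mapping_eqI) (simp add: cf_H plin_comp)

text \<open>Splits the signed tensor product of operators into its two sign-free factors and the
  twist, after which only commutation rules are needed.\<close>

lemma otens_eq:
  assumes "a \<in> weyl"
  shows "otens P a q b u = B b (H (\<lambda>v. act P a (twist P q v)) u)"
proof -
  have l: "plin (\<lambda>v. act P a (twist P q v))"
    using plin_comp[OF act_linear[OF assms] plin_sigma] act_linear[OF assms] by (cases q) simp_all
  then have "supp (H (\<lambda>v. act P a (twist P q v)) u) \<subseteq> supp u"
    by (auto simp: in_keys_iff cf_H plin_zero[OF l])
  then show ?thesis
    by (subst B_superset[of "supp u"]) (simp_all add: otens_def cf_H[OF l])
qed


abbreviation "Mt f \<equiv> H (M f)"
abbreviation "Dt j \<equiv> H (D j)"
abbreviation "St \<equiv> H \<sigma>"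
text \<open>With t_s read as d xi_s and \<xi> as dt, \<open>e j\<close> is exterior multiplication
  and \<open>\<iota> j\<close> is contraction with the corresponding vector field.\<close>

abbreviation e :: "'n option \<Rightarrow> ('n pmon \<Rightarrow>\<^sub>0 'p) \<Rightarrow> ('n pmon \<Rightarrow>\<^sub>0 'p)" where "e j \<equiv> B (vmul j)"
abbreviation \<iota> :: "'n option \<Rightarrow> ('n pmon \<Rightarrow>\<^sub>0 'p) \<Rightarrow> ('n pmon \<Rightarrow>\<^sub>0 'p)" where "\<iota> j \<equiv> B (vder j)"

lemmas Mt_lin = H_add[OF plin_M] H_scale[OF plin_M] H_diff[OF plin_M] H_minus[OF plin_M] H_zero[OF plin_M] H_sum[OF plin_M]
lemmas Dt_lin = H_add[OF plin_D] H_scale[OF plin_D] H_diff[OF plin_D] H_minus[OF plin_D] H_zero[OF plin_D] H_sum[OF plin_D]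
lemmas St_lin = H_add[OF plin_sigma] H_scale[OF plin_sigma] H_diff[OF plin_sigma] H_minus[OF plin_sigma] H_zero[OF plin_sigma] H_sum[OF plin_sigma]
lemmas HB = H_B[OF plin_M] H_B[OF plin_D] H_B[OF plin_sigma]
lemmas cf_HH = cf_H[OF plin_M] cf_H[OF plin_D] cf_H[OF plin_sigma]

lemma Mt_add_left: "Mt (f + g) u = Mt f u + Mt g u"
  and Mt_scale_left: "Mt (cscale c f) u = tscale P c (Mt f u)"
  and Mt_minus_left: "Mt (- f) u = - Mt f u"
  and Mt_one: "Mt (mon 0 {}) u = u"
  and Dt_Mt: "Dt j (Mt f u) = Mt (d_var j f) u + Mt (lsig j f) (Dt j u)"
  and St_Mt: "St (Mt f u) = Mt (lau_sigma f) (St u)"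
  and St_Dt: "St (Dt j u) = tscale P (ksign (pd j)) (Dt j (St u))"
  and St_St: "St (St u) = u"
  and Dt_Dt: "Dt None (Dt (Some i) u) = Dt (Some i) (Dt None u)" "Dt (Some i) (Dt (Some k) u) = - Dt (Some k) (Dt (Some i) u)"
  by (simp_all add: poly_mapping_eq_iff fun_eq_iff cf_HH lookup_add M_add_left M_scale_left M_minus_left D_M \<sigma>_M \<sigma>_D D_D_simps(1)
      D_D_simps(2)[of i k])

lemma St_Dt_simps: "St (Dt None u) = Dt None (St u)" "St (Dt (Some i) u) = - Dt (Some i) (St u)"
  by (simp_all add: St_Dt)

end

section \<open>Commutation relations in the polynomial factor\<close>

lemma clin_vmul [simp]: "clin (vmul j)" and clin_vder [simp]: "clin (vder j)"
  unfolding vmul_def vder_def by (rule clin_lin_ext)+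

lemma vmul_single:
  "vmul None (Poly_Mapping.single (a, x) c) = (if x = 0 then Poly_Mapping.single (a, 1) c else 0)"
  "vmul (Some s) (Poly_Mapping.single (a, x) c) = Poly_Mapping.single (a(s := a s + 1), x) c"
  by (simp_all add: vmul_def)

lemma vder_single:
  "vder None (Poly_Mapping.single (a, x) c) = (if x = 1 then Poly_Mapping.single (a, 0) c else 0)"
  "vder (Some s) (Poly_Mapping.single (a, x) c) = Poly_Mapping.single (a(s := a s - 1), x) (c * of_nat (a s))"
  by (simp_all add: vder_def)

lemma clin_pol_eqI:
  fixes \<phi> \<psi> :: "'n pol \<Rightarrow> ('c \<Rightarrow>\<^sub>0 complex)"
  assumes "clin \<phi>" "clin \<psi>"
    "\<And>a x. \<phi> (Poly_Mapping.single (a, x) 1) = \<psi> (Poly_Mapping.single (a, x) 1)"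
  shows "\<phi> u = \<psi> u"
  using assms(1,2) by (rule clin_eqI) (use assms(3) in auto)

lemmas clin_intros = clin_comp[OF clin_vmul] clin_comp[OF clin_vder] clin_id clin_plus clin_minusf clin_uminus clin_0 clin_cscale

lemma vder_vmul:
  "vder (Some i) (vmul (Some s) f) = vmul (Some s) (vder (Some i) f) + (if s = i then f else 0)"
  "vder (Some i) (vmul None f) = vmul None (vder (Some i) f)"
  "vder None (vmul (Some s) f) = vmul (Some s) (vder None f)"
  "vder None (vmul None f) = f - vmul None (vder None f)"
proof -
  show "vder (Some i) (vmul (Some s) f) = vmul (Some s) (vder (Some i) f) + (if s = i then f else 0)"
  proof (rule clin_pol_eqI[of "\<lambda>f. vder (Some i) (vmul (Some s) f)" "\<lambda>f. vmul (Some s) (vder (Some i) f) + (if s = i then f else 0)"])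
    fix a x
    \<comment> \<open>When the exponent \<open>a i\<close> is 0, the truncated exponent
      \<open>a i - 1\<close> is harmless because the derivative carries the coefficient 0.\<close>
    show "vder (Some i) (vmul (Some s) (Poly_Mapping.single (a, x) 1))
      = vmul (Some s) (vder (Some i) (Poly_Mapping.single (a, x) 1)) + (if s = i then Poly_Mapping.single (a, x) 1 else 0)"
      using fun_upd_triv[of a i]
      by (cases "a i") (auto simp: vmul_single vder_single fun_upd_twist single_add[symmetric] add.commute clin_zero[OF clin_vmul])
  qed (cases "s = i"; auto intro!: clin_intros)+
  show "vder (Some i) (vmul None f) = vmul None (vder (Some i) f)"
    by (rule clin_pol_eqI[of "\<lambda>f. vder (Some i) (vmul None f)" "\<lambda>f. vmul None (vder (Some i) f)"])
      (auto intro!: clin_intros simp: vmul_single vder_single clin_zero[OF clin_vder])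
  show "vder None (vmul (Some s) f) = vmul (Some s) (vder None f)"
    by (rule clin_pol_eqI[of "\<lambda>f. vder None (vmul (Some s) f)" "\<lambda>f. vmul (Some s) (vder None f)"])
      (auto intro!: clin_intros simp: vmul_single vder_single clin_zero[OF clin_vmul])
  show "vder None (vmul None f) = f - vmul None (vder None f)"
    by (rule clin_pol_eqI[of "\<lambda>f. vder None (vmul None f)" "\<lambda>f. f - vmul None (vder None f)"])
      (auto intro!: clin_intros simp: vmul_single vder_single clin_zero[OF clin_vmul] clin_zero[OF clin_vder])
qed

lemma vmul_vmul:
  "vmul (Some i) (vmul (Some s) f) = vmul (Some s) (vmul (Some i) f)"
  "vmul None (vmul (Some s) f) = vmul (Some s) (vmul None f)"
  "vmul None (vmul None f) = 0"
proof -
  show "vmul (Some i) (vmul (Some s) f) = vmul (Some s) (vmul (Some i) f)"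
    by (rule clin_pol_eqI[of "\<lambda>f. vmul (Some i) (vmul (Some s) f)" "\<lambda>f. vmul (Some s) (vmul (Some i) f)"])
      (cases "i = s"; auto intro!: clin_intros simp: vmul_single fun_upd_twist)+
  show "vmul None (vmul (Some s) f) = vmul (Some s) (vmul None f)"
    by (rule clin_pol_eqI[of "\<lambda>f. vmul None (vmul (Some s) f)" "\<lambda>f. vmul (Some s) (vmul None f)"])
      (auto intro!: clin_intros simp: vmul_single clin_zero[OF clin_vmul])
  show "vmul None (vmul None f) = 0"
    by (rule clin_pol_eqI[of "\<lambda>f. vmul None (vmul None f)" "\<lambda>f. 0"])
      (auto intro!: clin_intros simp: vmul_single clin_zero[OF clin_vmul])
qed

definition ppar :: "'n pol \<Rightarrow> 'n pol" where
  "ppar = lin_ext (\<lambda>(a, x). Poly_Mapping.single (a, x) (ksign x))"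

lemma clin_ppar [simp]: "clin ppar"
  unfolding ppar_def by (rule clin_lin_ext)

lemma ppar_single: "ppar (Poly_Mapping.single (a, x) c) = Poly_Mapping.single (a, x) (ksign x * c)"
  by (simp add: ppar_def mult.commute)

lemma ppar_rules:
  "ppar (vmul j f) = cscale (ksign (vpar j)) (vmul j (ppar f))"
  "ppar (vder j f) = cscale (ksign (vpar j)) (vder j (ppar f))"
  "ppar (ppar f) = f"
proof -
  show "ppar (vmul j f) = cscale (ksign (vpar j)) (vmul j (ppar f))"
  proof (rule clin_pol_eqI[OF clin_comp[OF clin_ppar clin_vmul] clin_cscale[OF clin_comp[OF clin_vmul clin_ppar]]])
    fix a x
    show "ppar (vmul j (Poly_Mapping.single (a, x) 1)) = cscale (ksign (vpar j)) (vmul j (ppar (Poly_Mapping.single (a, x) 1)))"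
      by (cases j; cases x) (simp_all add: vmul_single ppar_single vpar_def clin_zero[OF clin_ppar] single_uminus clin_minus[OF clin_vmul] clin_minus[OF clin_vder])
  qed
  show "ppar (vder j f) = cscale (ksign (vpar j)) (vder j (ppar f))"
  proof (rule clin_pol_eqI[OF clin_comp[OF clin_ppar clin_vder] clin_cscale[OF clin_comp[OF clin_vder clin_ppar]]])
    fix a x
    show "ppar (vder j (Poly_Mapping.single (a, x) 1)) = cscale (ksign (vpar j)) (vder j (ppar (Poly_Mapping.single (a, x) 1)))"
      by (cases j; cases x) (simp_all add: vder_single ppar_single vpar_def clin_zero[OF clin_ppar] single_uminus clin_minus[OF clin_vmul] clin_minus[OF clin_vder])
  qed
  show "ppar (ppar f) = f"
    by (rule clin_pol_eqI[of "\<lambda>f. ppar (ppar f)" "\<lambda>f. f"]) (auto intro!: clin_id clin_comp[OF clin_ppar] simp: ppar_single)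
qed

context weyl_mod
begin

lemma \<iota>_e:
  "\<iota> (Some i) (e (Some s) u) = e (Some s) (\<iota> (Some i) u) + (if s = i then u else 0)"
  "\<iota> (Some i) (e None u) = e None (\<iota> (Some i) u)"
  "\<iota> None (e (Some s) u) = e (Some s) (\<iota> None u)"
  "\<iota> None (e None u) = u - e None (\<iota> None u)"
proof -
  show "\<iota> (Some i) (e (Some s) u) = e (Some s) (\<iota> (Some i) u) + (if s = i then u else 0)"
  proof -
    have "B (\<lambda>f. if s = i then f else 0) u = (if s = i then u else 0)"
      by (simp add: B_id B_fun_zero)
    then show ?thesis
      by (simp only: B_B[OF clin_vder] B_B[OF clin_vmul] vder_vmul(1) B_fun_add)
  qed
  show "\<iota> (Some i) (e None u) = e None (\<iota> (Some i) u)" "\<iota> None (e (Some s) u) = e (Some s) (\<iota> None u)"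
    by (simp_all only: B_B[OF clin_vder] B_B[OF clin_vmul] vder_vmul(2,3))
  have "B (\<lambda>f. f - vmul None (vder None f)) u = B (\<lambda>f. f + - vmul None (vder None f)) u" by simp
  then show "\<iota> None (e None u) = u - e None (\<iota> None u)"
    by (simp only: B_B[OF clin_vder] B_B[OF clin_vmul] vder_vmul(4) B_fun_add B_id B_fun_minus) simp
qed

lemma e_e:
  "e (Some i) (e (Some s) u) = e (Some s) (e (Some i) u)"
  "e None (e (Some s) u) = e (Some s) (e None u)"
  "e None (e None u) = 0"
  by (simp_all add: B_B vmul_vmul(2,3) vmul_vmul(1)[of i s] B_fun_zero)

text \<open>The total parity operator of the tensor product: the product of the parity operators of
  its two factors.\<close>

definition Pi :: "('n pmon \<Rightarrow>\<^sub>0 'p) \<Rightarrow> ('n pmon \<Rightarrow>\<^sub>0 'p)" where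
  "Pi u = B ppar (St u)"

lemma Pi_add: "Pi (u + v) = Pi u + Pi v" and Pi_scale: "Pi (tscale P c u) = tscale P c (Pi u)"
  and Pi_Pi: "Pi (Pi u) = u"
  and Pi_Mt: "Pi (Mt f u) = Mt (lau_sigma f) (Pi u)"
  and Pi_Dt: "Pi (Dt j u) = tscale P (ksign (pd j)) (Dt j (Pi u))"
  and Pi_St: "Pi (St u) = St (Pi u)"
  and Pi_e: "Pi (e j u) = tscale P (ksign (vpar j)) (e j (Pi u))"
  and Pi_\<iota>: "Pi (\<iota> j u) = tscale P (ksign (vpar j)) (\<iota> j (Pi u))"
  by (simp_all add: Pi_def St_lin B_lin HB B_B ppar_rules St_St B_id St_Mt St_Dt H_B B_fun_scale)

lemma Pi_zero: "Pi 0 = 0" using Pi_scale[of 0 0] by simp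
lemma Pi_minus: "Pi (- u) = - Pi u" using Pi_scale[of "-1" u] by simp
lemma Pi_diff: "Pi (u - v) = Pi u - Pi v" using Pi_add[of u "- v"] by (simp add: Pi_minus)
lemma Pi_sum: "Pi (sum f S) = (\<Sum>x\<in>S. Pi (f x))"
  by (induction S rule: infinite_finite_induct) (auto simp: Pi_add Pi_zero)
lemmas Pi_lin = Pi_add Pi_scale Pi_diff Pi_minus Pi_zero Pi_sum

lemma cf_Pi: "cf (Pi u) (a, x) = sm (ksign x) (\<sigma> (cf u (a, x)))"
proof (induction u rule: pm_induct)
  case (single b v)
  then show ?case by (cases b) (auto simp: Pi_def ppar_single lookup_single when_def \<sigma>_lin)
qed (simp_all add: Pi_lin lookup_add \<sigma>_lin vs.scale_right_distrib)

lemma tensor_part: "u \<in> part (tensor_mod P) p \<longleftrightarrow> Pi u = tscale P (ksign p) u"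
proof -
  have "u \<in> part (tensor_mod P) p \<longleftrightarrow> (\<forall>a x. (a, x) \<in> supp u \<longrightarrow> cf u (a, x) \<in> part P (p + x))"
    unfolding tensor_mod_def by auto
  also have "\<dots> \<longleftrightarrow> (\<forall>a x. cf u (a, x) \<in> part P (p + x))"
    using part_0 by (auto simp: in_keys_iff) metis
  also have "\<dots> \<longleftrightarrow> (\<forall>a x. sm (ksign x) (\<sigma> (cf u (a, x))) = sm (ksign x) (sm (ksign (p + x)) (cf u (a, x))))"
  proof -
    have "w \<in> part P (p + x) \<longleftrightarrow> sm (ksign x) (\<sigma> w) = sm (ksign x) (sm (ksign (p + x)) w)" for w x
      by (cases x) (simp_all only: gr.prt_iff, simp_all)
    then show ?thesis by simp
  qed
  also have "\<dots> \<longleftrightarrow> (\<forall>b. cf (Pi u) b = cf (tscale P (ksign p) u) b)"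
  proof -
    have "ksign x * ksign (p + x) = ksign p" for x by (cases x; cases p) simp_all
    then show ?thesis by (simp only: split_paired_All cf_Pi cf_tscale vs.scale_scale)
  qed
  also have "\<dots> \<longleftrightarrow> Pi u = tscale P (ksign p) u"
    unfolding poly_mapping_eq_iff fun_eq_iff by (rule refl)
  finally show ?thesis .
qed

sublocale tg: graded_space "tscale P" Pi "part (tensor_mod P)"
  by unfold_locales (simp_all add: Pi_lin Pi_Pi tensor_part)


subsection \<open>The differential and Cartan's formula\<close>

lemma diff_eq: "diff P u = e None (Dt None (St u)) - (\<Sum>s\<in>UNIV. e (Some s) (Dt (Some s) u))"
proof -
  have D: "D None = act P d_t" "D (Some s) = act P (d_xi s)" for s
    by (simp_all add: D_def)
  have "otens P d_t 1 (vmul None) u = e None (Dt None (St u))"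
    unfolding H_H[OF plin_D plin_sigma] unfolding D by (rule otens_eq[OF weyl.intros(4)])
  moreover have "otens P (d_xi s) 0 (vmul (Some s)) u = e (Some s) (Dt (Some s) u)" for s
    using otens_eq[OF weyl.intros(5), of s 0] by (simp add: D)
  ultimately show ?thesis by (simp add: diff_def)
qed

text \<open>The operator \<pi>(f d_j) for arbitrary f. The sign \<open>(- 1) ^ (card I + 1)\<close>
  has become \<open>lau_sigma\<close> inside the derivative together with a minus sign, and
  \<open>St\<close> stands exactly in the terms where the matrix unit \<open>E_op\<close> is
  odd.\<close>

definition L :: "'n lau \<Rightarrow> 'n option \<Rightarrow> ('n pmon \<Rightarrow>\<^sub>0 'p) \<Rightarrow> ('n pmon \<Rightarrow>\<^sub>0 'p)" where
  "L f j u = (case j of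
     None \<Rightarrow> Mt f (Dt None u) + e None (\<iota> None (Mt (d_t f) u)) - (\<Sum>s\<in>UNIV. e (Some s) (\<iota> None (Mt (d_xi s (lau_sigma f)) (St u))))
   | Some i \<Rightarrow> Mt f (Dt (Some i) u) + e None (\<iota> (Some i) (Mt (d_t f) (St u))) - (\<Sum>s\<in>UNIV. e (Some s) (\<iota> (Some i) (Mt (d_xi s (lau_sigma f)) u))))"

lemma L_add_left: "L (f + g) j u = L f j u + L g j u"
  by (cases j) (simp_all add: L_def Mt_add_left clin_add[OF clin_sigma] clin_add[OF clin_d_t] clin_add[OF clin_d_xi] B_lin sum.distrib)

lemma L_scale_left: "L (cscale c f) j u = tscale P c (L f j u)"
  by (cases j) (simp_all add: L_def Mt_scale_left clin_scale[OF clin_sigma] clin_scale[OF clin_d_t] clin_scale[OF clin_d_xi] B_lin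
      ts.scale_right_distrib ts.scale_right_diff_distrib ts.scale_sum_right)

lemma L_zero_left: "L 0 j u = 0"
  using L_scale_left[of 0 0 j u] by simp

lemma pi_basis_eq: "pi_basis P k I j u = L (mon k I) j u"
proof -
  have ot: "otens P (amult f) q b u = B b (Mt f (H (twist P q) u))" for f q b
  proof -
    have "twist P 0 = (\<lambda>v. v)" by auto
    then have "plin (twist P q)" using plinI[of "\<lambda>v. v"] plin_sigma by (cases q) simp_all
    then show ?thesis by (simp add: otens_eq weyl_amult H_H M_def[symmetric])
  qed
  have t0: "H (twist P 0) u = u" for u :: "'n pmon \<Rightarrow>\<^sub>0 'p"
  proof -
    have "twist P 0 = (\<lambda>v. v)" "plin (\<lambda>v. v)" by (auto intro: plinI)
    then show ?thesis by (intro poly_mapping_eqI) (simp add: cf_H)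
  qed
  have E: "B (E_op i j) u = e i (\<iota> j u)" for i j u
    by (simp add: E_op_def B_B comp_def)
  have 1: "otens P (amult (mon k I) \<circ> d_var j) 0 id u = Mt (mon k I) (Dt j u)"
  proof -
    have "amult (mon k I) \<circ> d_var j \<in> weyl" by (intro weyl.intros(9) weyl_amult weyl_d_var)
    moreover have "(\<lambda>v. act P (amult (mon k I) \<circ> d_var j) v) = (\<lambda>v. M (mon k I) (D j v))"
      by (simp add: act_comp weyl_amult weyl_d_var M_def D_def)
    ultimately show ?thesis by (simp add: otens_eq id_def B_id H_H)
  qed
  have s: "tscale P ((- 1) ^ (card I + 1)) v = - tscale P ((- 1) ^ card I) v" for v :: "'n pmon \<Rightarrow>\<^sub>0 'p"
    by simp
  show ?thesis
    unfolding pi_basis_def ot 1 E s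
    by (cases j)
      (simp_all add: L_def vpar_def t0 d_t_mon lau_sigma_mon clin_scale[OF clin_d_xi] Mt_scale_left B_lin ts.scale_sum_right)
qed

lemma pi_act_eq: "pi_act P x u = (\<Sum>j\<in>UNIV. L (coef x j) j u)"
proof -
  have "(\<Sum>(k, I)\<in>supp f. tscale P (cf f (k, I)) (pi_basis P k I j u)) = L f j u" for f j
  proof -
    have "L (\<Sum>b\<in>S. g b) j u = (\<Sum>b\<in>S. L (g b) j u)" for S and g :: "_ \<Rightarrow> 'n lau"
      by (induction S rule: infinite_finite_induct) (simp_all add: L_zero_left L_add_left)
    then have "L f j u = (\<Sum>b\<in>supp f. L (cscale (cf f b) (mon (fst b) (snd b))) j u)"
      using arg_cong[OF lau_expand[of f], of "\<lambda>f. L f j u"] by simp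
    then show ?thesis by (simp add: case_prod_unfold pi_basis_eq L_scale_left)
  qed
  then show ?thesis by (simp add: pi_act_def)
qed

lemma diff_lin: "diff P (u + v) = diff P u + diff P v" "diff P (tscale P c u) = tscale P c (diff P u)"
  by (simp_all add: diff_eq St_lin Dt_lin B_lin sum.distrib ts.scale_right_diff_distrib ts.scale_sum_right)

lemma diff_zero: "diff P 0 = 0" using diff_lin(2)[of 0 0] by simp
lemma diff_minus: "diff P (- u) = - diff P u" using diff_lin(2)[of "-1" u] by simp
lemma diff_diff: "diff P (u - v) = diff P u - diff P v" using diff_lin(1)[of u "- v"] by (simp add: diff_minus)
lemma diff_sum: "diff P (sum f S) = (\<Sum>x\<in>S. diff P (f x))"
  by (induction S rule: infinite_finite_induct) (auto simp: diff_lin diff_zero)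

text \<open>Both \<open>\<iota>1\<close> and \<open>\<iota>2\<close> are contraction with the field
  f d_j. They differ by signs that depend on the parity of f; keeping two versions lets Cartan's
  formula hold for inhomogeneous f.\<close>

definition \<iota>1 :: "'n lau \<Rightarrow> 'n option \<Rightarrow> ('n pmon \<Rightarrow>\<^sub>0 'p) \<Rightarrow> ('n pmon \<Rightarrow>\<^sub>0 'p)" where
  "\<iota>1 f j u = (case j of None \<Rightarrow> \<iota> None (Mt (lau_sigma f) (St u)) | Some i \<Rightarrow> \<iota> (Some i) (Mt (lau_sigma f) u))"

definition \<iota>2 :: "'n lau \<Rightarrow> 'n option \<Rightarrow> ('n pmon \<Rightarrow>\<^sub>0 'p) \<Rightarrow> ('n pmon \<Rightarrow>\<^sub>0 'p)" where
  "\<iota>2 f j u = (case j of None \<Rightarrow> \<iota> None (Mt f (St u)) | Some i \<Rightarrow> - \<iota> (Some i) (Mt f u))"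

text \<open>In \<open>diff \<circ> \<iota>1\<close> and \<open>\<iota>2 \<circ> diff\<close> the
  terms with a derivative of the form and an exterior factor cancel. What remains are the
  derivatives of f, giving the matrix-unit terms, and the canonical commutator of \<iota> and e,
  giving f D_j u.\<close>

lemma cartan: "L f j u = diff P (\<iota>1 f j u) + \<iota>2 f j (diff P u)"
proof (cases j)
  case None
  have "(\<Sum>s\<in>UNIV. e (Some s) (\<iota> None (Mt (d_xi s (lau_sigma f)) (St u) + Mt f (Dt (Some s) (St u)))))
    = (\<Sum>s\<in>UNIV. e (Some s) (\<iota> None (Mt (d_xi s (lau_sigma f)) (St u)))) + (\<Sum>s\<in>UNIV. e (Some s) (\<iota> None (Mt f (Dt (Some s) (St u)))))"
    by (simp add: B_lin sum.distrib)
  then show ?thesis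
    by (simp add: None L_def \<iota>1_def \<iota>2_def diff_eq HB St_lin Mt_lin Dt_lin Dt_Mt St_Mt St_St St_Dt_simps B_lin \<iota>_e
        sigma_d_t sum_negf algebra_simps)
next
  case (Some i)
  \<comment> \<open>The Kronecker term of the commutator of \<open>\<iota> (Some i)\<close> and
    \<open>e (Some s)\<close> is the source of f D_i u.\<close>
  have "(\<Sum>s\<in>UNIV. e (Some s) (\<iota> (Some i) (Mt f (Dt (Some s) u))) + (if s = i then Mt f (Dt (Some s) u) else 0))
    = (\<Sum>s\<in>UNIV. e (Some s) (\<iota> (Some i) (Mt f (Dt (Some s) u)))) + Mt f (Dt (Some i) u)"
    by (simp add: sum.distrib)
  then show ?thesis
    by (simp add: Some L_def \<iota>1_def \<iota>2_def diff_eq HB St_lin Mt_lin Dt_lin Dt_Mt St_Mt St_St St_Dt_simps B_lin \<iota>_e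
        sigma_d_t sum_negf sum.distrib algebra_simps)
qed

lemma anti_sum_zero:
  fixes g :: "'n \<Rightarrow> 'n \<Rightarrow> ('n pmon \<Rightarrow>\<^sub>0 'p)"
  assumes "\<And>s t. g s t = - g t s"
  shows "(\<Sum>s\<in>UNIV. \<Sum>t\<in>UNIV. g s t) = 0"
proof -
  let ?S = "\<Sum>s\<in>UNIV. \<Sum>t\<in>UNIV. g s t"
  have "?S = (\<Sum>t\<in>UNIV. \<Sum>s\<in>UNIV. g s t)" by (rule sum.swap)
  also have "\<dots> = (\<Sum>t\<in>UNIV. \<Sum>s\<in>UNIV. - g t s)"
    using assms by (metis (no_types, lifting) sum.cong)
  also have "\<dots> = - ?S" by (simp add: sum_negf)
  finally have "tscale P (1 + 1) ?S = 0" by (simp only: ts.scale_left_distrib ts.scale_one) (metis add.left_inverse)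
  then show ?thesis by simp
qed

text \<open>The d xi_s commute while the D_s anticommute, dt squares to zero, and the mixed terms
  cancel because \<open>St\<close> anticommutes with the odd derivatives.\<close>

lemma diff_sq: "diff P (diff P u) = 0"
proof -
  have "(\<Sum>s\<in>UNIV. \<Sum>t\<in>UNIV. e (Some s) (e (Some t) (Dt (Some s) (Dt (Some t) u)))) = 0"
  proof (rule anti_sum_zero)
    show "e (Some s) (e (Some t) (Dt (Some s) (Dt (Some t) u))) = - e (Some t) (e (Some s) (Dt (Some t) (Dt (Some s) u)))" for s t
      by (subst Dt_Dt(2)) (simp add: B_minus e_e(1)[of s t])
  qed
  then show ?thesis
    by (simp add: diff_eq HB St_lin Dt_lin B_lin St_Dt_simps St_St e_e(2,3) Dt_Dt(1) sum_negf sum_subtractf)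
qed

lemma Pi_d: "Pi (diff P u) = - diff P (Pi u)"
  by (simp add: diff_eq Pi_lin tg.par_diff Pi_e Pi_Dt Pi_St vpar_def sum_negf B_lin)

end


subsection \<open>Degrees\<close>

text \<open>The degree as a differential form: each t_s counts as d xi_s, and dt can occur at most
  once.\<close>

definition dg :: "'n::finite pmon \<Rightarrow> nat" where
  "dg m = (\<Sum>s\<in>UNIV. fst m s) + (if snd m = 1 then 1 else 0)"

definition Deg :: "nat \<Rightarrow> ('n::finite pmon \<Rightarrow>\<^sub>0 'c::zero) set" where
  "Deg d = {u. \<forall>m\<in>supp u. dg m = d}"

lemma Deg_iff: "u \<in> Deg d \<longleftrightarrow> (\<forall>m. cf u m \<noteq> 0 \<longrightarrow> dg m = d)"
  by (auto simp: Deg_def in_keys_iff)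

lemma single_Deg: "dg m = d \<Longrightarrow> Poly_Mapping.single m c \<in> Deg d"
  by (auto simp: Deg_iff lookup_single when_def)

lemma Deg_zero [simp]: "0 \<in> Deg d"
  by (simp add: Deg_iff)

lemma sum_fun_upd: "(\<Sum>t\<in>UNIV. (a(s := k)) t) + a s = (\<Sum>t\<in>UNIV. a t) + (k :: nat)" for a :: "'n::finite \<Rightarrow> nat"
proof -
  have "(\<Sum>t\<in>UNIV - {s}. (a(s := k)) t) = (\<Sum>t\<in>UNIV - {s}. a t)" by (rule sum.cong) auto
  then show ?thesis by (simp add: sum.remove[of UNIV s])
qed

lemma vmul_Deg: "vmul j (Poly_Mapping.single m c) \<in> Deg (Suc (dg m))"
proof -
  obtain a x where m: "m = (a, x)" by (cases m)
  show ?thesis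
    using sum_fun_upd[of a "the j" "Suc (a (the j))"]
    by (cases j) (auto simp: m vmul_single dg_def intro!: single_Deg)
qed

lemma vder_Deg: "dg m = Suc d \<Longrightarrow> vder j (Poly_Mapping.single m c) \<in> Deg d"
proof -
  assume d: "dg m = Suc d"
  obtain a x where m: "m = (a, x)" by (cases m)
  show ?thesis
  proof (cases j)
    case None
    then show ?thesis using d by (auto simp: m vder_single dg_def intro!: single_Deg)
  next
    case (Some s)
    show ?thesis
      using d sum_fun_upd[of a s "a s - 1"] Some
      by (cases "a s") (auto simp: m vder_single dg_def intro!: single_Deg)
  qed
qed

lemma vder_Deg_0: "dg m = 0 \<Longrightarrow> vder j (Poly_Mapping.single m c) = 0"
  by (cases m; cases j) (auto simp: vder_single dg_def split: if_splits)

text \<open>The operator defining \<open>N_mod\<close> is the Euler operator, diagonal with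
  eigenvalue \<open>dg m\<close>. Hence only the sum of the entries of the weight matters.\<close>

lemma N_mod_eq: "N_mod lam = Deg (\<Sum>s\<in>UNIV. lam s)"
proof -
  have S: "cf (vmul (Some s) (vder (Some s) f)) (a, x) = of_nat (a s) * cf f (a, x)" for f s and a :: "'a \<Rightarrow> nat" and x
  proof (induction f rule: pm_induct)
    case (single m c)
    obtain b y where m: "m = (b, y)" by (cases m)
    have "vmul (Some s) (vder (Some s) (Poly_Mapping.single (b, y) c)) = Poly_Mapping.single (b, y) (c * of_nat (b s))"
      by (cases "b s") (auto simp: vmul_single vder_single clin_zero[OF clin_vmul] fun_upd_idem)
    then show ?case by (auto simp: m lookup_single when_def)
  qed (simp_all add: clin_zero[OF clin_vmul] clin_zero[OF clin_vder] clin_add[OF clin_vmul] clin_add[OF clin_vder] lookup_add ring_distribs)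
  have N: "cf (vmul None (vder None f)) (a, x) = (if x = 1 then cf f (a, x) else 0)" for f and a :: "'a \<Rightarrow> nat" and x
  proof (induction f rule: pm_induct)
    case (single m c)
    obtain b y where m: "m = (b, y)" by (cases m)
    show ?case by (auto simp: m lookup_single when_def vmul_single vder_single clin_zero[OF clin_vmul])
  qed (simp_all add: clin_zero[OF clin_vmul] clin_zero[OF clin_vder] clin_add[OF clin_vmul] clin_add[OF clin_vder] lookup_add)
  have "cf (\<Sum>j\<in>UNIV. vmul j (vder j v)) m = of_nat (dg m) * cf v m" for v :: "'a pol" and m
  proof -
    obtain a x where m: "m = (a, x)" by (cases m)
    show ?thesis
      by (simp add: UNIV_option_conv sum.reindex lookup_add lookup_sum m S N dg_def ring_distribs sum_distrib_right)
  qed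
  then have "v \<in> N_mod lam \<longleftrightarrow> (\<forall>m. of_nat (dg m) * cf v m = of_nat (\<Sum>s\<in>UNIV. lam s) * cf v m)" for v
    unfolding N_mod_def poly_mapping_eq_iff fun_eq_iff mem_Collect_eq by simp
  also have "\<dots> v \<longleftrightarrow> v \<in> Deg (\<Sum>s\<in>UNIV. lam s)" for v
    unfolding mult_cancel_right of_nat_eq_iff Deg_iff by blast
  finally show ?thesis by blast
qed

text \<open>The basis of one-forms: dt for \<open>None\<close> and d xi_s for
  \<open>Some s\<close>.\<close>

definition V :: "'n option \<Rightarrow> 'n pmon" where
  "V j = (case j of None \<Rightarrow> (\<lambda>_. 0, 1) | Some s \<Rightarrow> (unit_vec s, 0))"

definition V0 :: "'n pmon" where
  "V0 = (\<lambda>_. 0, 0)"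

lemma unit_vec_inj [simp]: "unit_vec s = unit_vec t \<longleftrightarrow> s = t"
proof
  assume "unit_vec s = unit_vec t"
  from fun_cong[OF this, of s] show "s = t" by (simp add: unit_vec_def split: if_splits)
qed simp

lemma V_inj [simp]: "V j = V l \<longleftrightarrow> j = l"
  by (cases j; cases l) (auto simp: V_def)

lemma sum_unit_vec: "(\<Sum>s\<in>UNIV. unit_vec i s) = 1" for i :: "'n::finite"
  by (simp add: unit_vec_def)

lemma dg_V: "dg (V j) = 1" and dg_V0: "dg V0 = 0"
  by (cases j) (simp_all add: V_def V0_def dg_def sum_unit_vec)

lemma dg_1: "dg m = 1 \<Longrightarrow> \<exists>j. m = V j"
proof -
  assume d: "dg m = 1"
  obtain a x where m: "m = (a, x)" by (cases m)
  show ?thesis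
  proof (cases x)
    case one
    then have "a = (\<lambda>_. 0)" using d by (auto simp: m dg_def)
    then have "m = V None" by (simp add: m one V_def)
    then show ?thesis ..
  next
    case zero
    then have "(\<Sum>s\<in>UNIV. a s) = 1" using d by (simp add: m dg_def)
    then obtain s where s: "a s = 1" "\<And>t. t \<noteq> s \<Longrightarrow> a t = 0"
      using sum_eq_1_iff[of UNIV a] by auto
    then have "a = unit_vec s" by (auto simp: unit_vec_def)
    then have "m = V (Some s)" by (simp add: m zero V_def)
    then show ?thesis ..
  qed
qed

lemma dg_0: "dg m = 0 \<Longrightarrow> m = V0"
  by (cases m) (auto simp: dg_def V0_def split: if_splits)

lemma vmul_V0: "vmul j (Poly_Mapping.single V0 c) = Poly_Mapping.single (V j) c"
  by (cases j) (auto simp: V0_def V_def vmul_single unit_vec_def intro!: arg_cong2[of _ _ _ _ Poly_Mapping.single])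

lemma vder_V: "vder j (Poly_Mapping.single (V l) c) = (if j = l then Poly_Mapping.single V0 c else 0)"
  by (cases j; cases l)
    (auto simp: V0_def V_def vder_single unit_vec_def fun_upd_def intro!: arg_cong2[of _ _ _ _ Poly_Mapping.single])

context weyl_mod
begin

lemma Deg_subspace: "ts.subspace (Deg d :: ('n pmon \<Rightarrow>\<^sub>0 'p) set)"
proof (rule ts.subspaceI)
  fix u v :: "'n pmon \<Rightarrow>\<^sub>0 'p" assume uv: "u \<in> Deg d" "v \<in> Deg d"
  have "cf u m \<noteq> 0 \<or> cf v m \<noteq> 0" if "cf (u + v) m \<noteq> 0" for m
    using that by (auto simp: lookup_add)
  with uv show "u + v \<in> Deg d" unfolding Deg_iff by blast
qed (auto simp: Deg_iff)

lemma tens_Deg: "f \<in> Deg d \<Longrightarrow> tens P v f \<in> Deg d"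
  by (auto simp: Deg_iff)

lemma carrier_F: "carrier (F_mod P lam) = Deg (\<Sum>s\<in>UNIV. lam s)"
proof -
  let ?d = "\<Sum>s\<in>UNIV. lam s"
  let ?T = "{tens P v f | v f. f \<in> N_mod lam}"
  have "ts.span ?T = Deg ?d"
  proof
    show "ts.span ?T \<subseteq> Deg ?d"
      by (rule ts.span_minimal[OF _ Deg_subspace]) (auto simp: N_mod_eq tens_Deg)
    show "Deg ?d \<subseteq> ts.span ?T"
    proof
      fix u :: "'n pmon \<Rightarrow>\<^sub>0 'p" assume u: "u \<in> Deg ?d"
      have "Poly_Mapping.single m (cf u m) \<in> ts.span ?T" if "m \<in> supp u" for m
      proof (rule ts.span_base)
        have "Poly_Mapping.single m (cf u m) = tens P (cf u m) (Poly_Mapping.single m 1)" by simp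
        moreover have "Poly_Mapping.single m 1 \<in> N_mod lam"
          using u that by (auto simp: N_mod_eq Deg_def[of "sum _ _"])
        ultimately show "Poly_Mapping.single m (cf u m) \<in> ?T" by blast
      qed
      then have "(\<Sum>m\<in>supp u. Poly_Mapping.single m (cf u m)) \<in> ts.span ?T" by (rule ts.span_sum)
      then show "u \<in> ts.span ?T" using poly_mapping_sum_singles[of u] by simp
    qed
  qed
  then show ?thesis by (simp add: F_mod_def restr_def)
qed

lemma F_mod_simps [simp]: "add (F_mod P lam) = (+)" "zero (F_mod P lam) = 0" "smult (F_mod P lam) = tscale P"
  "act (F_mod P lam) = pi_act P" "part (F_mod P lam) p = part (tensor_mod P) p \<inter> Deg (\<Sum>s\<in>UNIV. lam s)"
proof -
  show "part (F_mod P lam) p = part (tensor_mod P) p \<inter> Deg (\<Sum>s\<in>UNIV. lam s)"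
    using carrier_F[of lam] by (simp add: F_mod_def restr_def)
qed (simp_all add: F_mod_def restr_def tensor_mod_def)

lemma tensor_mod_simps [simp]: "carrier (tensor_mod P) = UNIV" "add (tensor_mod P) = (+)" "zero (tensor_mod P) = 0"
  "smult (tensor_mod P) = tscale P" "act (tensor_mod P) = pi_act P"
  by (simp_all add: tensor_mod_def)

lemma H_Deg: "plin \<phi> \<Longrightarrow> u \<in> Deg d \<Longrightarrow> H \<phi> u \<in> Deg d"
  by (auto simp: Deg_iff cf_H) (metis plin_zero)

lemma B_Deg:
  fixes b :: "'n pol \<Rightarrow> 'n pol"
  assumes "\<And>m. dg m = d \<Longrightarrow> b (Poly_Mapping.single m 1) \<in> Deg d'" "u \<in> Deg d"
  shows "B b u \<in> Deg d'"
  unfolding B_def using assms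
  by (intro ts.subspace_sum[OF Deg_subspace] tens_Deg) (auto simp: Deg_def[of d])

lemma e_Deg: "u \<in> Deg d \<Longrightarrow> e j u \<in> Deg (Suc d)"
  by (rule B_Deg) (use vmul_Deg in auto)

lemma \<iota>_Deg: "u \<in> Deg (Suc d) \<Longrightarrow> \<iota> j u \<in> Deg d"
  by (rule B_Deg) (use vder_Deg in auto)

lemma \<iota>_Deg_0: "u \<in> Deg 0 \<Longrightarrow> \<iota> j u = 0"
  unfolding B_def by (rule sum.neutral) (auto simp: Deg_def vder_Deg_0)

lemma diff_Deg: "u \<in> Deg d \<Longrightarrow> diff P u \<in> Deg (Suc d)"
  unfolding diff_eq
  by (intro ts.subspace_diff[OF Deg_subspace] ts.subspace_sum[OF Deg_subspace] e_Deg H_Deg plin_D plin_sigma)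

lemma \<iota>1_Deg: "u \<in> Deg (Suc d) \<Longrightarrow> \<iota>1 f j u \<in> Deg d"
  by (cases j) (simp_all add: \<iota>1_def \<iota>_Deg H_Deg)

lemma \<iota>1_Deg_0: "u \<in> Deg 0 \<Longrightarrow> \<iota>1 f j u = 0"
  by (cases j) (simp_all add: \<iota>1_def \<iota>_Deg_0 H_Deg)

lemma \<iota>2_Deg: "u \<in> Deg (Suc d) \<Longrightarrow> \<iota>2 f j u \<in> Deg d"
  by (cases j) (simp_all add: \<iota>2_def \<iota>_Deg H_Deg ts.subspace_neg[OF Deg_subspace])

lemma pi_act_cartan: "pi_act P x u = diff P (\<Sum>j\<in>UNIV. \<iota>1 (coef x j) j u) + (\<Sum>j\<in>UNIV. \<iota>2 (coef x j) j (diff P u))"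
  by (simp add: pi_act_eq cartan diff_sum sum.distrib)

lemma pi_act_Deg: "u \<in> Deg d \<Longrightarrow> pi_act P x u \<in> Deg d"
proof -
  assume u: "u \<in> Deg d"
  have "diff P (\<Sum>j\<in>UNIV. \<iota>1 (coef x j) j u) \<in> Deg d"
  proof (cases d)
    case 0
    then show ?thesis using u by (simp add: \<iota>1_Deg_0 diff_zero)
  next
    case (Suc d')
    then show ?thesis using u by (auto intro!: diff_Deg ts.subspace_sum[OF Deg_subspace] \<iota>1_Deg)
  qed
  moreover have "(\<Sum>j\<in>UNIV. \<iota>2 (coef x j) j (diff P u)) \<in> Deg d"
    using u by (auto intro!: diff_Deg ts.subspace_sum[OF Deg_subspace] \<iota>2_Deg)
  ultimately show ?thesis
    unfolding pi_act_cartan by (rule ts.subspace_add[OF Deg_subspace])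
qed

lemma \<iota>_0: "\<iota>1 f j 0 = 0" "\<iota>2 f j 0 = 0"
  by (cases j; simp add: \<iota>1_def \<iota>2_def St_lin Mt_lin B_lin)+

lemma pi_act_closed: "diff P u = 0 \<Longrightarrow> pi_act P x u = diff P (\<Sum>j\<in>UNIV. \<iota>1 (coef x j) j u)"
  by (simp add: pi_act_cartan \<iota>_0)

lemma pi_act_diff: "pi_act P x (diff P u) = diff P (\<Sum>j\<in>UNIV. \<iota>1 (coef x j) j (diff P u))"
  by (rule pi_act_closed) (rule diff_sq)

lemma diff_pi_act: "diff P (pi_act P x u) = diff P (\<Sum>j\<in>UNIV. \<iota>2 (coef x j) j (diff P u))"
  by (simp add: pi_act_cartan diff_lin diff_sq)

lemma Pi_\<iota>1: "Pi (\<iota>1 f j (Pi u)) = - \<iota>2 f j u"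
  by (cases j) (simp_all add: \<iota>1_def \<iota>2_def Pi_\<iota> Pi_Mt Pi_St Pi_Pi vpar_def)

text \<open>\<open>diff\<close> passes \<pi>(x) with a sign depending on the parity of x.
  Conjugation by \<open>Pi\<close> produces this sign also for inhomogeneous x, as needed for
  stability of preimages under \<open>diff\<close>.\<close>

lemma diff_pi_act_Pi: "diff P (pi_act P x u) = Pi (pi_act P x (Pi (diff P u)))"
proof -
  have "Pi (diff P u) = diff P (- Pi u)" by (simp add: Pi_d diff_minus)
  then have "Pi (pi_act P x (Pi (diff P u))) = Pi (diff P (\<Sum>j\<in>UNIV. \<iota>1 (coef x j) j (Pi (diff P u))))"
    by (simp only: pi_act_diff)
  also have "\<dots> = - diff P (\<Sum>j\<in>UNIV. Pi (\<iota>1 (coef x j) j (Pi (diff P u))))"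
    by (simp add: Pi_d Pi_sum)
  finally show ?thesis by (simp add: Pi_\<iota>1 diff_pi_act sum_negf diff_minus)
qed

text \<open>For x of parity p the j-th coefficient has parity p + \<open>pd j\<close>, which turns
  the signs separating \<open>\<iota>1\<close> from \<open>\<iota>2\<close> into the single factor
  \<open>ksign p\<close>.\<close>

lemma diff_pi_act_homog:
  assumes "x \<in> oper_part p"
  shows "diff P (pi_act P x u) = tscale P (ksign p) (pi_act P x (diff P u))"
proof -
  have "\<iota>2 (coef x j) j w = tscale P (ksign p) (\<iota>1 (coef x j) j w)" for j w
    using coef_part[OF assms, of j]
    by (cases j) (simp_all add: \<iota>1_def \<iota>2_def lau_part_iff ksign_add Mt_scale_left B_lin Mt_minus_left)
  then show ?thesis
    by (simp add: diff_pi_act pi_act_diff diff_lin flip: ts.scale_sum_right)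
qed

lemma pi_act_vf: "pi_act P (vf g j) u = L g j u"
proof -
  have "L (coef (vf g j) l) l u = (if l = j then L g j u else 0)" for l
    by (simp add: coef_vf L_zero_left)
  then show ?thesis by (simp add: pi_act_eq)
qed


subsection \<open>Forms of degree one in components\<close>

abbreviation sv :: "'n option \<Rightarrow> 'p \<Rightarrow> ('n pmon \<Rightarrow>\<^sub>0 'p)" where "sv j \<equiv> Poly_Mapping.single (V j)"
abbreviation s0 :: "'p \<Rightarrow> ('n pmon \<Rightarrow>\<^sub>0 'p)" where "s0 \<equiv> Poly_Mapping.single V0"
abbreviation cmp :: "('n pmon \<Rightarrow>\<^sub>0 'p) \<Rightarrow> 'n option \<Rightarrow> 'p" where "cmp u j \<equiv> cf u (V j)"

lemma sv_Deg [simp]: "sv j v \<in> Deg 1" and s0_Deg [simp]: "s0 v \<in> Deg 0"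
  by (simp_all add: single_Deg dg_V dg_V0)

lemma sv_Deg' [simp]: "sv j v \<in> Deg (Suc 0)"
  using sv_Deg by simp

lemma cmp_sv: "cmp (sv j v) l = (if l = j then v else 0)"
  by (auto simp: lookup_single when_def)

lemma Deg_1_eqI:
  assumes "u \<in> Deg 1" "w \<in> Deg 1" "\<And>j. cmp u j = cmp w j"
  shows "u = w"
proof (rule poly_mapping_eqI)
  fix m
  show "cf u m = cf w m"
  proof (cases "dg m = 1")
    case True
    then show ?thesis using dg_1 assms(3) by metis
  next
    case False
    then show ?thesis using assms(1,2) unfolding Deg_iff by metis
  qed
qed

lemma Deg_1_expand: "u \<in> Deg 1 \<Longrightarrow> u = (\<Sum>j\<in>UNIV. sv j (cmp u j))"
  by (rule Deg_1_eqI) (auto intro!: ts.subspace_sum[OF Deg_subspace] simp: lookup_sum cmp_sv)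

lemma e_s0: "e j (s0 v) = sv j v"
  by (simp add: vmul_V0)

lemma \<iota>_Deg_1: "u \<in> Deg 1 \<Longrightarrow> \<iota> j u = s0 (cmp u j)"
proof -
  assume "u \<in> Deg 1"
  then have "\<iota> j u = \<iota> j (\<Sum>l\<in>UNIV. sv l (cmp u l))" using Deg_1_expand by metis
  also have "\<dots> = (\<Sum>l\<in>UNIV. if j = l then s0 (cmp u l) else 0)"
    unfolding B_sum by (rule sum.cong) (simp_all add: vder_V)
  finally show ?thesis by simp
qed

lemma cmp_diff_s0: "cmp (diff P (s0 p)) None = D None (\<sigma> p)" "cmp (diff P (s0 p)) (Some s) = - D (Some s) p"
  by (simp_all add: diff_eq e_s0 lookup_minus lookup_sum cmp_sv del: B_single)

text \<open>The twist in the dt-component is invertible and commutes with d/dt, so it does not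
  affect vanishing.\<close>

lemma diff_s0_zero_iff: "diff P (s0 p) = 0 \<longleftrightarrow> (\<forall>l. D l p = 0)"
proof
  assume z: "diff P (s0 p) = 0"
  have "D None (\<sigma> p) = 0" "\<And>s. D (Some s) p = 0" using cmp_diff_s0[of p] by (simp_all add: z)
  then have "\<sigma> (D None (\<sigma> p)) = 0" "\<And>s. D (Some s) p = 0" by (simp_all add: \<sigma>_lin)
  then have "D l p = 0" for l by (cases l) (simp_all add: \<sigma>_D_simps)
  then show "\<forall>l. D l p = 0" by blast
next
  assume z: "\<forall>l. D l p = 0"
  have "D None (\<sigma> p) = \<sigma> (D None p)" by (simp add: \<sigma>_D_simps)
  then have "D None (\<sigma> p) = 0" using z by (simp add: \<sigma>_lin)
  then have "cmp (diff P (s0 p)) j = cmp 0 j" for j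
    using z by (cases j) (simp_all add: cmp_diff_s0)
  then show "diff P (s0 p) = 0"
    using diff_Deg[OF s0_Deg, of p] by (intro Deg_1_eqI) simp_all
qed

lemma cmp_L_Some:
  assumes "u \<in> Deg 1"
  shows "cmp (L f (Some i) u) None = M f (D (Some i) (cmp u None)) + M (d_t f) (\<sigma> (cmp u (Some i)))"
    "cmp (L f (Some i) u) (Some s) = M f (D (Some i) (cmp u (Some s))) - M (d_xi s (lau_sigma f)) (cmp u (Some i))"
  using assms
  by (simp_all add: L_def \<iota>_Deg_1 H_Deg e_s0 lookup_add lookup_minus lookup_sum cmp_sv cf_HH del: B_single)

lemma cmp_L_None:
  assumes "u \<in> Deg 1"
  shows "cmp (L f None u) None = M f (D None (cmp u None)) + M (d_t f) (cmp u None)"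
    "cmp (L f None u) (Some s) = M f (D None (cmp u (Some s))) - M (d_xi s (lau_sigma f)) (\<sigma> (cmp u None))"
  using assms
  by (simp_all add: L_def \<iota>_Deg_1 H_Deg e_s0 lookup_add lookup_minus lookup_sum cmp_sv cf_HH del: B_single)

lemma L_Deg: "u \<in> Deg d \<Longrightarrow> L f j u \<in> Deg d"
  using pi_act_Deg[of u d "vf f j"] by (simp add: pi_act_vf)

lemma Mt_Deg: "u \<in> Deg d \<Longrightarrow> Mt f u \<in> Deg d"
  by (rule H_Deg[OF plin_M])

text \<open>Cartan's formula for the constant field d/dxi_a, solved for the contraction of
  du.\<close>

lemma \<iota>_diff: "u \<in> Deg 1 \<Longrightarrow> \<iota> (Some a) (diff P u) = diff P (s0 (cmp u (Some a))) - L (mon 0 {}) (Some a) u"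
  by (simp add: cartan \<iota>1_def \<iota>2_def lau_sigma_mon Mt_one \<iota>_Deg_1)

lemma cf_\<iota>: "cf (\<iota> (Some s) u) (a, x) = sm (of_nat (a s + 1)) (cf u (a(s := a s + 1), x))"
proof (induction u rule: pm_induct)
  case (single m v)
  obtain b y where m: "m = (b, y)" by (cases m)
  show ?case
  proof (cases "b s")
    case 0
    then have "(b, y) \<noteq> (a(s := a s + 1), x)" by auto
    then show ?thesis using 0 by (auto simp: m vder_single lookup_single when_def)
  next
    case (Suc k)
    then have "(b(s := b s - 1), y) = (a, x) \<longleftrightarrow> (b, y) = (a(s := a s + 1), x)"
      by (auto simp: fun_eq_iff split: if_splits)
    then show ?thesis using Suc by (auto simp: m vder_single lookup_single when_def)
  qed
qed (simp_all add: B_lin lookup_add vs.scale_right_distrib)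

text \<open>In degree at least 2 every monomial contains some t_s, because \<xi> occurs at most
  once; contraction then recovers its coefficient up to the nonzero factor \<open>b s\<close>. In
  degree 1 the form dt would be a counterexample.\<close>

lemma \<iota>_all_zero:
  assumes u: "u \<in> Deg (Suc (Suc d))" and z: "\<And>s. \<iota> (Some s) u = 0"
  shows "u = 0"
proof (rule poly_mapping_eqI)
  fix m :: "'n pmon"
  obtain b y where m: "m = (b, y)" by (cases m)
  show "cf u m = cf 0 m"
  proof (cases "\<exists>s. b s \<noteq> 0")
    case True
    then obtain s k where s: "b s = Suc k" by (auto simp: gr0_conv_Suc)
    have "cf (\<iota> (Some s) u) (b(s := k), y) = sm (of_nat (k + 1)) (cf u m)"
      using s by (simp add: cf_\<iota> m fun_upd_idem)
    then show ?thesis using z[of s] by (simp del: of_nat_add of_nat_Suc)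
  next
    case False
    then have "dg m \<noteq> Suc (Suc d)" by (simp add: m dg_def)
    then show ?thesis using u unfolding Deg_iff by (metis lookup_zero)
  qed
qed

text \<open>The two families of equations are the d xi_a d xi_s and dt d xi_a components of du;
  there is no dt dt component. By \<open>\<iota>_all_zero\<close> the odd contractions see all of
  du.\<close>

lemma diff_zeroI:
  assumes u: "u \<in> Deg 1" and "\<And>a s. D (Some a) (cmp u (Some s)) + D (Some s) (cmp u (Some a)) = 0"
    and "\<And>a. D (Some a) (cmp u None) = D None (\<sigma> (cmp u (Some a)))"
  shows "diff P u = 0"
proof (rule \<iota>_all_zero)
  show "diff P u \<in> Deg (Suc (Suc 0))" using diff_Deg[OF u] by simp
  fix a
  show "\<iota> (Some a) (diff P u) = 0"
  proof (rule Deg_1_eqI)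
    show "\<iota> (Some a) (diff P u) \<in> Deg 1" using diff_Deg[OF u] \<iota>_Deg by simp
    fix j show "cmp (\<iota> (Some a) (diff P u)) j = cmp 0 j"
      using assms(2)[of a "the j"] assms(3)[of a]
      by (cases j) (simp_all add: \<iota>_diff[OF u] lookup_minus cmp_diff_s0 cmp_L_Some[OF u] lau_sigma_mon neg_eq_iff_add_eq_0 add.commute)
  qed simp
qed

text \<open>The component of d(p d xi_a) at d xi_a d xi_a is a multiple of D_a p, and d xi_a does
  not square to zero. If all these forms were closed, D_a would vanish on \<open>P\<close>.\<close>

lemma ex_not_closed: "\<exists>p. diff P (sv (Some a) p) \<noteq> 0" if "\<exists>p :: 'p. p \<noteq> 0"
proof (rule ccontr)
  assume "\<not> ?thesis"
  then have z: "diff P (sv (Some a) p) = 0" for p by blast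
  have "D (Some a) p = 0" for p
  proof -
    have "cmp (\<iota> (Some a) (diff P (sv (Some a) p))) (Some a) = - D (Some a) p - D (Some a) p"
      by (simp only: \<iota>_diff sv_Deg) (simp add: lookup_minus cmp_diff_s0 cmp_L_Some[OF sv_Deg] cmp_sv lau_sigma_mon)
    then have "D (Some a) p + D (Some a) p = 0" by (simp add: z neg_eq_iff_add_eq_0)
    then have "sm (1 + 1) (D (Some a) p) = 0" by (simp only: vs.scale_left_distrib vs.scale_one)
    then show ?thesis by simp
  qed
  then have "p = 0" for p :: 'p by (rule all_D_zero)
  with that show False by blast
qed

end


lemma t_right: "amult g (mon k {}) = amult (mon k {}) g"
  by (rule clin_mon_eqI[of "\<lambda>g. amult g (mon k {})"]) (simp_all add: amult_mon add.commute)

section \<open>Simplicity of the space of exact two-forms\<close>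

text \<open>Because \<open>X\<close> contains all closed forms, exact corrections may be added or
  subtracted freely; this makes contractions of du available from Lie derivatives.\<close>

locale forms_submodule = simple_weyl_mod P for P :: "('n::{finite,linorder} oper, 'p::ab_group_add) smod" +
  fixes X :: "('n pmon \<Rightarrow>\<^sub>0 'p) set"
  assumes n: "CARD('n) \<ge> 2"
    and X_sub: "ts.subspace X" and X_Deg: "X \<subseteq> Deg 1" and X_Pi: "u \<in> X \<Longrightarrow> Pi u \<in> X"
    and X_act: "x \<in> S'_alg \<Longrightarrow> u \<in> X \<Longrightarrow> pi_act P x u \<in> X"
    and X_closed: "u \<in> Deg 1 \<Longrightarrow> diff P u = 0 \<Longrightarrow> u \<in> X"
begin

lemma Deg_X: "u \<in> X \<Longrightarrow> u \<in> Deg 1"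
  using X_Deg by blast

lemma Deg_X': "u \<in> X \<Longrightarrow> u \<in> Deg (Suc 0)"
  using Deg_X by simp

lemma L_xi: "u \<in> X \<Longrightarrow> d_xi a g = 0 \<Longrightarrow> L g (Some a) u \<in> X"
  using X_act[OF S'_vf_xi[OF n, of a "amult (mon 0 {a}) g"]] d_xi_lift[of a g] by (simp add: pi_act_vf)

lemma L_t: "u \<in> X \<Longrightarrow> L (mon 0 {l}) None u \<in> X"
  using X_act[OF S'_vf_t[OF n]] by (simp add: pi_act_vf)

lemma L_d_t: "u \<in> X \<Longrightarrow> L (mon 0 {}) None u \<in> X"
proof -
  have "vf (mon 0 {}) None = (d_t :: 'n oper)" by (auto simp: vf_def)
  then show "u \<in> X \<Longrightarrow> L (mon 0 {}) None u \<in> X"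
    using X_act[OF S'_d_t[OF n]] by (metis pi_act_vf)
qed

lemma exact: "diff P (s0 p) \<in> X"
  using X_closed[OF _ diff_sq] diff_Deg[OF s0_Deg] by simp

lemma X_add: "u \<in> X \<Longrightarrow> w \<in> X \<Longrightarrow> u + w \<in> X"
  and X_diff: "u \<in> X \<Longrightarrow> w \<in> X \<Longrightarrow> u - w \<in> X"
  and X_scale: "u \<in> X \<Longrightarrow> tscale P c u \<in> X"
  and X_neg: "u \<in> X \<Longrightarrow> - u \<in> X"
  using X_sub by (simp_all add: ts.subspace_add ts.subspace_diff ts.subspace_scale ts.subspace_neg)

text \<open>Up to an exact form, \<open>h \<eta>\<close> is \<open>h \<partial>\<^sub>a\<close> applied to \<open>u\<close>; it is the contraction of \<open>du\<close> with \<open>h \<partial>\<^sub>a\<close>.\<close>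

definition \<eta> :: "'n \<Rightarrow> ('n pmon \<Rightarrow>\<^sub>0 'p) \<Rightarrow> ('n pmon \<Rightarrow>\<^sub>0 'p)" where
  "\<eta> a u = L (mon 0 {}) (Some a) u - diff P (s0 (cmp u (Some a)))"

lemma cmp_\<eta>:
  assumes "u \<in> X"
  shows "cmp (\<eta> a u) None = D (Some a) (cmp u None) - D None (\<sigma> (cmp u (Some a)))"
    "cmp (\<eta> a u) (Some s) = D (Some a) (cmp u (Some s)) + D (Some s) (cmp u (Some a))"
  by (simp_all add: \<eta>_def lookup_minus cmp_L_Some[OF Deg_X[OF assms]] cmp_diff_s0 lau_sigma_mon)

lemma diff_s0_Deg1: "diff P (s0 p) \<in> Deg 1"
  using diff_Deg[OF s0_Deg] by simp

lemma \<eta>_Deg: "u \<in> X \<Longrightarrow> \<eta> a u \<in> Deg 1"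
  unfolding \<eta>_def by (intro ts.subspace_diff[OF Deg_subspace] L_Deg Deg_X diff_s0_Deg1)

text \<open>\<pi>(h d_a) u differs from h times the contraction of du only by the differential of
  (\<open>lau_sigma h\<close>) u_a, which is exact. Thus all admissible multiples of \<eta> lie in
  \<open>X\<close>, though \<open>X\<close> is not closed under multiplication by h.\<close>

lemma \<eta>_X:
  assumes u: "u \<in> X" and h: "d_xi a h = 0"
  shows "Mt h (\<eta> a u) \<in> X"
proof -
  have "Mt h (\<eta> a u) = L h (Some a) u - diff P (s0 (M (lau_sigma h) (cmp u (Some a))))"
  proof (rule Deg_1_eqI)
    show "Mt h (\<eta> a u) \<in> Deg 1" using u by (intro Mt_Deg \<eta>_Deg)
    show "L h (Some a) u - diff P (s0 (M (lau_sigma h) (cmp u (Some a)))) \<in> Deg 1"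
      using u by (intro ts.subspace_diff[OF Deg_subspace] L_Deg Deg_X diff_s0_Deg1)
    fix j
    show "cmp (Mt h (\<eta> a u)) j = cmp (L h (Some a) u - diff P (s0 (M (lau_sigma h) (cmp u (Some a))))) j"
      by (cases j)
        (simp_all add: cf_HH cmp_\<eta>[OF u] lookup_minus cmp_L_Some[OF Deg_X[OF u]] cmp_diff_s0 \<sigma>_M D_M M_lin)
  qed
  then show ?thesis using L_xi[OF u h] exact X_diff by simp
qed

text \<open>The Lie derivative is not linear over functions: replacing Y by tY adds dt times the
  contraction with Y, and acting on t w adds nothing else since Y = g d_a kills t. The difference is
  a form with a single component.\<close>

lemma extract_t:
  assumes w: "w \<in> X" "Mt (mon 1 {}) w \<in> X" and g: "d_xi a g = 0"
  shows "sv None (M g (\<sigma> (cmp w (Some a)))) \<in> X"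
proof -
  let ?t = "mon 1 {}"
  have "d_xi a (amult ?t g) = 0" using g by (simp add: d_xi_amult lau_sigma_mon)
  then have "L (amult ?t g) (Some a) w - L g (Some a) (Mt ?t w) \<in> X"
    using L_xi w g X_diff by blast
  moreover have "L (amult ?t g) (Some a) w - L g (Some a) (Mt ?t w) = sv None (M g (\<sigma> (cmp w (Some a))))"
  proof (rule Deg_1_eqI)
    show "L (amult ?t g) (Some a) w - L g (Some a) (Mt ?t w) \<in> Deg 1"
      using w by (intro ts.subspace_diff[OF Deg_subspace] L_Deg Deg_X)
    fix j
    show "cmp (L (amult ?t g) (Some a) w - L g (Some a) (Mt ?t w)) j = cmp (sv None (M g (\<sigma> (cmp w (Some a))))) j"
      by (cases j)
        (simp_all add: lookup_minus cmp_L_Some Deg_X' w cf_HH cmp_sv D_M M_M lau_sigma_mon \<sigma>_M d_t_amult sigma_amult d_xi_amult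
          t_right M_add_left)
  qed simp
  ultimately show ?thesis by simp
qed

text \<open>The same comparison with the odd function xi_c, which explains the plus sign. For c
  different from a the field g d_a kills xi_c, and g xi_c stays admissible.\<close>

lemma extract_xi:
  assumes w: "w \<in> X" "Mt (mon 0 {c}) w \<in> X" and g: "d_xi a g = 0" and ca: "c \<noteq> a"
  shows "sv (Some c) (M g (cmp w (Some a))) \<in> X"
proof -
  let ?x = "mon 0 {c}"
  have "d_xi a (amult g ?x) = 0" using g ca by (simp add: d_xi_amult)
  then have "L (amult g ?x) (Some a) w + L g (Some a) (Mt ?x w) \<in> X"
    using L_xi w g X_add by blast
  moreover have "L (amult g ?x) (Some a) w + L g (Some a) (Mt ?x w) = sv (Some c) (M g (cmp w (Some a)))"
  proof (rule Deg_1_eqI)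
    show "L (amult g ?x) (Some a) w + L g (Some a) (Mt ?x w) \<in> Deg 1"
      using w by (intro ts.subspace_add[OF Deg_subspace] L_Deg Deg_X)
    fix j
    show "cmp (L (amult g ?x) (Some a) w + L g (Some a) (Mt ?x w)) j = cmp (sv (Some c) (M g (cmp w (Some a)))) j"
    proof (cases j)
      case None
      then show ?thesis using ca
        by (simp add: lookup_add cmp_L_Some Deg_X' w cf_HH cmp_sv D_M M_M M_lin lau_sigma_mon \<sigma>_M d_t_amult M_minus_left amult_minus_right)
    next
      case (Some s)
      have "d_xi s ?x = (if s = c then mon 0 {} else 0)" by simp
      then show ?thesis using ca Some
        by (simp add: lookup_add cmp_L_Some Deg_X' w cf_HH cmp_sv D_M M_M M_lin lau_sigma_mon \<sigma>_M sigma_amult d_xi_amult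
            M_minus_left amult_minus_right amult_minus_left M_add_left M_diff_left clin_minus[OF clin_d_xi])
    qed
  qed simp
  ultimately show ?thesis by simp
qed

lemma diagonal_forms:
  assumes u: "u \<in> X" and g: "d_xi a g = 0"
  shows "sv None (M g (\<sigma> (D (Some a) (cmp u (Some a))))) \<in> X"
    "c \<noteq> a \<Longrightarrow> sv (Some c) (M g (D (Some a) (cmp u (Some a)))) \<in> X"
proof -
  let ?p = "D (Some a) (cmp u (Some a))"
  have 1: "\<eta> a u \<in> X" using \<eta>_X[OF u, of a "mon 0 {}"] by (simp add: Mt_one)
  \<comment> \<open>On the diagonal both summands of the contraction coincide, whence the factor 2,
    removed by \<open>h\<close>.\<close>
  have 2: "cmp (\<eta> a u) (Some a) = sm 2 ?p"
    using vs.scale_left_distrib[of 1 1 ?p] by (simp add: cmp_\<eta>[OF u])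
  have h: "sv j v \<in> X" if "sv j (sm 2 v) \<in> X" for j v
    using X_scale[OF that, of "1/2"] by simp
  show "sv None (M g (\<sigma> ?p)) \<in> X"
    using extract_t[OF 1 \<eta>_X[OF u] g] by - (rule h, simp add: 2 \<sigma>_lin M_lin)
  show "c \<noteq> a \<Longrightarrow> sv (Some c) (M g ?p) \<in> X"
    using extract_xi[OF 1 \<eta>_X[OF u] g, of c] by - (rule h, simp add: 2 M_lin)
qed

lemma Pi_sv: "Pi (sv None v) = - sv None (\<sigma> v)"
proof (rule Deg_1_eqI)
  show "Pi (sv None v) \<in> Deg 1" unfolding Pi_def by (rule B_Deg) (auto simp: ppar_single H_Deg dg_V intro!: single_Deg)
  show "- sv None (\<sigma> v) \<in> Deg 1" by (simp add: ts.subspace_neg[OF Deg_subspace])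
  fix j :: "'n option"
  obtain a x where ax: "V j = (a, x)" by (cases "V j")
  have "cmp (Pi (sv None v)) j = sm (ksign x) (\<sigma> (cmp (sv None v) j))"
    unfolding ax by (rule cf_Pi)
  then show "cmp (Pi (sv None v)) j = cmp (- sv None (\<sigma> v)) j"
  proof -
    have "x = (if j = None then 1 else 0)" using ax by (cases j) (auto simp: V_def)
    with \<open>cmp (Pi (sv None v)) j = sm (ksign x) (\<sigma> (cmp (sv None v) j))\<close> show ?thesis
      by (simp add: cmp_sv \<sigma>_lin)
  qed
qed

lemma L_sv:
  "L g (Some a) (sv None v) = sv None (M g (D (Some a) v))"
  "L (mon 0 {}) None (sv None v) = sv None (D None v)"
  "L (mon 0 {l}) None (sv (Some a) v) = sv (Some a) (M (mon 0 {l}) (D None v))"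
proof -
  show "L g (Some a) (sv None v) = sv None (M g (D (Some a) v))"
  proof (rule Deg_1_eqI)
    show "cmp (L g (Some a) (sv None v)) j = cmp (sv None (M g (D (Some a) v))) j" for j
      by (cases j) (simp_all add: cmp_L_Some cmp_sv \<sigma>_lin M_lin D_lin)
  qed (simp_all add: L_Deg)
  show "L (mon 0 {}) None (sv None v) = sv None (D None v)"
  proof (rule Deg_1_eqI)
    show "cmp (L (mon 0 {}) None (sv None v)) j = cmp (sv None (D None v)) j" for j
      by (cases j) (simp_all add: cmp_L_None cmp_sv \<sigma>_lin M_lin D_lin lau_sigma_mon)
  qed (simp_all add: L_Deg)
  show "L (mon 0 {l}) None (sv (Some a) v) = sv (Some a) (M (mon 0 {l}) (D None v))"
  proof (rule Deg_1_eqI)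
    show "cmp (L (mon 0 {l}) None (sv (Some a) v)) j = cmp (sv (Some a) (M (mon 0 {l}) (D None v))) j" for j
      by (cases j) (simp_all add: cmp_L_None cmp_sv \<sigma>_lin M_lin D_lin)
  qed (simp_all add: L_Deg)
qed

text \<open>The field xi_l d/dt maps p dt to a multiple of dt plus a d xi_l term carrying p up to
  the twist, so all components become reachable.\<close>

lemma full_if_sv_None:
  assumes "\<And>p. sv None p \<in> X"
  shows "X = Deg 1"
proof -
  have "sv (Some l) p \<in> X" for l p
  proof -
    have "L (mon 0 {l}) None (sv None (\<sigma> p)) = sv None (M (mon 0 {l}) (D None (\<sigma> p))) + sv (Some l) p"
    proof (rule Deg_1_eqI)
      fix j
      show "cmp (L (mon 0 {l}) None (sv None (\<sigma> p))) j = cmp (sv None (M (mon 0 {l}) (D None (\<sigma> p))) + sv (Some l) p) j"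
      proof (cases j)
        case None
        then show ?thesis by (simp add: cmp_L_None cmp_sv lookup_add)
      next
        case (Some s)
        have "d_xi s (mon 0 {l}) = (if s = l then mon 0 {} else 0)" by simp
        then show ?thesis using Some
          by (simp add: cmp_L_None cmp_sv lookup_add D_lin M_lin lau_sigma_mon clin_minus[OF clin_d_xi] M_minus_left)
      qed
    qed (simp_all add: L_Deg ts.subspace_add[OF Deg_subspace])
    then have "sv (Some l) p = L (mon 0 {l}) None (sv None (\<sigma> p)) - sv None (M (mon 0 {l}) (D None (\<sigma> p)))" by simp
    then show ?thesis using L_t[OF assms] assms X_diff by simp
  qed
  with assms have "sv j p \<in> X" for j p by (cases j) simp_all
  then have "Deg 1 \<subseteq> X"
    using Deg_1_expand ts.subspace_sum[OF X_sub] by (metis (no_types, lifting) subsetI)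
  with X_Deg show ?thesis by blast
qed

lemma split_M:
  "M f q = M (d_xi i (amult (lau_sigma f) (mon 0 {i}))) q - M (d_xi i (lau_sigma f)) (M (mon 0 {i}) q)"
  using mon_split[of f i] by (metis M_diff_left M_M)

text \<open>Diagonal forms come only with coefficients killed by \<open>d_xi a\<close>. Passing
  through p d xi_s gives dt-forms with coefficients killed by \<open>d_xi s\<close>, and the
  splitting along xi_s then reaches all f, at the cost of replacing p by D_s p. Hence the hypothesis
  that D_s p is nonzero.\<close>

lemma full_if_mixed:
  assumes u: "u \<in> X" and "s \<noteq> a" and nz: "D (Some s) (D (Some a) (cmp u (Some a))) \<noteq> 0"
  shows "X = Deg 1"
proof -
  let ?p = "D (Some a) (cmp u (Some a))"
  define Q where "Q = {q. \<forall>f. sv None (M f q) \<in> X}"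
  have "sv (Some s) (M g ?p) \<in> X" if "d_xi a g = 0" for g
    using diagonal_forms(2)[OF u that \<open>s \<noteq> a\<close>] .
  from this[of "mon 0 {}"] this[of "mon 1 {}"]
  have 1: "sv (Some s) ?p \<in> X" "Mt (mon 1 {}) (sv (Some s) ?p) \<in> X" by simp_all
  have 2: "sv None (M g (\<sigma> ?p)) \<in> X" if "d_xi s g = 0" for g
    using extract_t[OF 1 that] by (simp add: cmp_sv)
  \<comment> \<open>The coefficient xi_s is killed by \<open>d_xi a\<close>, though not by
    \<open>d_xi s\<close>; \<open>2\<close> does not cover it.\<close>
  have 3: "sv None (M (mon 0 {s}) (\<sigma> ?p)) \<in> X"
    using diagonal_forms(1)[OF u, of a "mon 0 {s}"] \<open>s \<noteq> a\<close> by simp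
  \<comment> \<open>Applying g d_s to the form in \<open>3\<close> gives g p minus g xi_s D_s p, up
    to the twist; since the g p form is known from \<open>2\<close>, the second one is isolated. It
    supplies the xi_s-term of the splitting of f.\<close>
  have 4: "sv None (M g (M (mon 0 {s}) (D (Some s) (\<sigma> ?p)))) \<in> X" if "d_xi s g = 0" for g
  proof -
    have "sv None (M g (D (Some s) (M (mon 0 {s}) (\<sigma> ?p)))) \<in> X"
      using L_xi[OF 3 that] by (simp add: L_sv)
    moreover have "M g (D (Some s) (M (mon 0 {s}) (\<sigma> ?p))) = M g (\<sigma> ?p) - M g (M (mon 0 {s}) (D (Some s) (\<sigma> ?p)))"
    proof -
      have "D (Some s) (M (mon 0 {s}) (\<sigma> ?p)) = \<sigma> ?p - M (mon 0 {s}) (D (Some s) (\<sigma> ?p))"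
        using D_xi_M_xi[of s "\<sigma> ?p"] by (simp only: eq_diff_eq)
      then show ?thesis by (simp only: M_lin(3))
    qed
    ultimately have "sv None (M g (\<sigma> ?p)) - (sv None (M g (\<sigma> ?p)) - sv None (M g (M (mon 0 {s}) (D (Some s) (\<sigma> ?p))))) \<in> X"
      using X_diff[OF 2[OF that]] by (simp only: single_diff)
    then show ?thesis by simp
  qed
  have 5: "sv None (M g (D (Some s) (\<sigma> ?p))) \<in> X" if "d_xi s g = 0" for g
    using L_xi[OF 2[of "mon 0 {}"] that] by (simp add: L_sv)
  have "sv None (M f (D (Some s) (\<sigma> ?p))) \<in> X" for f
    by (subst split_M[of f _ s]) (simp add: single_diff X_diff 4 5)
  then have "D (Some s) (\<sigma> ?p) \<in> Q" by (simp add: Q_def)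
  moreover have "D (Some s) (\<sigma> ?p) \<noteq> 0"
  proof
    assume "D (Some s) (\<sigma> ?p) = 0"
    then have "\<sigma> (D (Some s) ?p) = 0" by (simp add: \<sigma>_D_simps)
    then have "\<sigma> (\<sigma> (D (Some s) ?p)) = 0" by (simp only: \<sigma>_lin)
    with nz show False by simp
  qed
  moreover have "Q = {0} \<or> Q = UNIV"
  proof (rule dichotomy)
    show "vs.subspace Q"
    proof (rule vs.subspaceI)
      show "0 \<in> Q" using ts.subspace_0[OF X_sub] by (simp add: Q_def M_lin)
      show "q + r \<in> Q" if "q \<in> Q" "r \<in> Q" for q r
        using that X_add by (simp add: Q_def M_lin single_add)
      show "sm c q \<in> Q" if "q \<in> Q" for c q
        using that X_scale by (auto simp: Q_def M_lin simp flip: tscale_single)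
    qed
  next
    fix q assume q: "q \<in> Q"
    have "sv None (M f (\<sigma> q)) = - Pi (sv None (M (lau_sigma f) q))" for f
      by (simp add: Pi_sv \<sigma>_M)
    then show "\<sigma> q \<in> Q" using q X_Pi X_neg by (simp add: Q_def)
  next
    fix f q assume "q \<in> Q"
    then show "M f q \<in> Q" by (simp add: Q_def M_M)
  next
    fix k q assume q: "q \<in> Q"
    have "sv None (D k v) \<in> X" if "sv None v \<in> X" for v
      using L_xi[OF that, of _ "mon 0 {}"] L_d_t[OF that] by (cases k) (simp_all add: L_sv)
    moreover have "M f (D k q) = D k (M (lsig k f) q) - M (d_var k (lsig k f)) q" for f
      by (simp add: D_M)
    ultimately show "D k q \<in> Q" using q by (simp add: Q_def single_diff X_diff)
  qed
  ultimately have "Q = UNIV" by auto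
  then have "sv None p \<in> X" for p
    using M_one unfolding Q_def by (metis (mono_tags, lifting) UNIV_I mem_Collect_eq)
  then show ?thesis by (rule full_if_sv_None)
qed

text \<open>If all diagonal terms vanish on \<open>X\<close>, apply this to xi_b d_a u and to xi_b
  d/dt u, which also lie in \<open>X\<close>: their diagonal terms at b are the off-diagonal and the
  dt-components of du. So u would be closed.\<close>

lemma ex_diagonal:
  assumes u: "u \<in> X" "diff P u \<noteq> 0"
  shows "\<exists>w\<in>X. \<exists>a. D (Some a) (cmp w (Some a)) \<noteq> 0"
proof (rule ccontr)
  assume "\<not> ?thesis"
  then have z: "D (Some a) (cmp w (Some a)) = 0" if "w \<in> X" for w a using that by blast
  have anti: "D (Some b) (D (Some a) v) = - D (Some a) (D (Some b) v)" for a b v by (rule D_D_simps)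
  have "diff P u = 0"
  proof (rule diff_zeroI)
    show "u \<in> Deg 1" using u(1) by (rule Deg_X)
    show "D (Some a) (cmp u (Some b)) + D (Some b) (cmp u (Some a)) = 0" for a b
    proof (cases "a = b")
      case True
      then show ?thesis using z[OF u(1)] by simp
    next
      case False
      then have "L (mon 0 {b}) (Some a) u \<in> X" using u by (intro L_xi) simp_all
      from z[OF this, of b] show ?thesis
        using anti[of b a "cmp u (Some b)"] z[OF u(1), of b]
        by (simp add: cmp_L_Some Deg_X' u D_lin D_M M_lin lau_sigma_mon clin_minus[OF clin_d_xi] M_minus_left)
    qed
    show "D (Some b) (cmp u None) = D None (\<sigma> (cmp u (Some b)))" for b
    proof -
      have "D None (cmp u (Some b)) + D (Some b) (\<sigma> (cmp u None)) = 0"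
        using z[OF L_t[OF u(1)], of b b] D_D_simps(1)[of b "cmp u (Some b)"] z[OF u(1), of b]
        by (simp add: cmp_L_None Deg_X' u D_lin D_M M_lin lau_sigma_mon clin_minus[OF clin_d_xi] M_minus_left)
      then have "\<sigma> (D None (cmp u (Some b)) + D (Some b) (\<sigma> (cmp u None))) = 0" by (simp only: \<sigma>_lin)
      then show ?thesis by (simp add: \<sigma>_lin \<sigma>_D_simps)
    qed
  qed
  with u show False by simp
qed

theorem full:
  assumes u: "u \<in> X" "diff P u \<noteq> 0"
  shows "X = Deg 1"
proof (rule ccontr)
  assume "X \<noteq> Deg 1"
  then have z: "D (Some s) (D (Some a) (cmp w (Some a))) = 0" if "w \<in> X" "s \<noteq> a" for w s a
    using full_if_mixed that by blast
  obtain w a where w: "w \<in> X" and nz: "D (Some a) (cmp w (Some a)) \<noteq> 0"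
    using ex_diagonal[OF u] by blast
  obtain s where sa: "s \<noteq> a" using ex_other[OF n] by blast
  define p where "p = D (Some a) (cmp w (Some a))"
  have Dp: "D (Some a) p = 0" "D (Some s) p = 0" using z[OF w sa] by (simp_all add: p_def)
  \<comment> \<open>The coefficient xi_s is chosen so that the diagonal term at s of this new form
    is p again. \<open>diagonal_forms\<close> then applies with s in place of a, which admits
    coefficients containing xi_a.\<close>
  have 1: "sv (Some s) (M (mon 0 {s}) p) \<in> X"
    using diagonal_forms(2)[OF w, of a "mon 0 {s}" s] sa by (simp add: p_def)
  have sp: "D (Some s) (M (mon 0 {s}) p) = p"
    using D_xi_M_xi[of s p] by (simp add: Dp M_lin)
  have 2: "sv (Some a) (M (mon k {a}) p) \<in> X" for k
    using diagonal_forms(2)[OF 1, of s "mon k {a}" a] sa by (simp add: cmp_sv sp d_xi_mon)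
  \<comment> \<open>The field xi_s d/dt turns the form in \<open>2\<close> into xi_s xi_a q d xi_a,
    with q the vector to be shown zero. The mixed derivative D_s D_a of its component is q up to
    sign, and \<open>z\<close> forces it to vanish.\<close>
  have r: "D None (M (mon k {}) p) = 0" for k
  proof -
    define q where "q = D None (M (mon k {}) p)"
    have "M (mon k {a}) p = M (mon 0 {a}) (M (mon k {}) p)" by (simp add: M_M amult_mon)
    then have e: "D None (M (mon k {a}) p) = M (mon 0 {a}) q" by (simp add: q_def D_M)
    have Dq: "D (Some b) q = 0" if "D (Some b) p = 0" for b
      using that unfolding q_def by (simp add: D_D_simps(1)[symmetric] D_M[of "Some b"] M_lin D_lin)
    have "sv (Some a) (M (mon 0 {s}) (M (mon 0 {a}) q)) \<in> X"
      using L_t[OF 2[of k], of s] by (simp only: L_sv e)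
    from z[OF this sa] have "D (Some s) (D (Some a) (M (mon 0 {s}) (M (mon 0 {a}) q))) = 0"
      by (simp add: cmp_sv)
    moreover have "D (Some a) (M (mon 0 {s}) (M (mon 0 {a}) q)) = - M (mon 0 {s}) q"
      using sa Dq[OF Dp(1)] by (simp add: D_M lau_sigma_mon M_minus_left M_lin)
    moreover have "D (Some s) (M (mon 0 {s}) q) = q"
      using D_xi_M_xi[of s q] by (simp add: Dq[OF Dp(2)] M_lin)
    ultimately show ?thesis by (simp add: D_lin flip: q_def)
  qed
  \<comment> \<open>k = 0 gives D_t p = 0, and k = 1 gives p + t D_t p = 0.\<close>
  have "p = 0"
    using r[of 0] r[of 1] by (simp add: D_M M_lin)
  with nz show False by (simp add: p_def)
qed

end


section \<open>Submodules, quotients and isomorphisms\<close>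

lemma submod_restr:
  assumes "X \<subseteq> carrier M"
  shows "submod G (restr M X) N \<longleftrightarrow> N \<subseteq> X \<and> submod G M N"
proof -
  have "(\<forall>v\<in>N. \<exists>v0\<in>N \<inter> part (restr M X) 0. \<exists>v1\<in>N \<inter> part (restr M X) 1. v = add M v0 v1)
      \<longleftrightarrow> (\<forall>v\<in>N. \<exists>v0\<in>N \<inter> part M 0. \<exists>v1\<in>N \<inter> part M 1. v = add M v0 v1)" if "N \<subseteq> X"
  proof -
    have "N \<inter> part (restr M X) p = N \<inter> part M p" for p using that by (auto simp: restr_def)
    then show ?thesis by simp
  qed
  then show ?thesis using assms unfolding submod_def by (simp add: restr_def) blast
qed

lemma restr_simps [simp]: "carrier (restr M X) = X" "add (restr M X) = add M" "zero (restr M X) = zero M"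
  "smult (restr M X) = smult M" "act (restr M X) = act M" "part (restr M X) p = part M p \<inter> X"
  by (simp_all add: restr_def)

text \<open>The isomorphism is \<open>\<psi> \<circ> d\<^sup>-\<^sup>1\<close>, for maps \<open>d\<close> and \<open>\<psi>\<close> out of \<open>S\<close> with the same kernel.\<close>

lemma iso_modI:
  assumes d: "d ` carrier S = carrier M" and \<psi>: "\<psi> ` carrier S = carrier M'"
    and inj: "\<And>u v. u \<in> carrier S \<Longrightarrow> v \<in> carrier S \<Longrightarrow> d u = d v \<longleftrightarrow> \<psi> u = \<psi> v"
    and add: "\<And>u v. u \<in> carrier S \<Longrightarrow> v \<in> carrier S \<Longrightarrow> add S u v \<in> carrier S"
      "\<And>u v. u \<in> carrier S \<Longrightarrow> v \<in> carrier S \<Longrightarrow> d (add S u v) = add M (d u) (d v)"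
      "\<And>u v. u \<in> carrier S \<Longrightarrow> v \<in> carrier S \<Longrightarrow> \<psi> (add S u v) = add M' (\<psi> u) (\<psi> v)"
    and smult: "\<And>c u. u \<in> carrier S \<Longrightarrow> smult S c u \<in> carrier S"
      "\<And>c u. u \<in> carrier S \<Longrightarrow> d (smult S c u) = smult M c (d u)"
      "\<And>c u. u \<in> carrier S \<Longrightarrow> \<psi> (smult S c u) = smult M' c (\<psi> u)"
    and part: "\<And>p w. w \<in> part M p \<Longrightarrow> \<exists>u\<in>carrier S. d u = w \<and> \<psi> u \<in> part M' (p + e)"
    and act: "\<And>p x u. x \<in> G p \<Longrightarrow> u \<in> carrier S \<Longrightarrow>
      \<exists>u'\<in>carrier S. act M x (d u) = d u' \<and> \<psi> u' = smult M' (ksign (p * e)) (act M' x (\<psi> u))"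
  shows "iso_mod G M M'"
proof -
  define h where "h w = \<psi> (SOME u. u \<in> carrier S \<and> d u = w)" for w
  have h: "h (d u) = \<psi> u" if "u \<in> carrier S" for u
  proof -
    have "(SOME u'. u' \<in> carrier S \<and> d u' = d u) \<in> carrier S \<and> d (SOME u'. u' \<in> carrier S \<and> d u' = d u) = d u"
      by (rule someI_ex) (use that in blast)
    then show ?thesis using inj that unfolding h_def by blast
  qed
  have "bij_betw h (carrier M) (carrier M')"
  proof (rule bij_betwI')
    show "h x = h y \<longleftrightarrow> x = y" if "x \<in> carrier M" "y \<in> carrier M" for x y
      using that unfolding d [symmetric] by (auto simp: h inj)
    show "h x \<in> carrier M'" if "x \<in> carrier M" for x
      using that unfolding d [symmetric] \<psi> [symmetric] by (auto simp: h)
    show "\<exists>x\<in>carrier M. y = h x" if "y \<in> carrier M'" for y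
      using that unfolding d [symmetric] \<psi> [symmetric] by (auto simp: h)
  qed
  moreover have "h (add M u v) = add M' (h u) (h v)" if "u \<in> carrier M" "v \<in> carrier M" for u v
  proof -
    from that obtain u' v' where "u' \<in> carrier S" "u = d u'" "v' \<in> carrier S" "v = d v'"
      unfolding d [symmetric] by blast
    then show ?thesis using add by (simp add: h flip: add(2))
  qed
  moreover have "h (smult M c v) = smult M' c (h v)" if "v \<in> carrier M" for c v
  proof -
    from that obtain v' where "v' \<in> carrier S" "v = d v'" unfolding d [symmetric] by blast
    then show ?thesis using smult by (simp add: h flip: smult(2))
  qed
  moreover have "h ` part M p \<subseteq> part M' (p + e)" for p
    using part[of _ p] h by fastforce
  moreover have "h (act M x v) = smult M' (ksign (p * e)) (act M' x (h v))" if "x \<in> G p" "v \<in> carrier M" for p x v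
  proof -
    from that obtain v' where v': "v' \<in> carrier S" "v = d v'" unfolding d [symmetric] by blast
    then show ?thesis using act[OF that(1) v'(1)] by (auto simp: h)
  qed
  ultimately show ?thesis unfolding iso_mod_def by blast
qed

text \<open>The quotient by zero consists of singletons and so lives in another type; submodules are
  transported along q \<mapsto> {q}.\<close>

lemma simple_quot_zero:
  assumes M: "\<And>q. q \<in> carrier M \<Longrightarrow> add M q (zero M) = q" and s: "simple_mod G (quot M {zero M})"
    and part: "\<And>p. part M p \<subseteq> carrier M"
    and N: "submod G M N"
  shows "N = {zero M} \<or> N = carrier M"
proof -
  let ?N = "(\<lambda>q. {q}) ` N"
  have NM: "N \<subseteq> carrier M" using N by (simp add: submod_def)
  have cs: "coset M {zero M} q = {q}" if "q \<in> carrier M" for q using M[OF that] by (simp add: coset_def)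
  have "submod G (quot M {zero M}) ?N"
    unfolding submod_def
  proof (intro conjI ballI allI)
    show "?N \<subseteq> carrier (quot M {zero M})" using NM cs by (force simp: quot_def)
    show "zero (quot M {zero M}) \<in> ?N" using N by (auto simp: quot_def submod_def)
    show "add (quot M {zero M}) u v \<in> ?N" if "u \<in> ?N" "v \<in> ?N" for u v
      using that N by (auto simp: quot_def submod_def)
    show "smult (quot M {zero M}) c v \<in> ?N" if "v \<in> ?N" for c v
    proof -
      from that obtain q where q: "q \<in> N" "v = {q}" by blast
      then have "smult M c q \<in> N" using N by (simp add: submod_def)
      then show ?thesis using q NM cs[of "smult M c q"] by (auto simp: quot_def)
    qed
    show "act (quot M {zero M}) x v \<in> ?N" if "x \<in> G" "v \<in> ?N" for x v
    proof -
      from that obtain q where q: "q \<in> N" "v = {q}" by blast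
      then have "act M x q \<in> N" using N that by (simp add: submod_def)
      then show ?thesis using q NM cs[of "act M x q"] by (auto simp: quot_def)
    qed
    show "\<exists>v0\<in>?N \<inter> part (quot M {zero M}) 0. \<exists>v1\<in>?N \<inter> part (quot M {zero M}) 1. v = add (quot M {zero M}) v0 v1"
      if "v \<in> ?N" for v
    proof -
      from that obtain q where q: "q \<in> N" "v = {q}" by blast
      then obtain q0 q1 where q01: "q0 \<in> N" "q0 \<in> part M 0" "q1 \<in> N" "q1 \<in> part M 1" "q = add M q0 q1"
        using N unfolding submod_def by blast
      have "{q0} \<in> part (quot M {zero M}) 0" "{q1} \<in> part (quot M {zero M}) 1"
        using q01 NM cs[of q0] cs[of q1] by (force simp: quot_def)+
      moreover have "v = add (quot M {zero M}) {q0} {q1}" using q q01 by (simp add: quot_def)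
      ultimately show ?thesis using q01 by blast
    qed
  qed
  then have "?N = {{zero M}} \<or> ?N = carrier (quot M {zero M})"
    using s unfolding simple_mod_def by (simp add: quot_def)
  then show ?thesis
  proof
    assume "?N = {{zero M}}"
    then have "N = {zero M}" by auto
    then show ?thesis ..
  next
    assume e: "?N = carrier (quot M {zero M})"
    have "q \<in> N" if "q \<in> carrier M" for q
    proof -
      have "{q} \<in> ?N" unfolding e using that cs[OF that] by (force simp: quot_def)
      then show ?thesis by auto
    qed
    with NM show ?thesis by blast
  qed
qed

text \<open>A common interface for \<open>P\<close>, the tensor product, \<open>F_mod\<close> and
  the closed forms, so that the correspondence between submodules of a module and of its quotient is
  proved only once.\<close>

locale graded_module = graded_space scale par prt
  for scale :: "complex \<Rightarrow> 'v::ab_group_add \<Rightarrow> 'v" and par prt +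
  fixes Mod :: "('x, 'v) smod" and G :: "'x set"
  assumes add_eq: "add Mod = (+)" and zero_eq: "zero Mod = 0" and smult_eq: "smult Mod = scale"
    and part_eq: "part Mod p = prt p \<inter> carrier Mod"
    and carrier_subspace: "subspace (carrier Mod)"
    and carrier_par: "v \<in> carrier Mod \<Longrightarrow> par v \<in> carrier Mod"
    and act_carrier: "x \<in> G \<Longrightarrow> v \<in> carrier Mod \<Longrightarrow> act Mod x v \<in> carrier Mod"
    and act_add: "x \<in> G \<Longrightarrow> u \<in> carrier Mod \<Longrightarrow> v \<in> carrier Mod \<Longrightarrow> act Mod x (u + v) = act Mod x u + act Mod x v"
begin

lemmas eqs = add_eq zero_eq smult_eq

lemma submod_iff:
  "submod G Mod N \<longleftrightarrow> N \<subseteq> carrier Mod \<and> subspace N \<and> (\<forall>v\<in>N. par v \<in> N) \<and> (\<forall>x\<in>G. \<forall>v\<in>N. act Mod x v \<in> N)"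
proof -
  have "(\<forall>v\<in>N. \<exists>v0\<in>N \<inter> part Mod 0. \<exists>v1\<in>N \<inter> part Mod 1. v = add Mod v0 v1)
      \<longleftrightarrow> (\<forall>v\<in>N. \<exists>v0\<in>N \<inter> prt 0. \<exists>v1\<in>N \<inter> prt 1. v = v0 + v1)" if "N \<subseteq> carrier Mod"
    using that unfolding part_eq add_eq by blast
  then show ?thesis
    using graded_iff[of N] unfolding submod_def eqs subspace_def by blast
qed

context
  fixes N assumes N: "submod G Mod N"
begin

lemma N_props: "N \<subseteq> carrier Mod" "subspace N" "v \<in> N \<Longrightarrow> par v \<in> N" "x \<in> G \<Longrightarrow> v \<in> N \<Longrightarrow> act Mod x v \<in> N"
  using N by (auto simp: submod_iff)

abbreviation "cst \<equiv> coset Mod N"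

lemma in_cst: "w \<in> cst v \<longleftrightarrow> w - v \<in> N"
  unfolding coset_def add_eq by (auto intro: image_eqI[of _ _ "w - v"])

lemma cst_eq: "cst u = cst v \<longleftrightarrow> u - v \<in> N"
proof
  assume "cst u = cst v"
  moreover have "u \<in> cst u" using subspace_0[OF N_props(2)] by (simp add: in_cst)
  ultimately show "u - v \<in> N" by (simp add: in_cst)
next
  assume uv: "u - v \<in> N"
  have "w - u \<in> N \<longleftrightarrow> w - v \<in> N" for w
    using subspace_add[OF N_props(2) _ uv, of "w - u"] subspace_diff[OF N_props(2) _ uv, of "w - v"] by auto
  then show "cst u = cst v" by (auto simp: in_cst)
qed

lemma cst_N: "v \<in> N \<Longrightarrow> cst v = N"
  using cst_eq[of v 0] by (auto simp: in_cst set_eq_iff)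

lemma cst_eq_N: "cst v = N \<longleftrightarrow> v \<in> N"
  using cst_eq[of v 0] cst_N[OF subspace_0[OF N_props(2)]] by simp

lemma cst_self: "v \<in> cst v"
  using subspace_0[OF N_props(2)] by (simp add: in_cst)

lemma quot_carrier: "carrier (quot Mod N) = cst ` carrier Mod"
  and quot_zero: "zero (quot Mod N) = N"
  and quot_part: "part (quot Mod N) p = cst ` part Mod p"
  by (simp_all add: quot_def)

lemma quot_add: "add (quot Mod N) (cst u) (cst v) = cst (u + v)"
proof (intro set_eqI iffI)
  fix w assume "w \<in> add (quot Mod N) (cst u) (cst v)"
  then obtain a b where ab: "a - u \<in> N" "b - v \<in> N" "w = a + b"
    by (auto simp: quot_def add_eq in_cst)
  then have "(a - u) + (b - v) \<in> N" using subspace_add[OF N_props(2)] by blast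
  then show "w \<in> cst (u + v)" by (simp add: in_cst ab algebra_simps)
next
  fix w assume "w \<in> cst (u + v)"
  then have "w - v \<in> cst u" by (simp add: in_cst algebra_simps)
  then have "\<exists>a b. w = a + b \<and> a \<in> cst u \<and> b \<in> cst v"
    using cst_self[of v] by (intro exI[of _ "w - v"] exI[of _ v]) simp
  then show "w \<in> add (quot Mod N) (cst u) (cst v)"
    by (simp add: quot_def add_eq)
qed

lemma quot_smult: "smult (quot Mod N) c (cst v) = cst (scale c v)"
proof -
  have "cst (smult Mod c a) = cst (scale c v)" if "a \<in> cst v" for a
    using that subspace_scale[OF N_props(2), of "a - v" c] by (simp add: cst_eq in_cst smult_eq scale_right_diff_distrib)
  then show ?thesis using cst_self by (auto simp: quot_def)
qed

lemma quot_act: "x \<in> G \<Longrightarrow> v \<in> carrier Mod \<Longrightarrow> act (quot Mod N) x (cst v) = cst (act Mod x v)"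
proof -
  assume x: "x \<in> G" and v: "v \<in> carrier Mod"
  have "cst (act Mod x a) = cst (act Mod x v)" if "a \<in> cst v" for a
  proof -
    have a: "a - v \<in> N" using that by (simp add: in_cst)
    then have "act Mod x (v + (a - v)) = act Mod x v + act Mod x (a - v)"
      using N_props(1) x v by (intro act_add) auto
    then show ?thesis using N_props(4)[OF x a] by (simp add: cst_eq)
  qed
  then have "(\<Union>a\<in>cst v. cst (act Mod x a)) = (\<Union>a\<in>cst v. cst (act Mod x v))"
    by (intro SUP_cong refl)
  also have "\<dots> = cst (act Mod x v)" using cst_self[of v] by blast
  finally show ?thesis by (simp add: quot_def)
qed

lemma quot_preimage:
  assumes Y: "submod G (quot Mod N) Y"
  defines "X \<equiv> {v \<in> carrier Mod. cst v \<in> Y}"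
  shows "submod G Mod X" "N \<subseteq> X" "Y = cst ` X"
proof -
  have Y1: "Y \<subseteq> cst ` carrier Mod" and Y2: "N \<in> Y"
    using Y by (simp_all add: submod_def quot_carrier quot_zero)
  have Y3: "cst (u + v) \<in> Y" if "cst u \<in> Y" "cst v \<in> Y" for u v
  proof -
    have "add (quot Mod N) (cst u) (cst v) \<in> Y" using Y that by (simp add: submod_def)
    then show ?thesis by (simp only: quot_add)
  qed
  have Y4: "cst (scale c v) \<in> Y" if "cst v \<in> Y" for c v
  proof -
    have "smult (quot Mod N) c (cst v) \<in> Y" using Y that by (simp add: submod_def)
    then show ?thesis by (simp only: quot_smult)
  qed
  have Y5: "cst (act Mod x v) \<in> Y" if "x \<in> G" "v \<in> carrier Mod" "cst v \<in> Y" for x v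
  proof -
    have "act (quot Mod N) x (cst v) \<in> Y" using Y that by (simp add: submod_def)
    then show ?thesis using that by (simp only: quot_act)
  qed
  note Y' = Y1 Y2 Y3 Y4 Y5
  show NX: "N \<subseteq> X" using N_props(1) cst_N Y'(2) by (auto simp: X_def)
  show "Y = cst ` X" using Y'(1) by (auto simp: X_def)
  have sub: "subspace X"
  proof (rule subspaceI)
    show "0 \<in> X" using NX subspace_0[OF N_props(2)] by blast
    show "u + v \<in> X" if "u \<in> X" "v \<in> X" for u v
      using that Y3 subspace_add[OF carrier_subspace] by (simp add: X_def)
    show "scale c v \<in> X" if "v \<in> X" for c v
      using that Y4 subspace_scale[OF carrier_subspace] by (simp add: X_def)
  qed
  show "submod G Mod X"
    unfolding submod_iff
  proof (intro conjI ballI sub)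
    show "X \<subseteq> carrier Mod" by (auto simp: X_def)
    show "act Mod x v \<in> X" if "x \<in> G" "v \<in> X" for x v
      using that Y'(5) act_carrier by (auto simp: X_def)
    fix v assume v: "v \<in> X"
    then have "cst v \<in> Y" by (simp add: X_def)
    then have "\<exists>v0\<in>Y \<inter> part (quot Mod N) 0. \<exists>v1\<in>Y \<inter> part (quot Mod N) 1. cst v = add (quot Mod N) v0 v1"
      using Y by (simp add: submod_def)
    then obtain A0 A1 where A: "A0 \<in> Y" "A0 \<in> cst ` part Mod 0" "A1 \<in> Y" "A1 \<in> cst ` part Mod 1" "cst v = add (quot Mod N) A0 A1"
      unfolding quot_part by blast
    then obtain v0 v1 where v01: "v0 \<in> part Mod 0" "cst v0 \<in> Y" "v1 \<in> part Mod 1" "cst v1 \<in> Y" "cst v = cst (v0 + v1)"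
      by (auto simp: quot_add)
    then have "v0 \<in> X" "v1 \<in> X" "v - (v0 + v1) \<in> N" "par v0 = v0" "par v1 = - v1"
      by (auto simp: part_eq X_def cst_eq prt_iff)
    \<comment> \<open>Homogeneous representatives recover v only modulo N; the error lies in N,
      which is stable under \<open>par\<close> and contained in X.\<close>
    moreover have "par v = par v0 + par v1 + par (v - (v0 + v1))"
      by (simp add: par_diff par_add)
    ultimately show "par v \<in> X"
      using subspace_add[OF sub subspace_add[OF sub]] subspace_neg[OF sub] NX N_props(3) by (metis subsetD)
  qed
qed

lemma quot_image:
  assumes X: "submod G Mod X"
  shows "submod G (quot Mod N) (cst ` X)"
proof -
  have X': "X \<subseteq> carrier Mod" "subspace X" "\<And>v. v \<in> X \<Longrightarrow> par v \<in> X" "\<And>x v. x \<in> G \<Longrightarrow> v \<in> X \<Longrightarrow> act Mod x v \<in> X"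
    using X by (auto simp: submod_iff)
  show ?thesis
    unfolding submod_def quot_carrier quot_zero quot_part
  proof (intro conjI ballI allI)
    show "cst ` X \<subseteq> cst ` carrier Mod" using X' by blast
    show "N \<in> cst ` X" using subspace_0[OF X'(2)] cst_N[OF subspace_0[OF N_props(2)]] by force
    show "add (quot Mod N) u v \<in> cst ` X" if "u \<in> cst ` X" "v \<in> cst ` X" for u v
      using that subspace_add[OF X'(2)] by (auto simp: quot_add)
    show "smult (quot Mod N) c v \<in> cst ` X" if "v \<in> cst ` X" for c v
      using that subspace_scale[OF X'(2)] by (auto simp: quot_smult)
    show "act (quot Mod N) x v \<in> cst ` X" if "x \<in> G" "v \<in> cst ` X" for x v
    proof -
      from that obtain w where w: "w \<in> X" "v = cst w" by blast
      then show ?thesis using X'(1) X'(4)[OF that(1)] quot_act[OF that(1), of w] by auto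
    qed
    fix u assume "u \<in> cst ` X"
    then obtain v where v: "v \<in> X" "u = cst v" by blast
    then obtain v0 v1 where "v0 \<in> X" "v0 \<in> part Mod 0" "v1 \<in> X" "v1 \<in> part Mod 1" "v = v0 + v1"
      using X unfolding submod_def add_eq by blast
    then show "\<exists>v0\<in>cst ` X \<inter> cst ` part Mod 0. \<exists>v1\<in>cst ` X \<inter> cst ` part Mod 1. u = add (quot Mod N) v0 v1"
      unfolding v(2) by (intro bexI[of _ "cst v0"] bexI[of _ "cst v1"]) (simp_all add: quot_add)
  qed
qed

lemma simple_quotI:
  assumes "\<And>X. submod G Mod X \<Longrightarrow> N \<subseteq> X \<Longrightarrow> X = N \<or> X = carrier Mod" "N \<noteq> carrier Mod"
  shows "simple_mod G (quot Mod N)"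
  unfolding simple_mod_def
proof (intro conjI allI impI)
  obtain v where "v \<in> carrier Mod" "v \<notin> N" using assms(2) N_props(1) by blast
  then show "\<exists>v\<in>carrier (quot Mod N). v \<noteq> zero (quot Mod N)"
    by (auto simp: quot_carrier quot_zero cst_eq_N)
  fix Y assume Y: "submod G (quot Mod N) Y"
  note pre = quot_preimage[OF Y]
  from assms(1)[OF pre(1,2)] show "Y = {zero (quot Mod N)} \<or> Y = carrier (quot Mod N)"
  proof
    assume "{v \<in> carrier Mod. cst v \<in> Y} = N"
    then have "Y = cst ` N" using pre(3) by simp
    then show ?thesis using cst_N subspace_0[OF N_props(2)] by (auto simp: quot_zero)
  next
    assume "{v \<in> carrier Mod. cst v \<in> Y} = carrier Mod"
    then show ?thesis using pre(3) by (simp add: quot_carrier)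
  qed
qed

lemma zero_or_trivial:
  assumes "\<And>x v. x \<in> G \<Longrightarrow> v \<in> carrier Mod \<Longrightarrow> act Mod x v \<in> N"
  shows "zero_mod (quot Mod N) \<or> trivial_mod G (quot Mod N)"
proof -
  have "act (quot Mod N) x (cst v) = N" if "x \<in> G" "v \<in> carrier Mod" for x v
    using that assms by (simp add: quot_act cst_eq_N)
  moreover have "N \<in> carrier (quot Mod N)"
    using subspace_0[OF carrier_subspace] cst_N[OF subspace_0[OF N_props(2)]] by (force simp: quot_carrier)
  ultimately show ?thesis
    unfolding zero_mod_def trivial_mod_def quot_carrier quot_zero by auto
qed

end

end


context weyl_mod
begin

lemma P_graded_module: "graded_module sm \<sigma> (part P) P S'_alg"
  by unfold_locales (auto intro: plin_add[OF act_linear] S'_alg_weyl)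

lemma pi_act_add: "pi_act P x (u + v) = pi_act P x u + pi_act P x v"
proof -
  have "\<iota>1 f j (u + v) = \<iota>1 f j u + \<iota>1 f j v" "\<iota>2 f j (u + v) = \<iota>2 f j u + \<iota>2 f j v" for f j u v
    by (cases j; simp add: \<iota>1_def \<iota>2_def St_lin Mt_lin B_lin)+
  then show ?thesis by (simp add: pi_act_cartan diff_lin sum.distrib)
qed

lemma Pi_Deg: "u \<in> Deg d \<Longrightarrow> Pi u \<in> Deg d"
  unfolding Pi_def by (rule B_Deg) (auto simp: ppar_single H_Deg intro!: single_Deg)

lemma F_graded_module: "graded_module (tscale P) Pi (part (tensor_mod P)) (F_mod P lam) S'_alg"
  by unfold_locales (auto simp: carrier_F Deg_subspace Pi_Deg pi_act_Deg pi_act_add)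

lemma tensor_graded_module: "graded_module (tscale P) Pi (part (tensor_mod P)) (tensor_mod P) S'_alg"
  by unfold_locales (auto simp: pi_act_add)

text \<open>Contractions kill zero-forms, so only the first term of \<pi> survives; this identifies
  F(P, N(0)) with \<open>P\<close>.\<close>

lemma pi_act_s0:
  assumes "x \<in> S'_alg"
  shows "pi_act P x (s0 u) = s0 (act P x u)"
proof -
  have s0L: "L f j (s0 u) = s0 (M f (D j u))" for f j
    by (cases j) (simp_all add: L_def \<iota>_Deg_0 H_Deg del: B_single)
  have "act P x u = (\<Sum>j\<in>UNIV. act P (vf (coef x j) j) u)"
    using W_alg_expand[OF S'_alg_W[OF assms]] act_sum[of UNIV "\<lambda>j. vf (coef x j) j" u] weyl_vf by metis
  then have "act P x u = (\<Sum>j\<in>UNIV. M (coef x j) (D j u))" by (simp add: act_vf)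
  moreover have "s0 (\<Sum>j\<in>S. g j) = (\<Sum>j\<in>S. s0 (g j))" for S and g :: "'n option \<Rightarrow> 'p"
    by (induction S rule: infinite_finite_induct) (simp_all add: single_add)
  ultimately show ?thesis by (simp add: pi_act_eq s0L)
qed

lemma Pi_s0: "Pi (s0 u) = s0 (\<sigma> u)"
  by (simp add: Pi_def V0_def ppar_single)

lemma Deg_0_range: "Deg 0 = range s0"
proof
  show "Deg 0 \<subseteq> range s0"
  proof
    fix u :: "'n pmon \<Rightarrow>\<^sub>0 'p" assume u: "u \<in> Deg 0"
    have "cf u m = cf (s0 (cf u V0)) m" for m
    proof (cases "m = V0")
      case False
      then have "dg m \<noteq> 0" using dg_0[of m] by auto
      then have "cf u m = 0" using u[unfolded Deg_iff, rule_format, of m] by auto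
      then show ?thesis using False by (simp add: lookup_single when_def)
    qed simp
    then have "u = s0 (cf u V0)" by (intro poly_mapping_eqI)
    then show "u \<in> range s0" by blast
  qed
qed auto

lemma carrier_F0: "carrier (F_mod P (\<lambda>_. 0)) = range s0"
  by (simp add: carrier_F Deg_0_range)

lemma carrier_F1: "carrier (F_mod P (unit_vec i)) = Deg 1"
  by (simp add: carrier_F sum_unit_vec)

lemma diff_image_0: "diff_image P (\<lambda>_. 0) = range (\<lambda>p. diff P (s0 p))"
  by (auto simp: diff_image_def carrier_F0)

lemma diff_image_1: "diff_image P (unit_vec i) = diff P ` Deg 1"
  by (simp add: diff_image_def carrier_F1)

lemma F_tilde_1: "F_tilde P (unit_vec i) = {u \<in> Deg 1. diff P u = 0}"
  by (simp add: F_tilde_def carrier_F1)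

lemma submod_Ft: "submod S'_alg (F_mod P (unit_vec i)) (F_tilde P (unit_vec i))"
proof -
  interpret F: graded_module "tscale P" Pi "part (tensor_mod P)" "F_mod P (unit_vec i)" S'_alg
    by (rule F_graded_module)
  have "diff P (Pi u) = 0" if "diff P u = 0" for u
    using that Pi_d[of u] by (simp add: Pi_zero)
  moreover have "diff P (pi_act P x u) = 0" if "diff P u = 0" for x u
    by (simp add: pi_act_closed[OF that] diff_sq)
  ultimately show ?thesis
    unfolding F.submod_iff F_tilde_1 carrier_F1
    by (auto simp: ts.subspace_def diff_zero diff_lin Pi_Deg pi_act_Deg
        ts.subspace_0[OF Deg_subspace] ts.subspace_add[OF Deg_subspace] ts.subspace_scale[OF Deg_subspace])
qed

lemma submod_dF:
  "submod S'_alg (tensor_mod P) (diff P ` Deg (Suc d))"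
  "submod S'_alg (tensor_mod P) (diff P ` Deg 0)"
proof -
  interpret T: graded_module "tscale P" Pi "part (tensor_mod P)" "tensor_mod P" S'_alg
    by (rule tensor_graded_module)
  have "ts.subspace (diff P ` Deg d)" for d
  proof (rule ts.subspaceI)
    show "0 \<in> diff P ` Deg d" using diff_zero ts.subspace_0[OF Deg_subspace] by force
    show "x + y \<in> diff P ` Deg d" if "x \<in> diff P ` Deg d" "y \<in> diff P ` Deg d" for x y
      using that ts.subspace_add[OF Deg_subspace] by (auto simp flip: diff_lin)
    show "tscale P c x \<in> diff P ` Deg d" if "x \<in> diff P ` Deg d" for c x
      using that ts.subspace_scale[OF Deg_subspace] by (auto simp flip: diff_lin)
  qed
  moreover have "Pi (diff P u) \<in> diff P ` Deg d" if "u \<in> Deg d" for u d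
    using Pi_Deg[OF ts.subspace_neg[OF Deg_subspace that]] by (auto simp: Pi_d diff_minus Pi_minus intro: image_eqI[of _ _ "- Pi u"])
  moreover have "pi_act P x (diff P u) \<in> diff P ` Deg d" if "u \<in> Deg d" for x u d
    unfolding pi_act_diff using that
    by (intro imageI ts.subspace_sum[OF Deg_subspace] \<iota>1_Deg diff_Deg)
  ultimately show "submod S'_alg (tensor_mod P) (diff P ` Deg (Suc d))" "submod S'_alg (tensor_mod P) (diff P ` Deg 0)"
    unfolding T.submod_iff by auto
qed

lemma submod_dF0: "submod S'_alg (F_mod P (unit_vec i)) (diff_image P (\<lambda>_. 0))"
proof -
  interpret F: graded_module "tscale P" Pi "part (tensor_mod P)" "F_mod P (unit_vec i)" S'_alg
    by (rule F_graded_module)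
  interpret T: graded_module "tscale P" Pi "part (tensor_mod P)" "tensor_mod P" S'_alg
    by (rule tensor_graded_module)
  have "diff_image P (\<lambda>_. 0) = diff P ` Deg 0" by (simp add: diff_image_def carrier_F)
  moreover have "diff P ` Deg 0 \<subseteq> Deg 1" using diff_Deg[of _ 0] by auto
  ultimately show ?thesis
    using submod_dF(2) unfolding F.submod_iff T.submod_iff by (simp add: carrier_F1)
qed

text \<open>\<open>diff\<close> is odd, so a homogeneous exact form has a potential of the opposite
  parity, obtained by projecting any potential to that parity.\<close>

lemma diff_part:
  assumes "Pi (diff P (s0 u)) = tscale P (ksign p) (diff P (s0 u))"
  shows "\<exists>u' \<in> part P (p + 1). diff P (s0 u') = diff P (s0 u)"
proof -
  let ?u = "sm (1/2) (u + sm (ksign (p + 1)) (\<sigma> u))"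
  have "diff P (s0 (\<sigma> u)) = tscale P (ksign (p + 1)) (diff P (s0 u))"
    using assms by (simp add: Pi_d Pi_s0 ksign_add minus_equation_iff[of "diff P _"])
  then have "diff P (s0 ?u) = tscale P (1/2) (diff P (s0 u) + diff P (s0 u))"
    by (simp add: single_add diff_lin ts.scale_right_distrib flip: tscale_single)
  also have "\<dots> = diff P (s0 u)" by (simp flip: ts.scale_left_distrib add: ts.scale_right_distrib)
  finally have "diff P (s0 ?u) = diff P (s0 u)" .
  moreover have "?u \<in> part P (p + 1)"
    by (simp add: gr.prt_iff \<sigma>_lin vs.scale_right_distrib mult_ac add.commute)
  ultimately show ?thesis by blast
qed

end


section \<open>Comparison with \<open>A\<close> and the filtration of \<open>F(P, N(e\<^sub>i))\<close>\<close>

context weyl_mod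
begin

text \<open>The map f \<mapsto> f v intertwines all derivatives because they kill v. Its kernel is a
  Weyl-stable subspace of \<open>A\<close> not containing 1, and its range is one of
  \<open>P\<close> containing v.\<close>

lemma iso_A_if_killed:
  assumes v: "v \<in> part P r" "v \<noteq> 0" and kill: "\<And>l. D l v = 0" and s: "simple_mod weyl P"
  shows "iso_mod (homog weyl) P A_mod"
proof -
  interpret simple_weyl_mod P by unfold_locales (rule s)
  interpret A: simple_weyl_mod A_mod
    by (intro simple_weyl_mod.intro weyl_mod.intro simple_weyl_mod_axioms.intro A_weyl_module A_simple)
  have \<sigma>v: "\<sigma> v = sm (ksign r) v" using v by (simp add: gr.prt_iff)
  define \<phi> where "\<phi> f = M f v" for f
  have D\<phi>: "D j (\<phi> f) = \<phi> (d_var j f)" for j f by (simp add: \<phi>_def D_M kill M_lin)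
  have \<sigma>\<phi>: "\<sigma> (\<phi> f) = sm (ksign r) (\<phi> (lau_sigma f))" for f by (simp add: \<phi>_def \<sigma>_M \<sigma>v M_lin)
  define K where "K = {f. \<phi> f = 0}"
  have "K = {0}"
  proof (rule ccontr)
    assume K: "K \<noteq> {0}"
    have "0 \<in> K" by (simp add: K_def \<phi>_def)
    with K obtain g where g: "g \<in> K" "g \<noteq> 0" by blast
    have "K = UNIV"
    proof (rule A_ideal[OF _ _ _ g])
      show "cs.subspace K" by (auto simp: cs.subspace_def K_def \<phi>_def M_add_left M_scale_left)
      show "amult f g \<in> K" if "g \<in> K" for f g
        using that by (simp add: K_def \<phi>_def M_lin flip: M_M)
      show "d_var j g \<in> K" if "g \<in> K" for j g
        using that by (simp add: K_def D_lin flip: D\<phi>)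
    qed
    then have "\<phi> (mon 0 {}) = 0" by (auto simp: K_def)
    then show False using v by (simp add: \<phi>_def)
  qed
  moreover have \<phi>_diff: "\<phi> (f - g) = \<phi> f - \<phi> g" for f g by (simp add: \<phi>_def M_diff_left)
  ultimately have inj: "\<phi> f = \<phi> g \<longleftrightarrow> f = g" for f g
  proof -
    have "f - g \<in> K \<longleftrightarrow> f - g \<in> {0}" using \<open>K = {0}\<close> by simp
    then show ?thesis by (simp add: K_def \<phi>_diff)
  qed
  have "range \<phi> = {0} \<or> range \<phi> = UNIV"
  proof (rule dichotomy)
    show "vs.subspace (range \<phi>)"
    proof (rule vs.subspaceI)
      show "0 \<in> range \<phi>" by (rule image_eqI[of _ _ 0]) (simp_all add: \<phi>_def)
      show "x + y \<in> range \<phi>" if "x \<in> range \<phi>" "y \<in> range \<phi>" for x y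
        using that by (auto simp: \<phi>_def simp flip: M_add_left)
      show "sm c x \<in> range \<phi>" if "x \<in> range \<phi>" for c x
        using that by (auto simp: \<phi>_def simp flip: M_scale_left)
    qed
    show "\<sigma> x \<in> range \<phi>" if "x \<in> range \<phi>" for x
      using that by (auto simp: \<sigma>\<phi>) (auto simp: \<phi>_def simp flip: M_scale_left)
    show "M f x \<in> range \<phi>" if "x \<in> range \<phi>" for f x
      using that by (auto simp: \<phi>_def M_M)
    show "D j x \<in> range \<phi>" if "x \<in> range \<phi>" for j x
      using that by (auto simp: D\<phi>)
  qed
  moreover have "\<phi> (mon 0 {}) \<noteq> 0" using v by (simp add: \<phi>_def)
  ultimately have surj: "range \<phi> = UNIV" by (metis rangeI singletonD)
  have act: "act P x (\<phi> f) = \<phi> (x f)" if "x \<in> weyl" for x f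
    using that
  proof (induction x arbitrary: f rule: weyl.induct)
    case 4
    then show ?case using D\<phi>[of None f] by (simp add: D_def)
  next
    case (5 i)
    then show ?case using D\<phi>[of "Some i" f] by (simp add: D_def)
  next
    case 6
    show ?case using act_id[of "\<phi> f"] unfolding id_def by simp
  next
    case (7 x c)
    then show ?case by (simp only: act_scale) (simp add: \<phi>_def M_scale_left)
  next
    case (8 x y)
    then have "act P (x + y) (\<phi> f) = \<phi> (x f) + \<phi> (y f)" using act_plus by metis
    moreover have "\<phi> ((x + y) f) = \<phi> (x f) + \<phi> (y f)" by (simp add: \<phi>_def M_add_left)
    ultimately show ?case by metis
  next
    case (9 x y)
    then have "act P (x \<circ> y) (\<phi> f) = \<phi> (x (y f))" using act_comp by metis
    then show ?case by (metis comp_apply)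
  qed (simp_all add: \<phi>_def M_M flip: M_def)
  \<comment> \<open>The map f \<mapsto> f v commutes with the action without any sign, whereas an
    odd isomorphism must commute up to sign. For odd v composing with \<open>lau_sigma\<close>
    supplies that sign.\<close>
  define \<tau> :: "'n lau \<Rightarrow> 'n lau" where "\<tau> f = (if r = 0 then f else lau_sigma f)" for f
  have \<tau>: "\<tau> (f + g) = \<tau> f + \<tau> g" "\<tau> (cscale c f) = cscale c (\<tau> f)" "\<tau> (\<tau> f) = f" "lau_sigma (\<tau> f) = \<tau> (lau_sigma f)" for f g c
    by (simp_all add: \<tau>_def clin_add[OF clin_sigma] clin_scale[OF clin_sigma])
  show ?thesis
  proof (rule iso_modI[where S = "A_mod" and d = \<phi> and \<psi> = \<tau> and e = r])
    show "\<phi> ` carrier A_mod = carrier P" by (simp add: surj)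
    show "\<tau> ` carrier A_mod = carrier A_mod" using \<tau>(3) by (metis A_mod_simps(1) surj_def)
    show "\<phi> u = \<phi> w \<longleftrightarrow> \<tau> u = \<tau> w" for u w using \<tau>(3) inj by metis
    show "\<exists>u\<in>carrier A_mod. \<phi> u = w \<and> \<tau> u \<in> part A_mod (p + r)" if w: "w \<in> part P p" for p w
    proof -
      obtain f where f: "w = \<phi> f" using surj by (metis UNIV_I rangeE)
      have "\<sigma> w = sm (ksign p) w" using w by (simp add: gr.prt_iff)
      then have "sm (ksign r) (sm (ksign r) (\<phi> (lau_sigma f))) = sm (ksign r) (sm (ksign p) (\<phi> f))"
        unfolding f \<sigma>\<phi> by simp
      then have "\<phi> (lau_sigma f) = \<phi> (cscale (ksign (p + r)) f)"
        by (simp only: vs.scale_scale ksign_square) (simp add: \<phi>_def M_scale_left ksign_add mult.commute)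
      then have "lau_sigma f = cscale (ksign (p + r)) f" by (simp only: inj)
      then have "\<tau> f \<in> lau_part (p + r)" by (simp add: lau_part_iff \<tau>)
      then show ?thesis using f by auto
    qed
    show "\<exists>u'\<in>carrier A_mod. act P x (\<phi> u) = \<phi> u' \<and> \<tau> u' = smult A_mod (ksign (p * r)) (act A_mod x (\<tau> u))"
      if x: "x \<in> homog weyl p" for p x u
    proof -
      have c: "clin x" using x weyl_clin by blast
      have "lau_sigma (x u) = cscale (ksign p) (x (lau_sigma u))"
        using x oper_part_iff[OF c] by auto
      then have "\<tau> (x u) = cscale (ksign (p * r)) (x (\<tau> u))"
        by (cases r) (simp_all add: \<tau>_def)
      then show ?thesis using act x by auto
    qed
  qed (simp_all add: \<tau> \<phi>_def M_add_left M_scale_left)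
qed

text \<open>\<open>iso_A_if_killed\<close> needs a homogeneous vector; the even and odd parts of a
  killed vector are again killed, since \<sigma> and D_l commute up to sign.\<close>

lemma killed_zero:
  assumes "\<not> iso_mod (homog weyl) P A_mod" "simple_mod weyl P" "\<And>l. D l v = 0"
  shows "v = 0"
proof -
  have "\<And>l. D l (\<sigma> v) = 0"
  proof -
    fix l
    have "\<sigma> (D l (\<sigma> v)) = sm (ksign (pd l)) (D l v)" by (simp add: \<sigma>_D)
    then have "\<sigma> (\<sigma> (D l (\<sigma> v))) = 0" using assms(3) by (simp add: \<sigma>_lin)
    then show "D l (\<sigma> v) = 0" by simp
  qed
  then have "D l (sm (1/2) (v + \<sigma> v)) = 0" "D l (sm (1/2) (v - \<sigma> v)) = 0" for l
    using assms(3) by (simp_all add: D_lin)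
  then have "sm (1/2) (v + \<sigma> v) = 0" "sm (1/2) (v - \<sigma> v) = 0"
    using iso_A_if_killed[OF gr.half_prt(1)] iso_A_if_killed[OF gr.half_prt(2)] assms(1,2) by blast+
  then show ?thesis using gr.half[of v] by simp
qed

lemma dF0_homog_act:
  assumes "x \<in> homog S'_alg p"
  shows "pi_act P x (diff P (s0 u)) = diff P (s0 (sm (ksign p) (act P x u)))"
proof -
  have "diff P (pi_act P x (s0 u)) = tscale P (ksign p) (pi_act P x (diff P (s0 u)))"
    using assms by (intro diff_pi_act_homog) auto
  then have "tscale P (ksign p) (diff P (pi_act P x (s0 u))) = pi_act P x (diff P (s0 u))" by simp
  moreover have "pi_act P x (s0 u) = s0 (act P x u)" using assms by (intro pi_act_s0) auto
  ultimately show ?thesis by (simp add: diff_lin flip: tscale_single)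
qed

text \<open>Covers both cases of the theorem: p \<mapsto> d p and \<psi> have the same kernel, the
  vectors killed by all derivatives, so their images are isomorphic. The parity r + 1 combines that
  of \<psi> with the oddness of \<open>diff\<close>.\<close>

lemma iso_dF0:
  assumes \<psi>: "range \<psi> = carrier M'"
    and ker: "\<And>u v. \<psi> u = \<psi> v \<longleftrightarrow> (\<forall>l. D l (u - v) = 0)"
    and add: "\<And>u v. \<psi> (u + v) = add M' (\<psi> u) (\<psi> v)"
    and smult: "\<And>c v. \<psi> (sm c v) = smult M' c (\<psi> v)"
    and part: "\<And>p u. u \<in> part P p \<Longrightarrow> \<psi> u \<in> part M' (p + r)"
    and act: "\<And>p x u. x \<in> homog S'_alg p \<Longrightarrow> \<psi> (act P x u) = smult M' (ksign (p * r)) (act M' x (\<psi> u))"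
    and assoc: "\<And>c d w. w \<in> carrier M' \<Longrightarrow> smult M' c (smult M' d w) = smult M' (c * d) w"
    and act_carrier: "\<And>x w. x \<in> S'_alg \<Longrightarrow> w \<in> carrier M' \<Longrightarrow> act M' x w \<in> carrier M'"
  shows "iso_mod (homog S'_alg) (restr (F_mod P (unit_vec i)) (diff_image P (\<lambda>_. 0))) M'"
proof (rule iso_modI[where S = P and d = "\<lambda>p. diff P (s0 p)" and \<psi> = \<psi> and e = "r + 1"])
  show "(\<lambda>p. diff P (s0 p)) ` carrier P = carrier (restr (F_mod P (unit_vec i)) (diff_image P (\<lambda>_. 0)))"
    by (simp add: diff_image_0)
  show "\<psi> ` carrier P = carrier M'" using \<psi> by simp
  show "diff P (s0 u) = diff P (s0 v) \<longleftrightarrow> \<psi> u = \<psi> v" for u v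
    using diff_s0_zero_iff[of "u - v"] by (simp add: ker single_diff diff_diff)
  show "\<exists>u\<in>carrier P. diff P (s0 u) = w \<and> \<psi> u \<in> part M' (p + (r + 1))"
    if "w \<in> part (restr (F_mod P (unit_vec i)) (diff_image P (\<lambda>_. 0))) p" for p w
  proof -
    from that obtain u where u: "w = diff P (s0 u)" "Pi w = tscale P (ksign p) w"
      by (auto simp: diff_image_0 tensor_part)
    then obtain u' where "u' \<in> part P (p + 1)" "diff P (s0 u') = w" using diff_part by metis
    then show ?thesis using part[of u' "p + 1"] by (auto simp: ac_simps)
  qed
  show "\<exists>u'\<in>carrier P. act (restr (F_mod P (unit_vec i)) (diff_image P (\<lambda>_. 0))) x (diff P (s0 u)) = diff P (s0 u')
      \<and> \<psi> u' = smult M' (ksign (p * (r + 1))) (act M' x (\<psi> u))"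
    if "x \<in> homog S'_alg p" for p x u
  proof -
    have c: "\<psi> u \<in> carrier M'" using \<psi> by blast
    have "\<psi> (sm (ksign p) (act P x u)) = smult M' (ksign p) (smult M' (ksign (p * r)) (act M' x (\<psi> u)))"
      by (simp only: smult act[OF that])
    also have "\<dots> = smult M' (ksign (p * (r + 1))) (act M' x (\<psi> u))"
      using that act_carrier[OF _ c] by (simp add: assoc ring_distribs ksign_add mult.commute)
    finally show ?thesis using dF0_homog_act[OF that] by auto
  qed
qed (use add smult in \<open>simp_all add: single_add diff_lin flip: tscale_single\<close>)

end

section \<open>The layers of the filtration for simple \<open>P\<close>\<close>

context simple_weyl_mod
begin

lemma killed_not_all: "\<exists>v. D l v \<noteq> 0"
  using all_D_zero[of l] nonzero by blast

lemma Delta_nonzero: "Delta P \<noteq> {0}"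
  using killed_not_all[of None] D_in_Delta[of None] by blast

lemma forms_full:
  assumes n: "CARD('n) \<ge> 2" and X: "submod S'_alg (F_mod P (unit_vec i)) X" and Ft: "F_tilde P (unit_vec i) \<subseteq> X"
  shows "X = F_tilde P (unit_vec i) \<or> X = Deg 1"
proof -
  interpret F: graded_module "tscale P" Pi "part (tensor_mod P)" "F_mod P (unit_vec i)" S'_alg
    by (rule F_graded_module)
  interpret forms_submodule P X
    using X Ft n unfolding F.submod_iff carrier_F1 F_tilde_1
    by unfold_locales auto
  show ?thesis
  proof (cases "\<exists>u\<in>X. diff P u \<noteq> 0")
    case True
    then show ?thesis using full by blast
  next
    case False
    then have "X \<subseteq> F_tilde P (unit_vec i)" using X_Deg by (auto simp: F_tilde_1)
    with Ft show ?thesis by blast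
  qed
qed

lemma ex_not_closed': "\<exists>u\<in>Deg 1. diff P u \<noteq> 0"
  using ex_not_closed nonzero sv_Deg by blast

lemma quot_F_Ft_simple:
  assumes n: "CARD('n) \<ge> 2"
  shows "simple_mod S'_alg (quot (F_mod P (unit_vec i)) (F_tilde P (unit_vec i)))"
proof -
  interpret F: graded_module "tscale P" Pi "part (tensor_mod P)" "F_mod P (unit_vec i)" S'_alg
    by (rule F_graded_module)
  show ?thesis
  proof (rule F.simple_quotI[OF submod_Ft])
    show "F_tilde P (unit_vec i) \<noteq> carrier (F_mod P (unit_vec i))"
      using ex_not_closed' by (auto simp: F_tilde_1 carrier_F1)
  qed (use forms_full[OF n] carrier_F1 in auto)
qed

text \<open>The preimage of a submodule under \<open>diff\<close> is a submodule of the one-forms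
  containing the closed ones, so \<open>forms_full\<close> decides it.\<close>

lemma dF_simple:
  assumes n: "CARD('n) \<ge> 2"
  shows "simple_mod S'_alg (restr (tensor_mod P) (diff P ` Deg 1))"
  unfolding simple_mod_def
proof (intro conjI allI impI)
  interpret F: graded_module "tscale P" Pi "part (tensor_mod P)" "F_mod P (unit_vec i)" S'_alg for i
    by (rule F_graded_module)
  interpret T: graded_module "tscale P" Pi "part (tensor_mod P)" "tensor_mod P" S'_alg
    by (rule tensor_graded_module)
  show "\<exists>v\<in>carrier (restr (tensor_mod P) (diff P ` Deg 1)). v \<noteq> zero (restr (tensor_mod P) (diff P ` Deg 1))"
    using ex_not_closed' by auto
  fix N assume "submod S'_alg (restr (tensor_mod P) (diff P ` Deg 1)) N"
  then have N: "N \<subseteq> diff P ` Deg 1" "ts.subspace N" "\<And>v. v \<in> N \<Longrightarrow> Pi v \<in> N"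
    "\<And>x v. x \<in> S'_alg \<Longrightarrow> v \<in> N \<Longrightarrow> pi_act P x v \<in> N"
    by (auto simp: submod_restr T.submod_iff)
  define X where "X = {u \<in> Deg 1. diff P u \<in> N}"
  \<comment> \<open>Every \<open>unit_vec i\<close> has total degree 1, so any index gives the space
    of all one-forms.\<close>
  obtain i :: 'n where True by simp
  have "submod S'_alg (F_mod P (unit_vec i)) X"
    unfolding F.submod_iff carrier_F1
  proof (intro conjI ballI)
    show "ts.subspace X"
    proof (rule ts.subspaceI)
      show "0 \<in> X" using ts.subspace_0[OF N(2)] by (simp add: X_def diff_zero)
      show "u + v \<in> X" if "u \<in> X" "v \<in> X" for u v
        using that ts.subspace_add[OF N(2)] ts.subspace_add[OF Deg_subspace] by (simp add: X_def diff_lin)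
      show "tscale P c u \<in> X" if "u \<in> X" for c u
        using that ts.subspace_scale[OF N(2)] ts.subspace_scale[OF Deg_subspace] by (simp add: X_def diff_lin)
    qed
    show "Pi u \<in> X" if "u \<in> X" for u
    proof -
      have "diff P (Pi u) = - Pi (diff P u)" by (simp add: Pi_d)
      then show ?thesis using that N(3) ts.subspace_neg[OF N(2)] by (simp add: X_def Pi_Deg)
    qed
    show "act (F_mod P (unit_vec i)) x u \<in> X" if "x \<in> S'_alg" "u \<in> X" for x u
      using that N(3,4) by (simp add: X_def pi_act_Deg diff_pi_act_Pi)
  qed (auto simp: X_def)
  moreover have "F_tilde P (unit_vec i) \<subseteq> X"
    using ts.subspace_0[OF N(2)] by (auto simp: F_tilde_1 X_def)
  ultimately have "X = F_tilde P (unit_vec i) \<or> X = Deg 1" by (rule forms_full[OF n])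
  moreover have "N = diff P ` X" using N(1) by (auto simp: X_def)
  moreover have "0 \<in> N" by (rule ts.subspace_0[OF N(2)])
  ultimately show "N = {zero (restr (tensor_mod P) (diff P ` Deg 1))} \<or> N = carrier (restr (tensor_mod P) (diff P ` Deg 1))"
    by (auto simp: F_tilde_1)
qed

lemma iso_quot_F_Ft:
  "iso_mod (homog S'_alg) (quot (F_mod P (unit_vec i)) (F_tilde P (unit_vec i))) (restr (tensor_mod P) (diff P ` Deg 1))"
proof -
  let ?F = "F_mod P (unit_vec i)" and ?N = "F_tilde P (unit_vec i)"
  interpret F: graded_module "tscale P" Pi "part (tensor_mod P)" ?F S'_alg
    by (rule F_graded_module)
  note N = submod_Ft[of i]
  show ?thesis
  proof (rule iso_modI[where S = ?F and d = "coset ?F ?N" and \<psi> = "diff P" and e = 1])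
    show "coset ?F ?N ` carrier ?F = carrier (quot ?F ?N)" by (simp add: F.quot_carrier[OF N])
    show "diff P ` carrier ?F = carrier (restr (tensor_mod P) (diff P ` Deg 1))" by (simp add: carrier_F1)
    show "coset ?F ?N u = coset ?F ?N v \<longleftrightarrow> diff P u = diff P v" if "u \<in> carrier ?F" "v \<in> carrier ?F" for u v
    proof -
      have "u - v \<in> ?N \<longleftrightarrow> diff P u = diff P v"
        using that ts.subspace_diff[OF Deg_subspace] by (simp add: F_tilde_1 carrier_F1 diff_diff)
      then show ?thesis by (simp only: F.cst_eq[OF N])
    qed
    show "\<exists>u\<in>carrier ?F. coset ?F ?N u = w \<and> diff P u \<in> part (restr (tensor_mod P) (diff P ` Deg 1)) (p + 1)"
      if "w \<in> part (quot ?F ?N) p" for p w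
    proof -
      from that obtain u where u: "u \<in> part ?F p" "w = coset ?F ?N u" by (auto simp: F.quot_part[OF N])
      then have "u \<in> Deg 1" "Pi u = tscale P (ksign p) u" by (simp_all add: sum_unit_vec tensor_part)
      then show ?thesis using u by (auto simp: carrier_F1 tensor_part Pi_d diff_lin ksign_add)
    qed
    show "\<exists>u'\<in>carrier ?F. act (quot ?F ?N) x (coset ?F ?N u) = coset ?F ?N u' \<and>
        diff P u' = smult (restr (tensor_mod P) (diff P ` Deg 1)) (ksign (p * 1)) (act (restr (tensor_mod P) (diff P ` Deg 1)) x (diff P u))"
      if x: "x \<in> homog S'_alg p" and u: "u \<in> carrier ?F" for p x u
    proof -
      have "act (quot ?F ?N) x (coset ?F ?N u) = coset ?F ?N (pi_act P x u)"
        using x u by (simp add: F.quot_act[OF N])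
      then show ?thesis
        using x u diff_pi_act_homog[of x p u] by (auto simp: carrier_F1 pi_act_Deg)
    qed
  qed (simp_all add: carrier_F1 diff_lin F.quot_add[OF N] F.quot_smult[OF N]
      ts.subspace_add[OF Deg_subspace] ts.subspace_scale[OF Deg_subspace])
qed

lemma iso_F0_P: "iso_mod (homog S'_alg) (F_mod P (\<lambda>_. 0)) P"
proof (rule iso_modI[where S = P and d = s0 and \<psi> = "\<lambda>v. v" and e = 0])
  show "s0 ` carrier P = carrier (F_mod P (\<lambda>_. 0))" by (simp add: carrier_F0)
  show "s0 u = s0 v \<longleftrightarrow> u = v" for u v :: 'p by (metis lookup_single_eq)
  show "\<exists>u\<in>carrier P. s0 u = w \<and> u \<in> part P (p + 0)" if "w \<in> part (F_mod P (\<lambda>_. 0)) p" for p w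
  proof -
    from that obtain u where u: "w = s0 u" "Pi w = tscale P (ksign p) w"
      by (auto simp: Deg_0_range tensor_part)
    then have "s0 (\<sigma> u) = s0 (sm (ksign p) u)" by (simp add: Pi_s0)
    then have "\<sigma> u = sm (ksign p) u" by (metis lookup_single_eq)
    then show ?thesis using u by (auto simp: gr.prt_iff)
  qed
  show "\<exists>u'\<in>carrier P. act (F_mod P (\<lambda>_. 0)) x (s0 u) = s0 u' \<and> u' = smult P (ksign (p * 0)) (act P x u)"
    if "x \<in> homog S'_alg p" for p x u
    using that pi_act_s0[of x u] by auto
qed (simp_all add: single_add)

lemma quot_Ft_dF0:
  "zero_mod (quot (restr (F_mod P (unit_vec i)) (F_tilde P (unit_vec i))) (diff_image P (\<lambda>_. 0)))
   \<or> trivial_mod S'_alg (quot (restr (F_mod P (unit_vec i)) (F_tilde P (unit_vec i))) (diff_image P (\<lambda>_. 0)))"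
proof -
  let ?F = "F_mod P (unit_vec i)" and ?N = "F_tilde P (unit_vec i)"
  interpret F: graded_module "tscale P" Pi "part (tensor_mod P)" ?F S'_alg
    by (rule F_graded_module)
  have Ft: "?N \<subseteq> carrier ?F" "ts.subspace ?N" "\<And>v. v \<in> ?N \<Longrightarrow> Pi v \<in> ?N"
    "\<And>x v. x \<in> S'_alg \<Longrightarrow> v \<in> ?N \<Longrightarrow> pi_act P x v \<in> ?N"
    using submod_Ft[of i] unfolding F.submod_iff by auto
  interpret R: graded_module "tscale P" Pi "part (tensor_mod P)" "restr ?F ?N" S'_alg
    by unfold_locales (use Ft in \<open>auto simp: pi_act_add carrier_F1 sum_unit_vec\<close>)
  have sub: "diff_image P (\<lambda>_. 0) \<subseteq> ?N"
    using diff_Deg[OF s0_Deg] by (auto simp: diff_image_0 F_tilde_1 diff_sq)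
  have "submod S'_alg (restr ?F ?N) (diff_image P (\<lambda>_. 0))"
    using submod_dF0 sub Ft(1) by (simp add: submod_restr)
  then show ?thesis
  proof (rule R.zero_or_trivial)
    fix x v assume "v \<in> carrier (restr ?F ?N)"
    then have v: "v \<in> Deg 1" "diff P v = 0" by (auto simp: F_tilde_1)
    have "(\<Sum>j\<in>UNIV. \<iota>1 (coef x j) j v) \<in> Deg 0"
      using v by (intro ts.subspace_sum[OF Deg_subspace] \<iota>1_Deg) simp
    then show "act (restr ?F ?N) x v \<in> diff_image P (\<lambda>_. 0)"
      by (auto simp: pi_act_closed[OF v(2)] diff_image_0 Deg_0_range)
  qed
qed

lemma F_not_simple: "\<not> simple_mod S'_alg (F_mod P (unit_vec i))"
proof
  assume "simple_mod S'_alg (F_mod P (unit_vec i))"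
  then have "diff_image P (\<lambda>_. 0) = {0} \<or> diff_image P (\<lambda>_. 0) = Deg 1"
    using submod_dF0[of i] by (simp add: simple_mod_def carrier_F1)
  moreover have "diff_image P (\<lambda>_. 0) \<noteq> {0}"
    using killed_not_all[of None] diff_s0_zero_iff by (auto simp: diff_image_0)
  moreover have "diff_image P (\<lambda>_. 0) \<noteq> Deg 1"
  proof
    assume e: "diff_image P (\<lambda>_. 0) = Deg 1"
    obtain u where "u \<in> Deg 1" "diff P u \<noteq> 0" using ex_not_closed' by blast
    then show False unfolding e [symmetric] by (auto simp: diff_image_0 diff_sq)
  qed
  ultimately show False by blast
qed

text \<open>When no nonzero vector is killed by all derivatives, every nonzero submodule contains
  \<open>Delta P\<close>; simplicity and uniqueness are both instances of this.\<close>

lemma restr_Delta_simple: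
  assumes n: "CARD('n) \<ge> 2" and inj: "\<And>v. (\<And>l. D l v = 0) \<Longrightarrow> v = 0"
  shows "simple_mod S'_alg (restr P (Delta P))"
    "submod S'_alg P X \<Longrightarrow> simple_mod S'_alg (restr P X) \<Longrightarrow> X = Delta P"
proof -
  have sub: "Delta P \<subseteq> X" if X: "submod S'_alg P X" "X \<noteq> {0}" for X
  proof -
    have "0 \<in> X" using submodD(1)[OF X(1)] by (rule vs.subspace_0)
    with X obtain v where "v \<in> X" "v \<noteq> 0" by blast
    then obtain l where "D l v \<noteq> 0" using inj by blast
    then show ?thesis using submodule_contains_Delta[OF n X(1) \<open>v \<in> X\<close>] by blast
  qed
  show "simple_mod S'_alg (restr P (Delta P))"
    unfolding simple_mod_def using Delta_nonzero vs.subspace_0[OF subspace_Delta] sub by (auto simp: submod_restr)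
  assume X: "submod S'_alg P X" "simple_mod S'_alg (restr P X)"
  then have "X \<noteq> {0}" by (auto simp: simple_mod_def)
  then have D: "Delta P \<subseteq> X" by (rule sub[OF X(1)])
  then have "submod S'_alg (restr P X) (Delta P)" using Delta_submod by (simp add: submod_restr)
  then have "Delta P = {zero (restr P X)} \<or> Delta P = carrier (restr P X)"
    using X(2) unfolding simple_mod_def by blast
  then show "X = Delta P" using Delta_nonzero by simp
qed

end


section \<open>The quotient of \<open>A\<close> by the constants\<close>

lemma submod_constants: "submod S'_alg (A_mod :: ('n::{finite,linorder} oper, 'n lau) smod) constants"
proof -
  let ?A = "A_mod :: ('n oper, 'n lau) smod"
  let ?C = "constants :: 'n lau set"
  interpret A: weyl_mod ?A
    by (intro weyl_mod.intro A_weyl_module)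
  have kill: "x f = 0" if "x \<in> S'_alg" "f \<in> ?C" for x f
  proof -
    have "x f = (\<Sum>j\<in>UNIV. vf (coef x j) j f)"
      using arg_cong[OF W_alg_expand[OF S'_alg_W[OF that(1)]], of "\<lambda>y. y f"] by (simp only: sum_fun_apply)
    then show ?thesis using that(2) by (simp add: constants_iff vf_def)
  qed
  have "cs.subspace ?C"
  proof (rule cs.subspaceI)
    show "0 \<in> ?C" by (simp only: constants_iff clin_zero[OF clin_d_var]) simp
    show "f + g \<in> ?C" if "f \<in> ?C" "g \<in> ?C" for f g
      using that by (simp only: constants_iff clin_add[OF clin_d_var]) simp
    show "cscale c f \<in> ?C" if "f \<in> ?C" for c f
      using that by (simp only: constants_iff clin_scale[OF clin_d_var]) simp
  qed
  then have "A.vs.subspace ?C" by simp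
  moreover have "lau_sigma f \<in> ?C" if "f \<in> ?C" for f
    using that by (auto simp: constants_def clin_scale[OF clin_sigma] lau_sigma_mon)
  moreover have "0 \<in> ?C" using \<open>cs.subspace ?C\<close> by (rule cs.subspace_0)
  then have "x f \<in> ?C" if "x \<in> S'_alg" "f \<in> ?C" for x f
    using kill[OF that] by simp
  ultimately show ?thesis
    by (intro A.submodI) simp_all
qed

lemma A_quotient:
  fixes Q :: "('n::{finite,linorder} oper, 'n lau set) smod"
  assumes n: "CARD('n) \<ge> 2"
  defines "Q \<equiv> quot A_mod constants" and "K \<equiv> carrier (quot (restr A_mod (Delta A_mod)) constants)"
  shows "submod S'_alg Q K" "simple_mod S'_alg (restr Q K)" "\<not> trivial_mod S'_alg (restr Q K)"
    "submod S'_alg Q X \<Longrightarrow> submod S'_alg Q Y \<Longrightarrow> Y \<subseteq> X \<Longrightarrow> simple_mod S'_alg (quot (restr Q X) Y)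
      \<Longrightarrow> \<not> trivial_mod S'_alg (quot (restr Q X) Y) \<Longrightarrow> X = K \<and> Y = {zero Q}"
proof -
  let ?A = "A_mod :: ('n oper, 'n lau) smod"
  let ?C = "constants :: 'n lau set"
  interpret A: simple_weyl_mod ?A
    by (intro simple_weyl_mod.intro weyl_mod.intro simple_weyl_mod_axioms.intro A_weyl_module A_simple)
  interpret G: graded_module "smult ?A" "twist ?A 1" "part ?A" ?A S'_alg
    by (rule A.P_graded_module)
  have AD: "A.D j f = d_var j f" for j f by (simp add: A.D_def)
  note C = submod_constants[where 'n = 'n]
  have CD: "?C \<subseteq> Delta ?A"
  proof
    fix f assume "f \<in> ?C"
    then obtain c where "f = cscale c (mon 0 {})" by (auto simp: constants_def)
    then have "f = A.D None (cscale c (mon 1 {}))" by (simp add: AD clin_scale[OF clin_d_t])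
    then show "f \<in> Delta ?A" using A.D_in_Delta by metis
  qed
  let ?c = "coset ?A ?C"
  have K: "K = ?c ` Delta ?A" by (simp add: K_def quot_def coset_def restr_def)
  have QC: "carrier Q = range ?c" and Q0: "zero Q = ?C" by (simp_all add: Q_def quot_def)
  show subK: "submod S'_alg Q K"
    unfolding K Q_def by (rule G.quot_image[OF C A.Delta_submod])
  \<comment> \<open>The preimage of Y contains a nonconstant function, which some derivative does
    not kill, so it contains all of \<open>Delta\<close>.\<close>
  have big: "K \<subseteq> Y" if Y: "submod S'_alg Q Y" "Y \<noteq> {?C}" for Y
  proof -
    note pre = G.quot_preimage[OF C Y(1)[unfolded Q_def]]
    obtain v where v: "v \<in> {v \<in> carrier ?A. ?c v \<in> Y}" "v \<notin> ?C"
    proof (rule ccontr)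
      assume "\<not> thesis"
      with that have "{v \<in> carrier ?A. ?c v \<in> Y} = ?C" using pre(2) by blast
      then have "Y = ?c ` ?C" using pre(3) by simp
      also have "\<dots> = {?C}" using G.cst_N[OF C] A.vs.subspace_0[OF A.submodD(1)[OF C]] by auto
      finally show False using Y(2) by simp
    qed
    then obtain l where "A.D l v \<noteq> 0" by (auto simp: AD constants_iff)
    from A.submodule_contains_Delta[OF n pre(1) v(1) this] show "K \<subseteq> Y" by (auto simp: K)
  qed
  \<comment> \<open>Both are t-derivatives. The class of t shows that K is nonzero, and d/dt maps
    the square of t to 2t, which is not constant, so the action on K is not trivial.\<close>
  have t: "mon 1 {} \<in> Delta ?A" "mon 2 {} \<in> Delta ?A"
  proof -
    have "mon 1 {} = A.D None (cscale (1/2) (mon 2 {}))" "mon 2 {} = A.D None (cscale (1/3) (mon 3 {}))"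
      by (simp_all add: AD clin_scale[OF clin_d_t] d_t_mon)
    then show "mon 1 {} \<in> Delta ?A" "mon 2 {} \<in> Delta ?A" using A.D_in_Delta by metis+
  qed
  have tC: "cscale c (mon 1 {}) \<notin> ?C" if "c \<noteq> 0" for c
  proof
    assume "cscale c (mon 1 {}) \<in> ?C"
    then have "d_t (cscale c (mon 1 {} :: 'n lau)) = 0" unfolding constants_iff by (metis d_var_simps(1))
    then show False using that by (simp add: clin_scale[OF clin_d_t])
  qed
  have Kne: "K \<noteq> {?C}"
  proof
    assume "K = {?C}"
    then have "?c (mon 1 {}) = ?C" using t K by blast
    then show False using tC[of 1] by (simp add: G.cst_eq_N[OF C])
  qed
  have CK: "?C \<in> K" using subK by (simp add: submod_def Q0)
  have KQ: "K \<subseteq> carrier Q" using subK by (simp add: submod_def)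
  show "simple_mod S'_alg (restr Q K)"
    unfolding simple_mod_def
  proof (intro conjI allI impI)
    show "\<exists>v\<in>carrier (restr Q K). v \<noteq> zero (restr Q K)" using Kne CK by (auto simp: Q0)
    fix N assume "submod S'_alg (restr Q K) N"
    then have "N \<subseteq> K" "submod S'_alg Q N" by (simp_all add: submod_restr[OF KQ])
    then show "N = {zero (restr Q K)} \<or> N = carrier (restr Q K)" using big by (auto simp: Q0)
  qed
  show "\<not> trivial_mod S'_alg (restr Q K)"
  proof
    assume "trivial_mod S'_alg (restr Q K)"
    then have "act Q d_t (?c (mon 2 {})) = ?C"
      using S'_d_t[OF n] t(2) by (auto simp: trivial_mod_def K Q0)
    then have "?c (d_t (mon 2 {})) = ?C"
      using G.quot_act[OF C S'_d_t[OF n], of "mon 2 {}"] by (simp add: Q_def)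
    then have "d_t (mon 2 {}) \<in> ?C" by (simp only: G.cst_eq_N[OF C])
    then show False using tC[of 2] by (simp add: d_t_mon)
  qed
  assume X: "submod S'_alg Q X" and Y: "submod S'_alg Q Y" and YX: "Y \<subseteq> X"
    and simple: "simple_mod S'_alg (quot (restr Q X) Y)" and nontriv: "\<not> trivial_mod S'_alg (quot (restr Q X) Y)"
  have XQ: "X \<subseteq> carrier Q" using X by (simp add: submod_def)
  have Qadd: "add Q (?c u) (?c v) = ?c (u + v)" for u v
    unfolding Q_def by (rule G.quot_add[OF C])
  \<comment> \<open>Otherwise Y contains K, and since \<open>S'\<close> maps \<open>A\<close> into
    \<open>Delta\<close>, it acts by zero on X/Y, contradicting nontriviality.\<close>
  have Y0: "Y = {?C}"
  proof (rule ccontr)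
    assume "Y \<noteq> {?C}"
    then have KY: "K \<subseteq> Y" using big Y by blast
    have Y': "\<And>u v. u \<in> Y \<Longrightarrow> v \<in> Y \<Longrightarrow> add Q u v \<in> Y" "\<And>c v. v \<in> Y \<Longrightarrow> smult Q c v \<in> Y" "Y \<subseteq> carrier Q" "?C \<in> Y"
      using Y by (simp_all add: submod_def Q0)
    \<comment> \<open>The elements of Q are cosets with their own addition rather than
      \<open>(+)\<close>, so the rules of \<open>graded_module\<close> do not apply to Q; cosets in
      Q are computed through representatives in \<open>A\<close>.\<close>
    have cosY: "coset Q Y y = Y" if "y \<in> Y" for y
    proof -
      obtain u where u: "y = ?c u" using subsetD[OF Y'(3) \<open>y \<in> Y\<close>] unfolding QC by blast
      have "w \<in> add Q y ` Y" if "w \<in> Y" for w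
      proof -
        obtain v where v: "w = ?c v" using subsetD[OF Y'(3) \<open>w \<in> Y\<close>] unfolding QC by blast
        have "smult Q (- 1) y = ?c (- u)"
          using G.quot_smult[OF C, of "- 1" u] by (simp add: u Q_def)
        then have "?c (v + - u) \<in> Y"
          using Y'(1)[OF that Y'(2)[OF \<open>y \<in> Y\<close>, of "- 1"]] Qadd[of v "- u"] by (simp add: v)
        moreover have "w = add Q y (?c (v + - u))" by (simp add: u v Qadd)
        ultimately show ?thesis by blast
      qed
      then show ?thesis using Y'(1)[OF that] by (auto simp: coset_def)
    qed
    have "act (quot (restr Q X) Y) x W = Y" if "x \<in> S'_alg" "W \<in> carrier (quot (restr Q X) Y)" for x W
    proof -
      obtain q where q: "q \<in> X" "W = coset Q Y q"
        using \<open>W \<in> carrier (quot (restr Q X) Y)\<close> by (auto simp: quot_def coset_def)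
      have actY: "coset Q Y (act Q x w) = Y" if "w \<in> carrier Q" for w
      proof -
        obtain v where v: "w = ?c v" using \<open>w \<in> carrier Q\<close> QC by auto
        have "act Q x w = ?c (x v)" using G.quot_act[OF C \<open>x \<in> S'_alg\<close>, of v] by (simp add: v Q_def)
        moreover have "x v \<in> Delta ?A" using A.S'_alg_act[OF \<open>x \<in> S'_alg\<close>, of v] by simp
        ultimately show ?thesis using KY K by (intro cosY) auto
      qed
      have "W \<subseteq> carrier Q"
      proof
        fix w assume "w \<in> W"
        then obtain y where "y \<in> Y" "w = add Q q y" by (auto simp: q coset_def)
        moreover have "q \<in> range ?c" "y \<in> range ?c"
          using subsetD[OF XQ q(1)] subsetD[OF Y'(3) \<open>y \<in> Y\<close>] by (simp_all only: QC)
        ultimately show "w \<in> carrier Q" by (auto simp: Qadd QC)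
      qed
      moreover have "W \<noteq> {}" using Y'(4) by (auto simp: q coset_def)
      ultimately have "(\<Union>w\<in>W. coset Q Y (act Q x w)) = Y" using actY by blast
      then show ?thesis by (simp add: quot_def coset_def)
    qed
    then have "trivial_mod S'_alg (quot (restr Q X) Y)"
      using simple by (simp add: trivial_mod_def simple_mod_def quot_def)
    with nontriv show False ..
  qed
  have q0: "add Q q ?C = q" if q: "q \<in> carrier Q" for q
  proof -
    obtain u where u: "q = ?c u" using q QC by auto
    have "?C = ?c 0" using G.cst_N[OF C] A.vs.subspace_0[OF A.submodD(1)[OF C]] by simp
    then have "add Q q ?C = add Q (?c u) (?c 0)" by (simp add: u)
    then show ?thesis by (simp add: Qadd u)
  qed
  have X0: "X \<noteq> {?C}"
  proof
    assume "X = {?C}"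
    moreover have "add Q ?C ?C = ?C" using q0 CK KQ by blast
    ultimately show False using simple by (auto simp: Y0 simple_mod_def quot_def coset_def)
  qed
  then have KX: "K \<subseteq> X" using big X by blast
  have "K = {zero (restr Q X)} \<or> K = carrier (restr Q X)"
  proof (rule simple_quot_zero)
    show "add (restr Q X) q (zero (restr Q X)) = q" if "q \<in> carrier (restr Q X)" for q
      using that XQ q0 by (auto simp: Q0)
    show "simple_mod S'_alg (quot (restr Q X) {zero (restr Q X)})" using simple by (simp add: Y0 Q0)
    show "submod S'_alg (restr Q X) K" using subK KX by (simp add: submod_restr[OF XQ])
  qed simp
  then show "X = K \<and> Y = {zero Q}" using Kne Y0 by (simp add: Q0)
qed

text \<open>The given isomorphism h followed by the projection modulo constants has as kernel
  exactly the vectors killed by all derivatives, because h intertwines derivatives up to nonzero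
  scalars.\<close>

lemma iso_dF0_A:
  fixes P :: "('n::{finite,linorder} oper, 'p::ab_group_add) smod"
  assumes P: "weyl_module P" "simple_mod weyl P" and iso: "iso_mod (homog weyl) P A_mod"
  shows "iso_mod (homog S'_alg) (restr (F_mod P (unit_vec i)) (diff_image P (\<lambda>_. 0))) (quot A_mod constants)"
proof -
  let ?A = "A_mod :: ('n oper, 'n lau) smod"
  let ?C = "constants :: 'n lau set"
  interpret simple_weyl_mod P by (intro simple_weyl_mod.intro weyl_mod.intro simple_weyl_mod_axioms.intro P)
  interpret A: simple_weyl_mod ?A
    by (intro simple_weyl_mod.intro weyl_mod.intro simple_weyl_mod_axioms.intro A_weyl_module A_simple)
  interpret G: graded_module "smult ?A" "twist ?A 1" "part ?A" ?A S'_alg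
    by (rule A.P_graded_module)
  note C = submod_constants[where 'n = 'n]
  let ?Q = "quot ?A ?C"
  obtain h r where h: "bij h" "\<And>u v. h (u + v) = h u + h v" "\<And>c v. h (sm c v) = cscale c (h v)"
    "\<And>p. h ` part P p \<subseteq> lau_part (p + r)"
    "\<And>p x v. x \<in> homog weyl p \<Longrightarrow> h (act P x v) = cscale (ksign (p * r)) (x (h v))"
  proof -
    obtain r h where "bij h" "\<forall>u v. h (u + v) = h u + h v" "\<forall>c v. h (sm c v) = cscale c (h v)"
      "\<forall>p. h ` part P p \<subseteq> lau_part (p + r)"
      "\<forall>p. \<forall>x\<in>homog weyl p. \<forall>v. h (act P x v) = cscale (ksign (p * r)) (x (h v))"
      using iso unfolding iso_mod_def by auto
    then show ?thesis by (intro that[of h r]) blast+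
  qed
  have h0: "h 0 = 0" using h(3)[of 0 0] by simp
  have hd: "h (u - v) = h u - h v" for u v using h(2)[of "u - v" v] by simp
  have hinj: "h u = 0 \<longleftrightarrow> u = 0" for u using h(1) h0 by (metis bij_def injD)
  have hD: "D l v = 0 \<longleftrightarrow> d_var l (h v) = 0" for l v
  proof -
    have "d_var l \<in> homog weyl (pd l)"
      using weyl_d_var by (simp add: oper_part_iff sigma_d_var)
    from h(5)[OF this, of v] have "h (D l v) = cscale (ksign (pd l * r)) (d_var l (h v))" by (simp only: D_def)
    moreover have "ksign (pd l * r) \<noteq> 0" by (simp add: ksign_def)
    ultimately show ?thesis using hinj[of "D l v"] by simp
  qed
  show ?thesis
  proof (rule iso_dF0[where r = r and \<psi> = "\<lambda>v. coset ?A ?C (h v)"])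
    show "range (\<lambda>v. coset ?A ?C (h v)) = carrier ?Q"
      using h(1) by (metis A_mod_simps(1) G.quot_carrier[OF C] bij_is_surj image_image)
    show "coset ?A ?C (h u) = coset ?A ?C (h v) \<longleftrightarrow> (\<forall>l. D l (u - v) = 0)" for u v
      by (simp only: G.cst_eq[OF C] constants_iff hD hd)
    show "coset ?A ?C (h (u + v)) = add ?Q (coset ?A ?C (h u)) (coset ?A ?C (h v))" for u v
      by (simp only: G.quot_add[OF C] h(2))
    show "coset ?A ?C (h (sm c v)) = smult ?Q c (coset ?A ?C (h v))" for c v
      using G.quot_smult[OF C, of c "h v"] by (simp add: h(3))
    show "coset ?A ?C (h u) \<in> part ?Q (p + r)" if "u \<in> part P p" for p u
      using h(4) that by (auto simp: G.quot_part[OF C])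
    show "coset ?A ?C (h (act P x u)) = smult ?Q (ksign (p * r)) (act ?Q x (coset ?A ?C (h u)))"
      if x: "x \<in> homog S'_alg p" for p x u
    proof -
      have "x \<in> homog weyl p" using x S'_alg_weyl by blast
      then have "h (act P x u) = cscale (ksign (p * r)) (x (h u))" by (rule h(5))
      then show ?thesis
        using x G.quot_act[OF C, of x "h u"] G.quot_smult[OF C, of "ksign (p * r)" "x (h u)"] by simp
    qed
    show "smult ?Q c (smult ?Q d w) = smult ?Q (c * d) w" if "w \<in> carrier ?Q" for c d w
    proof -
      from that obtain f where "w = coset ?A ?C f" by (auto simp: G.quot_carrier[OF C])
      then show ?thesis
        using G.quot_smult[OF C, of d f] G.quot_smult[OF C, of c "cscale d f"] G.quot_smult[OF C, of "c * d" f] by simp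
    qed
    show "act ?Q x w \<in> carrier ?Q" if "x \<in> S'_alg" "w \<in> carrier ?Q" for x w
    proof -
      from that obtain f where "w = coset ?A ?C f" by (auto simp: G.quot_carrier[OF C])
      then show ?thesis using G.quot_act[OF C that(1), of f] by (simp add: G.quot_carrier[OF C])
    qed
  qed
qed


text \<open>A subquotient is given by a pair Y \<subseteq> X of submodules. Its uniqueness is
  asserted for the pair itself and not merely up to isomorphism.\<close>

theorem proposition3p5:
  fixes P :: "('n::{finite,linorder} oper, 'p::ab_group_add) smod" and i :: 'n
  assumes n: "CARD('n) \<ge> 2"
    and P: "weyl_module P" "simple_mod weyl P"
  defines "F \<equiv> F_mod P (unit_vec i)"
    and "F0 \<equiv> F_mod P (\<lambda>_. 0)"
    and "dF0 \<equiv> diff_image P (\<lambda>_. 0)"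
    and "Ft \<equiv> F_tilde P (unit_vec i)"
    and "dF \<equiv> diff_image P (unit_vec i)"
    and "A \<equiv> A_mod :: ('n oper, 'n lau) smod"
  shows
    "submod S'_alg F dF0 \<and> submod S'_alg F Ft \<and> dF0 \<subseteq> Ft \<and>

     (iso_mod (homog weyl) P A \<longrightarrow>
        iso_mod (homog S'_alg) (restr F dF0) (quot A constants) \<and>
        (let Q = quot A constants; D = carrier (quot (restr A (Delta A)) constants) in
          submod S'_alg Q D \<and>
          simple_mod S'_alg (restr Q D) \<and> \<not> trivial_mod S'_alg (restr Q D) \<and>
          (\<forall>X Y. submod S'_alg Q X \<and> submod S'_alg Q Y \<and> Y \<subseteq> X \<and>
             simple_mod S'_alg (quot (restr Q X) Y) \<and>
             \<not> trivial_mod S'_alg (quot (restr Q X) Y) \<longrightarrow> X = D \<and> Y = {zero Q}))) \<and>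

     (\<not> iso_mod (homog weyl) P A \<longrightarrow>
        iso_mod (homog S'_alg) (restr F dF0) F0 \<and>
        iso_mod (homog S'_alg) F0 P \<and>
        submod S'_alg P (Delta P) \<and> simple_mod S'_alg (restr P (Delta P)) \<and>
        (\<forall>X. submod S'_alg P X \<and> simple_mod S'_alg (restr P X) \<longrightarrow> X = Delta P) \<and>
        (zero_mod (quot P (Delta P)) \<or> trivial_mod S'_alg (quot P (Delta P)))) \<and>

     (zero_mod (quot (restr F Ft) dF0) \<or> trivial_mod S'_alg (quot (restr F Ft) dF0)) \<and>

     (submod S'_alg (tensor_mod P) dF \<and>
      iso_mod (homog S'_alg) (quot F Ft) (restr (tensor_mod P) dF) \<and>
      simple_mod S'_alg (quot F Ft) \<and>
      simple_mod S'_alg (restr (tensor_mod P) dF)) \<and>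

     \<not> simple_mod S'_alg F"
proof -
  interpret simple_weyl_mod P
    by (intro simple_weyl_mod.intro weyl_mod.intro simple_weyl_mod_axioms.intro P)
  interpret P: graded_module sm \<sigma> "part P" P S'_alg
    by (rule P_graded_module)
  have 1: "submod S'_alg F dF0" "submod S'_alg F Ft"
    unfolding F_def dF0_def Ft_def by (rule submod_dF0 submod_Ft)+
  have 2: "dF0 \<subseteq> Ft"
    unfolding dF0_def Ft_def diff_image_0 F_tilde_1 using diff_Deg[OF s0_Deg] by (auto simp: diff_sq)
  have 3: "iso_mod (homog weyl) P A \<longrightarrow>
        iso_mod (homog S'_alg) (restr F dF0) (quot A constants) \<and>
        (let Q = quot A constants; D = carrier (quot (restr A (Delta A)) constants) in
          submod S'_alg Q D \<and>
          simple_mod S'_alg (restr Q D) \<and> \<not> trivial_mod S'_alg (restr Q D) \<and>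
          (\<forall>X Y. submod S'_alg Q X \<and> submod S'_alg Q Y \<and> Y \<subseteq> X \<and>
             simple_mod S'_alg (quot (restr Q X) Y) \<and>
             \<not> trivial_mod S'_alg (quot (restr Q X) Y) \<longrightarrow> X = D \<and> Y = {zero Q}))"
    unfolding Let_def F_def dF0_def A_def
    using iso_dF0_A[OF P, of i] A_quotient[OF n] by blast
  have 4: "iso_mod (homog S'_alg) (restr F dF0) F0" if nA: "\<not> iso_mod (homog weyl) P A"
    unfolding F_def dF0_def F0_def
  proof (rule iso_dF0[where r = 0 and \<psi> = s0])
    show "range s0 = carrier (F_mod P (\<lambda>_. 0))" by (simp add: carrier_F0)
    have "u = v \<longleftrightarrow> (\<forall>l. D l (u - v) = 0)" for u v
      using killed_zero[OF nA[unfolded A_def] P(2), of "u - v"] by (auto simp: D_lin)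
    then show "s0 u = s0 v \<longleftrightarrow> (\<forall>l. D l (u - v) = 0)" for u v by (metis lookup_single_eq)
    show "s0 u \<in> part (F_mod P (\<lambda>_. 0)) (p + 0)" if "u \<in> part P p" for p u
      using that by (simp add: tensor_part Pi_s0 gr.prt_iff)
    show "s0 (act P x u) = smult (F_mod P (\<lambda>_. 0)) (ksign (p * 0)) (act (F_mod P (\<lambda>_. 0)) x (s0 u))"
      if "x \<in> homog S'_alg p" for p x u
      using that pi_act_s0[of x u] by simp
    show "act (F_mod P (\<lambda>_. 0)) x w \<in> carrier (F_mod P (\<lambda>_. 0))" if "w \<in> carrier (F_mod P (\<lambda>_. 0))" for x w
      using that pi_act_Deg[of w 0 x] by (simp add: carrier_F)
  qed (simp_all add: single_add)
  have 5: "simple_mod S'_alg (restr P (Delta P)) \<and> (\<forall>X. submod S'_alg P X \<and> simple_mod S'_alg (restr P X) \<longrightarrow> X = Delta P)"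
    if nA: "\<not> iso_mod (homog weyl) P A"
    using restr_Delta_simple[OF n killed_zero[OF nA[unfolded A_def] P(2)]] by blast
  have 6: "zero_mod (quot P (Delta P)) \<or> trivial_mod S'_alg (quot P (Delta P))"
    by (rule P.zero_or_trivial[OF Delta_submod]) (rule S'_alg_act)
  have dF: "dF = diff P ` Deg 1" by (simp add: dF_def diff_image_1)
  have 7: "submod S'_alg (tensor_mod P) dF"
    using submod_dF(1)[of 0] by (simp add: dF)
  have 8: "iso_mod (homog S'_alg) (quot F Ft) (restr (tensor_mod P) dF)" "simple_mod S'_alg (quot F Ft)"
    "simple_mod S'_alg (restr (tensor_mod P) dF)"
    unfolding dF F_def Ft_def using iso_quot_F_Ft quot_F_Ft_simple[OF n] dF_simple[OF n] by blast+
  have 9: "zero_mod (quot (restr F Ft) dF0) \<or> trivial_mod S'_alg (quot (restr F Ft) dF0)"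
    unfolding F_def Ft_def dF0_def by (rule quot_Ft_dF0)
  have 10: "\<not> simple_mod S'_alg F" "iso_mod (homog S'_alg) F0 P"
    unfolding F_def F0_def by (rule F_not_simple iso_F0_P)+
  show ?thesis
    using 1 2 3 4 5 6 7 8 9 10 Delta_submod by blast
qed

end
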